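(* Let $\mathcal A_s$ be an $\mathbf{AL}$-theory which is the Girard translation $\mathcal I^*$ of an intuitionistic theory $\mathcal I$ extending $\mathbf{IL}^{\mathbb B}$, and let $\mathcal A_t$ be an $\mathbf{AL}$-theory, with parameters satisfying assumptions (A1)–(A5) of the context, in which equality is non-computational and $\mathbb B$ is computational. Assume moreover (A6): for each computational predicate symbol $P$ of $\mathcal A_s$ there is a term $m_P:\tau_{\mathbb B}\to\tau_P\to\tau_P\to\tau_P$ of $\mathcal A_t$ with (i) $\vdash_{\mathcal A_t}\mathrm W_{\tau_{\mathbb B}\to\tau_P\to\tau_P\to\tau_P}(m_P)$ and (ii) $!\mathrm W(x_1,x_2),\,!\widetilde{\mathbb B}(z,b),\,!\widetilde P(\mathbf x,\mathrm{if}(z,x_1,x_2))\vdash_{\mathcal A_t}\widetilde P(\mathbf x,m_P(b,x_1,x_2))$; and there are terms $\widetilde{\mathsf T},\widetilde{\mathsf F}$ of $\mathcal A_t$ with $\vdash_{\mathcal A_t}\widetilde{\mathbb B}(\mathsf T,\widetilde{\mathsf T})$ and $\vdash_{\mathcal A_t}\widetilde{\mathbb B}(\mathsf F,\widetilde{\mathsf F})$. Then for every formula $A$ of $\mathcal I$ and variable $z$, the sequent $!A^*[\mathsf T/z],\,!A^*[\mathsf F/z],\,!\mathbb B(z)\vdash A^*$ is witnessable in $\mathcal A_t$.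
   Context: $\mathbf{IL}^{\mathbb B}$: intuitionistic predicate logic with equality plus constants $\mathsf T,\mathsf F$, predicate $\mathbb B(z)$ with axioms $\vdash\mathbb B(\mathsf T)$, $\vdash\mathbb B(\mathsf F)$, $\vdash\neg(\mathsf T=\mathsf F)$, $A[\mathsf T/z],A[\mathsf F/z],\mathbb B(z)\vdash A$, and a function symbol $\mathrm{if}$ with $\mathrm{if}(\mathsf T,x,y)=x$, $\mathrm{if}(\mathsf F,x,y)=y$ (applied componentwise to tuples). Girard translation: $P^*=P$, $(A\wedge B)^*=A^*\otimes B^*$, $(A\to B)^*=\,!A^*\multimap B^*$, $(\forall xA)^*=\forall xA^*$, $(\exists xA)^*=\exists x!A^*$; $\mathcal I^*$ has axioms $!\Gamma^*\vdash A^*$ for each axiom $\Gamma\vdash A$ of $\mathcal I$. Intuitionistic affine logic $\mathbf{AL}$ is intuitionistic linear logic ($\otimes,\multimap,\forall,\exists,!,\bot$) with weakening; an $\mathbf{AL}$-theory extends it by symbols and axioms. Finite types are generated from $\mathbb B,\mathbb N$ by $\to$; $\mathbf{AL}^\omega$ is the Girard translation of the intuitionistic theory $\mathbf{IL}^\omega$ of finite types (extending $\mathbf{IL}^{\mathbb B}$ with typing predicates for finite types, combinators $\mathrm K,\mathrm S$ and application). Bold letters are tuples, $\varepsilon$ the empty tuple, tuple types curried/componentwise, $\mathbf t\mathbf s:=t_1\mathbf s,\dots$; $\mathrm W(x_1,\dots,x_n)$ is a list in antecedents and a $\otimes$ in succedents. Assumptions: (A1) $\mathcal A_t$ extends $\mathbf{AL}^\omega$.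 (A2) predicate symbols of $\mathcal A_s$ split into computational/non-computational and are predicate symbols of $\mathcal A_t$. (A3) each computational $n$-ary $P$ has a witnessing type $\tau_P$ and formula $\widetilde P(\mathbf x,a)$ of $\mathcal A_t$ with $\widetilde P(\mathbf x,a)\vdash P(\mathbf x)$. (A4) formulas $\mathrm W_\tau(x)$ with $\widetilde P(\mathbf x,a)\vdash\mathrm W_{\tau_P}(a)$, $\vdash\mathrm W(\mathrm K)$, $\vdash\mathrm W(\mathrm S)$, $\mathrm W_\tau(x),\mathrm W_{\tau\to\rho}(f)\vdash\mathrm W_\rho(fx)$. (A5) bounding types $\widehat{\boldsymbol\tau}$ and formulas $\forall\mathbf x\sqsubset_{\boldsymbol\tau}\mathbf a\,A$ ($\mathbf x$ not free, $\mathbf a$ of types $\widehat{\boldsymbol\tau}$) for each formula $A$ of $\mathcal A_t$ with: (Q1) $A\vdash B$ implies $\forall\mathbf x\sqsubset\mathbf a A\vdash\forall\mathbf x\sqsubset\mathbf a B$; (Q2) $\vdash\forall\mathbf x\sqsubset_{\boldsymbol\tau}\mathbf a\,!\mathrm W_{\boldsymbol\tau}(\mathbf x)$; terms $\eta,\sqcup,\circ$ in $\mathrm W$ with (C$_\eta$) $!\mathrm W(\mathbf z),!\forall\mathbf x\sqsubset\eta(\mathbf z)A\vdash A[\mathbf z/\mathbf x]$, (C$_\sqcup$) $!\mathrm W(\mathbf x_1,\mathbf x_2),!\forall\mathbf x\sqsubset(\mathbf x_1\sqcup\mathbf x_2)A\vdash\forall\mathbf x\sqsubset\mathbf x_1A\otimes\forall\mathbf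 x\sqsubset\mathbf x_2A$, (C$_\circ$) $!\mathrm W_{\boldsymbol\rho\to\widehat{\boldsymbol\tau}}(\mathbf f),!\mathrm W_{\widehat{\boldsymbol\rho}}(\mathbf z),!\forall\mathbf x\sqsubset_{\boldsymbol\tau}(\mathbf f\circ\mathbf z)A\vdash\forall\mathbf y\sqsubset_{\boldsymbol\rho}\mathbf z\,!\forall\mathbf x\sqsubset_{\boldsymbol\tau}\mathbf f\mathbf y\,A$. Witnessing types: $\tau^+_P=\tau_P$ (computational) or $\varepsilon$, $\tau^-_P=\varepsilon$; $\boldsymbol\tau^+_{A\multimap B}=(\boldsymbol\tau^+_A\to\boldsymbol\tau^+_B,\boldsymbol\tau^+_A\to\boldsymbol\tau^-_B\to\boldsymbol\tau^-_A)$, $\boldsymbol\tau^-_{A\multimap B}=(\boldsymbol\tau^+_A,\boldsymbol\tau^-_B)$; $\otimes$ concatenates; quantifiers unchanged; $\boldsymbol\tau^+_{!A}=\boldsymbol\tau^+_A$, $\boldsymbol\tau^-_{!A}=\widehat{\boldsymbol\tau^-_A}$. Interpretation: $|P(\mathbf x)|^a_\varepsilon=\widetilde P(\mathbf x,a)$ (computational), $|P(\mathbf x)|=P(\mathbf x)$ (otherwise); $|A\multimap B|^{\mathbf f,\mathbf g}_{\mathbf x,\mathbf w}=|A|^{\mathbf x}_{\mathbf g\mathbf x\mathbf w}\multimap|B|^{\mathbf f\mathbf x}_{\mathbf w}$; $|A\otimes B|^{\mathbf x,\mathbf v}_{\mathbf y,\mathbf w}=|A|^{\mathbf x}_{\mathbf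 y}\otimes|B|^{\mathbf v}_{\mathbf w}$; $|\exists zA|=\exists z|A|$, $|\forall zA|=\forall z|A|$; $|!A|^{\mathbf x}_{\mathbf a}=\,!\forall\mathbf y\sqsubset_{\boldsymbol\tau^-_A}\mathbf a|A|^{\mathbf x}_{\mathbf y}$. A sequent $\Gamma\vdash A$ is witnessable in $\mathcal A_t$ if there are closed terms $\boldsymbol\gamma,\mathbf a$ of $\mathcal A_t$ with $\vdash\mathrm W_{\boldsymbol\tau^+_\Gamma\to\boldsymbol\tau^-_A\to\boldsymbol\tau^-_\Gamma}(\boldsymbol\gamma)$, $\vdash\mathrm W_{\boldsymbol\tau^+_\Gamma\to\boldsymbol\tau^+_A}(\mathbf a)$ and $!\mathrm W(\mathbf x,\mathbf w),|\Gamma|^{\mathbf x}_{\boldsymbol\gamma\mathbf x\mathbf w}\vdash_{\mathcal A_t}|A|^{\mathbf a\mathbf x}_{\mathbf w}$.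
   Formalization: (Q1) is assumed with side formulas: from !Δ, !W(x), A ⊢ B infer !Δ, ∀x⊏a A ⊢ ∀x⊏a B (x not free in Δ); with the bare rule the claim can fail. The equality and boolean schemata of AL^ω are taken for all formulas of A_t. *)

theory Defs
  imports "HOL-Library.Multiset"
begin

section \<open>Terms and formulas\<close>

text \<open>
  First-order syntax with de Bruijn indices: a quantifier binds index 0 of its scope.
  Symbols are elements of the types \<open>'f\<close> and \<open>'p\<close>; a language is a choice of symbols
  together with their arities (\<open>None\<close> means that the symbol is not in the language).
\<close>

datatype 'f trm = Var nat | Fun 'f "'f trm list"

datatype ('f, 'p) ifm =
    IBot
  | IPred 'p "'f trm list"
  | IAnd "('f, 'p) ifm" "('f, 'p) ifm"
  | IImp "('f, 'p) ifm" "('f, 'p) ifm"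
  | IAll "('f, 'p) ifm"
  | IEx "('f, 'p) ifm"

datatype ('f, 'p) lfm =
    Bot
  | Pred 'p "'f trm list"
  | Tensor "('f, 'p) lfm" "('f, 'p) lfm"
  | Lolli "('f, 'p) lfm" "('f, 'p) lfm"
  | All "('f, 'p) lfm"
  | Ex "('f, 'p) lfm"
  | Bang "('f, 'p) lfm"

record ('f, 'p) language =
  fun_ar :: "'f \<Rightarrow> nat option"
  pred_ar :: "'p \<Rightarrow> nat option"

definition sublanguage :: "('f, 'p) language \<Rightarrow> ('f, 'p) language \<Rightarrow> bool" where
  "sublanguage L L' \<longleftrightarrow> fun_ar L \<subseteq>\<^sub>m fun_ar L' \<and> pred_ar L \<subseteq>\<^sub>m pred_ar L'"

primrec wf_trm :: "('f, 'p) language \<Rightarrow> 'f trm \<Rightarrow> bool" where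
  "wf_trm L (Var n) \<longleftrightarrow> True"
| "wf_trm L (Fun f ts) \<longleftrightarrow> fun_ar L f = Some (length ts) \<and> list_all (\<lambda>b. b) (map (wf_trm L) ts)"

primrec wf_ifm :: "('f, 'p) language \<Rightarrow> ('f, 'p) ifm \<Rightarrow> bool" where
  "wf_ifm L IBot \<longleftrightarrow> True"
| "wf_ifm L (IPred P ts) \<longleftrightarrow> pred_ar L P = Some (length ts) \<and> list_all (wf_trm L) ts"
| "wf_ifm L (IAnd A B) \<longleftrightarrow> wf_ifm L A \<and> wf_ifm L B"
| "wf_ifm L (IImp A B) \<longleftrightarrow> wf_ifm L A \<and> wf_ifm L B"
| "wf_ifm L (IAll A) \<longleftrightarrow> wf_ifm L A"
| "wf_ifm L (IEx A) \<longleftrightarrow> wf_ifm L A"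

primrec wf_lfm :: "('f, 'p) language \<Rightarrow> ('f, 'p) lfm \<Rightarrow> bool" where
  "wf_lfm L Bot \<longleftrightarrow> True"
| "wf_lfm L (Pred P ts) \<longleftrightarrow> pred_ar L P = Some (length ts) \<and> list_all (wf_trm L) ts"
| "wf_lfm L (Tensor A B) \<longleftrightarrow> wf_lfm L A \<and> wf_lfm L B"
| "wf_lfm L (Lolli A B) \<longleftrightarrow> wf_lfm L A \<and> wf_lfm L B"
| "wf_lfm L (All A) \<longleftrightarrow> wf_lfm L A"
| "wf_lfm L (Ex A) \<longleftrightarrow> wf_lfm L A"
| "wf_lfm L (Bang A) \<longleftrightarrow> wf_lfm L A"

primrec fv_trm :: "'f trm \<Rightarrow> nat set" where
  "fv_trm (Var n) = {n}"
| "fv_trm (Fun f ts) = \<Union> (set (map fv_trm ts))"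

primrec fv_lfm :: "('f, 'p) lfm \<Rightarrow> nat set" where
  "fv_lfm Bot = {}"
| "fv_lfm (Pred P ts) = \<Union> (fv_trm ` set ts)"
| "fv_lfm (Tensor A B) = fv_lfm A \<union> fv_lfm B"
| "fv_lfm (Lolli A B) = fv_lfm A \<union> fv_lfm B"
| "fv_lfm (All A) = {n. Suc n \<in> fv_lfm A}"
| "fv_lfm (Ex A) = {n. Suc n \<in> fv_lfm A}"
| "fv_lfm (Bang A) = fv_lfm A"

definition closed_trm :: "('f, 'p) language \<Rightarrow> 'f trm \<Rightarrow> bool" where
  "closed_trm L t \<longleftrightarrow> wf_trm L t \<and> fv_trm t = {}"


subsection \<open>Simultaneous substitution\<close>

primrec subst_trm :: "(nat \<Rightarrow> 'f trm) \<Rightarrow> 'f trm \<Rightarrow> 'f trm" where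
  "subst_trm \<sigma> (Var n) = \<sigma> n"
| "subst_trm \<sigma> (Fun f ts) = Fun f (map (subst_trm \<sigma>) ts)"

definition shift_trm :: "nat \<Rightarrow> 'f trm \<Rightarrow> 'f trm" where
  "shift_trm k = subst_trm (\<lambda>n. Var (n + k))"

text \<open>The substitution \<open>\<sigma>\<close> pushed under \<open>k\<close> binders.\<close>

definition lift_sub :: "nat \<Rightarrow> (nat \<Rightarrow> 'f trm) \<Rightarrow> nat \<Rightarrow> 'f trm" where
  "lift_sub k \<sigma> n = (if n < k then Var n else shift_trm k (\<sigma> (n - k)))"

primrec subst_ifm :: "(nat \<Rightarrow> 'f trm) \<Rightarrow> ('f, 'p) ifm \<Rightarrow> ('f, 'p) ifm" where
  "subst_ifm \<sigma> IBot = IBot"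
| "subst_ifm \<sigma> (IPred P ts) = IPred P (map (subst_trm \<sigma>) ts)"
| "subst_ifm \<sigma> (IAnd A B) = IAnd (subst_ifm \<sigma> A) (subst_ifm \<sigma> B)"
| "subst_ifm \<sigma> (IImp A B) = IImp (subst_ifm \<sigma> A) (subst_ifm \<sigma> B)"
| "subst_ifm \<sigma> (IAll A) = IAll (subst_ifm (lift_sub 1 \<sigma>) A)"
| "subst_ifm \<sigma> (IEx A) = IEx (subst_ifm (lift_sub 1 \<sigma>) A)"

primrec subst_lfm :: "(nat \<Rightarrow> 'f trm) \<Rightarrow> ('f, 'p) lfm \<Rightarrow> ('f, 'p) lfm" where
  "subst_lfm \<sigma> Bot = Bot"
| "subst_lfm \<sigma> (Pred P ts) = Pred P (map (subst_trm \<sigma>) ts)"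
| "subst_lfm \<sigma> (Tensor A B) = Tensor (subst_lfm \<sigma> A) (subst_lfm \<sigma> B)"
| "subst_lfm \<sigma> (Lolli A B) = Lolli (subst_lfm \<sigma> A) (subst_lfm \<sigma> B)"
| "subst_lfm \<sigma> (All A) = All (subst_lfm (lift_sub 1 \<sigma>) A)"
| "subst_lfm \<sigma> (Ex A) = Ex (subst_lfm (lift_sub 1 \<sigma>) A)"
| "subst_lfm \<sigma> (Bang A) = Bang (subst_lfm \<sigma> A)"

definition shift_lfm :: "nat \<Rightarrow> ('f, 'p) lfm \<Rightarrow> ('f, 'p) lfm" where
  "shift_lfm k = subst_lfm (\<lambda>n. Var (n + k))"

text \<open>
  \<open>A[t/z]\<close>: the free variable \<open>z\<close> is replaced, all other free variables keep their index.
  In contrast, \<open>inst ts A\<close> removes binders: it replaces the indices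
  \<open>0, \<dots>, length ts - 1\<close> by \<open>ts\<close> and lowers the remaining ones.
\<close>

definition isubst_var :: "('f, 'p) ifm \<Rightarrow> 'f trm \<Rightarrow> nat \<Rightarrow> ('f, 'p) ifm" ("_\<lbrakk>_'/'/_\<rbrakk>" [1000, 0, 0] 1000) where
  "A\<lbrakk>t//z\<rbrakk> = subst_ifm (Var(z := t)) A"

definition subst_var :: "('f, 'p) lfm \<Rightarrow> 'f trm \<Rightarrow> nat \<Rightarrow> ('f, 'p) lfm" ("_\<lbrakk>_'/_\<rbrakk>" [1000, 0, 0] 1000) where
  "A\<lbrakk>t/z\<rbrakk> = subst_lfm (Var(z := t)) A"

definition inst :: "'f trm list \<Rightarrow> ('f, 'p) lfm \<Rightarrow> ('f, 'p) lfm" where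
  "inst ts = subst_lfm (\<lambda>n. if n < length ts then ts ! n else Var (n - length ts))"


section \<open>Theories and derivability\<close>

record ('f, 'p, 'a) thy =
  lang :: "('f, 'p) language"
  axs :: "('a multiset \<times> 'a) set"

definition il_theory :: "('f, 'p, ('f, 'p) ifm) thy \<Rightarrow> bool" where
  "il_theory I \<longleftrightarrow> (\<forall>(\<Gamma>, A) \<in> axs I. (\<forall>B \<in># \<Gamma>. wf_ifm (lang I) B) \<and> wf_ifm (lang I) A)"

definition al_theory :: "('f, 'p, ('f, 'p) lfm) thy \<Rightarrow> bool" where
  "al_theory T \<longleftrightarrow> (\<forall>(\<Gamma>, A) \<in> axs T. (\<forall>B \<in># \<Gamma>. wf_lfm (lang T) B) \<and> wf_lfm (lang T) A)"

text \<open>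
  Derivability in an \<open>AL\<close>-theory: intuitionistic linear logic with weakening, over the
  formulas of the language of the theory.
\<close>

inductive entails :: "('f, 'p, ('f, 'p) lfm) thy \<Rightarrow> ('f, 'p) lfm multiset \<Rightarrow> ('f, 'p) lfm \<Rightarrow> bool"
  for T where
  axm: "(\<Gamma>, A) \<in> axs T \<Longrightarrow> entails T \<Gamma> A"
| ident: "wf_lfm (lang T) A \<Longrightarrow> entails T {#A#} A"
| cut: "entails T \<Gamma> A \<Longrightarrow> entails T (add_mset A \<Delta>) B \<Longrightarrow> entails T (\<Gamma> + \<Delta>) B"
| weaken: "entails T \<Gamma> B \<Longrightarrow> wf_lfm (lang T) A \<Longrightarrow> entails T (add_mset A \<Gamma>) B"
| botL: "wf_lfm (lang T) A \<Longrightarrow> entails T {#Bot#} A"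
| tensorR: "entails T \<Gamma> A \<Longrightarrow> entails T \<Delta> B \<Longrightarrow> entails T (\<Gamma> + \<Delta>) (Tensor A B)"
| tensorL: "entails T (add_mset A (add_mset B \<Gamma>)) C \<Longrightarrow> entails T (add_mset (Tensor A B) \<Gamma>) C"
| lolliR: "entails T (add_mset A \<Gamma>) B \<Longrightarrow> entails T \<Gamma> (Lolli A B)"
| lolliL: "entails T \<Gamma> A \<Longrightarrow> entails T (add_mset B \<Delta>) C \<Longrightarrow> entails T (add_mset (Lolli A B) (\<Gamma> + \<Delta>)) C"
| allR: "entails T (image_mset (shift_lfm 1) \<Gamma>) A \<Longrightarrow> entails T \<Gamma> (All A)"
| allL: "entails T (add_mset (inst [t] A) \<Gamma>) C \<Longrightarrow> wf_trm (lang T) t \<Longrightarrow> wf_lfm (lang T) A \<Longrightarrow>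
    entails T (add_mset (All A) \<Gamma>) C"
| exR: "entails T \<Gamma> (inst [t] A) \<Longrightarrow> wf_trm (lang T) t \<Longrightarrow> wf_lfm (lang T) A \<Longrightarrow> entails T \<Gamma> (Ex A)"
| exL: "entails T (add_mset A (image_mset (shift_lfm 1) \<Gamma>)) (shift_lfm 1 C) \<Longrightarrow>
    entails T (add_mset (Ex A) \<Gamma>) C"
| bangR: "entails T (image_mset Bang \<Gamma>) A \<Longrightarrow> entails T (image_mset Bang \<Gamma>) (Bang A)"
| bangL: "entails T (add_mset A \<Gamma>) C \<Longrightarrow> entails T (add_mset (Bang A) \<Gamma>) C"
| contract: "entails T (add_mset (Bang A) (add_mset (Bang A) \<Gamma>)) C \<Longrightarrow> entails T (add_mset (Bang A) \<Gamma>) C"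

text \<open>\<open>\<bottom>\<close> counts as an atomic formula.\<close>

primrec girard :: "('f, 'p) ifm \<Rightarrow> ('f, 'p) lfm" where
  "girard IBot = Bot"
| "girard (IPred P ts) = Pred P ts"
| "girard (IAnd A B) = Tensor (girard A) (girard B)"
| "girard (IImp A B) = Lolli (Bang (girard A)) (girard B)"
| "girard (IAll A) = All (girard A)"
| "girard (IEx A) = Ex (Bang (girard A))"

definition girard_axs :: "(('f, 'p) ifm multiset \<times> ('f, 'p) ifm) set \<Rightarrow> (('f, 'p) lfm multiset \<times> ('f, 'p) lfm) set" where
  "girard_axs X = (\<lambda>(\<Gamma>, A). (image_mset (\<lambda>B. Bang (girard B)) \<Gamma>, girard A)) ` X"

definition girard_thy :: "('f, 'p, ('f, 'p) ifm) thy \<Rightarrow> ('f, 'p, ('f, 'p) lfm) thy" where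
  "girard_thy I = \<lparr>lang = lang I, axs = girard_axs (axs I)\<rparr>"


section \<open>The theories of booleans and of finite types\<close>

datatype ty = TBool | TNat | Arrow ty ty (infixr "\<rightarrow>" 65)

record ('f, 'p) bool_symbols =
  eqP :: 'p
  boolP :: 'p
  trueF :: 'f
  falseF :: 'f
  ifF :: 'f

text \<open>
  The combinators may be given per type instance, or (as constant families) as single symbols.
  \<open>typeP \<tau>\<close> is the typing predicate of \<open>\<tau>\<close>; it is left open whether \<open>typeP TBool\<close> is \<open>boolP\<close>.
\<close>

record ('f, 'p) omega_symbols = "('f, 'p) bool_symbols" +
  appF :: 'f
  KF :: "ty \<Rightarrow> ty \<Rightarrow> 'f"
  SF :: "ty \<Rightarrow> ty \<Rightarrow> ty \<Rightarrow> 'f"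
  typeP :: "ty \<Rightarrow> 'p"

abbreviation tt :: "('f, 'p, 'e) bool_symbols_scheme \<Rightarrow> 'f trm" where
  "tt \<Sigma> \<equiv> Fun (trueF \<Sigma>) []"

abbreviation ff :: "('f, 'p, 'e) bool_symbols_scheme \<Rightarrow> 'f trm" where
  "ff \<Sigma> \<equiv> Fun (falseF \<Sigma>) []"

abbreviation ite :: "('f, 'p, 'e) bool_symbols_scheme \<Rightarrow> 'f trm \<Rightarrow> 'f trm \<Rightarrow> 'f trm \<Rightarrow> 'f trm" where
  "ite \<Sigma> z s t \<equiv> Fun (ifF \<Sigma>) [z, s, t]"

abbreviation app :: "('f, 'p) omega_symbols \<Rightarrow> 'f trm \<Rightarrow> 'f trm \<Rightarrow> 'f trm" where
  "app \<Sigma> s t \<equiv> Fun (appF \<Sigma>) [s, t]"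

abbreviation K_trm :: "('f, 'p) omega_symbols \<Rightarrow> ty \<Rightarrow> ty \<Rightarrow> 'f trm" where
  "K_trm \<Sigma> \<rho> \<sigma> \<equiv> Fun (KF \<Sigma> \<rho> \<sigma>) []"

abbreviation S_trm :: "('f, 'p) omega_symbols \<Rightarrow> ty \<Rightarrow> ty \<Rightarrow> ty \<Rightarrow> 'f trm" where
  "S_trm \<Sigma> \<rho> \<sigma> \<tau> \<equiv> Fun (SF \<Sigma> \<rho> \<sigma> \<tau>) []"

definition has_bool_symbols :: "('f, 'p, 'e) bool_symbols_scheme \<Rightarrow> ('f, 'p) language \<Rightarrow> bool" where
  "has_bool_symbols \<Sigma> L \<longleftrightarrow>
     pred_ar L (eqP \<Sigma>) = Some 2 \<and> pred_ar L (boolP \<Sigma>) = Some 1 \<and>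
     fun_ar L (trueF \<Sigma>) = Some 0 \<and> fun_ar L (falseF \<Sigma>) = Some 0 \<and> fun_ar L (ifF \<Sigma>) = Some 3"

definition has_omega_symbols :: "('f, 'p) omega_symbols \<Rightarrow> ('f, 'p) language \<Rightarrow> bool" where
  "has_omega_symbols \<Sigma> L \<longleftrightarrow>
     has_bool_symbols \<Sigma> L \<and> fun_ar L (appF \<Sigma>) = Some 2 \<and>
     (\<forall>\<rho> \<sigma>. fun_ar L (KF \<Sigma> \<rho> \<sigma>) = Some 0) \<and> (\<forall>\<rho> \<sigma> \<tau>. fun_ar L (SF \<Sigma> \<rho> \<sigma> \<tau>) = Some 0) \<and>
     (\<forall>\<tau>. pred_ar L (typeP \<Sigma> \<tau>) = Some 1)"

text \<open>
  The axioms of \<open>IL\<^sup>\<bool>\<close> over a language \<open>L\<close>. The equality and boolean axioms are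
  schemata, so a theory extending \<open>IL\<^sup>\<bool>\<close> has them for all formulas of its own language.
\<close>

inductive_set ILB_axioms :: "('f, 'p, 'e) bool_symbols_scheme \<Rightarrow> ('f, 'p) language \<Rightarrow>
    (('f, 'p) ifm multiset \<times> ('f, 'p) ifm) set"
  for \<Sigma> L where
  eq_refl: "wf_trm L t \<Longrightarrow> ({#}, IPred (eqP \<Sigma>) [t, t]) \<in> ILB_axioms \<Sigma> L"
| eq_subst: "wf_trm L s \<Longrightarrow> wf_trm L t \<Longrightarrow> wf_ifm L A \<Longrightarrow>
    ({#IPred (eqP \<Sigma>) [s, t], A\<lbrakk>s//z\<rbrakk>#}, A\<lbrakk>t//z\<rbrakk>) \<in> ILB_axioms \<Sigma> L"
| bool_true: "({#}, IPred (boolP \<Sigma>) [tt \<Sigma>]) \<in> ILB_axioms \<Sigma> L"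
| bool_false: "({#}, IPred (boolP \<Sigma>) [ff \<Sigma>]) \<in> ILB_axioms \<Sigma> L"
| true_neq_false: "({#}, IImp (IPred (eqP \<Sigma>) [tt \<Sigma>, ff \<Sigma>]) IBot) \<in> ILB_axioms \<Sigma> L"
| bool_cases: "wf_ifm L A \<Longrightarrow>
    ({#A\<lbrakk>tt \<Sigma>//z\<rbrakk>, A\<lbrakk>ff \<Sigma>//z\<rbrakk>, IPred (boolP \<Sigma>) [Var z]#}, A) \<in> ILB_axioms \<Sigma> L"
| if_true: "wf_trm L s \<Longrightarrow> wf_trm L t \<Longrightarrow>
    ({#}, IPred (eqP \<Sigma>) [ite \<Sigma> (tt \<Sigma>) s t, s]) \<in> ILB_axioms \<Sigma> L"
| if_false: "wf_trm L s \<Longrightarrow> wf_trm L t \<Longrightarrow>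
    ({#}, IPred (eqP \<Sigma>) [ite \<Sigma> (ff \<Sigma>) s t, t]) \<in> ILB_axioms \<Sigma> L"

definition extends_ILB :: "('f, 'p, 'e) bool_symbols_scheme \<Rightarrow> ('f, 'p, ('f, 'p) ifm) thy \<Rightarrow> bool" where
  "extends_ILB \<Sigma> I \<longleftrightarrow> has_bool_symbols \<Sigma> (lang I) \<and> ILB_axioms \<Sigma> (lang I) \<subseteq> axs I"

inductive_set ILomega_axioms :: "('f, 'p) omega_symbols \<Rightarrow> ('f, 'p) language \<Rightarrow>
    (('f, 'p) ifm multiset \<times> ('f, 'p) ifm) set"
  for \<Sigma> L where
  ILB: "X \<in> ILB_axioms \<Sigma> L \<Longrightarrow> X \<in> ILomega_axioms \<Sigma> L"
| K_type: "({#}, IPred (typeP \<Sigma> (\<rho> \<rightarrow> \<sigma> \<rightarrow> \<rho>)) [K_trm \<Sigma> \<rho> \<sigma>]) \<in> ILomega_axioms \<Sigma> L"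
| S_type: "({#}, IPred (typeP \<Sigma> ((\<rho> \<rightarrow> \<sigma> \<rightarrow> \<tau>) \<rightarrow> (\<rho> \<rightarrow> \<sigma>) \<rightarrow> \<rho> \<rightarrow> \<tau>)) [S_trm \<Sigma> \<rho> \<sigma> \<tau>])
    \<in> ILomega_axioms \<Sigma> L"
| app_type: "wf_trm L s \<Longrightarrow> wf_trm L t \<Longrightarrow>
    ({#IPred (typeP \<Sigma> (\<rho> \<rightarrow> \<sigma>)) [s], IPred (typeP \<Sigma> \<rho>) [t]#}, IPred (typeP \<Sigma> \<sigma>) [app \<Sigma> s t])
    \<in> ILomega_axioms \<Sigma> L"
| K_eq: "wf_trm L s \<Longrightarrow> wf_trm L t \<Longrightarrow>
    ({#}, IPred (eqP \<Sigma>) [app \<Sigma> (app \<Sigma> (K_trm \<Sigma> \<rho> \<sigma>) s) t, s]) \<in> ILomega_axioms \<Sigma> L"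
| S_eq: "wf_trm L r \<Longrightarrow> wf_trm L s \<Longrightarrow> wf_trm L t \<Longrightarrow>
    ({#}, IPred (eqP \<Sigma>) [app \<Sigma> (app \<Sigma> (app \<Sigma> (S_trm \<Sigma> \<rho> \<sigma> \<tau>) r) s) t,
      app \<Sigma> (app \<Sigma> r t) (app \<Sigma> s t)]) \<in> ILomega_axioms \<Sigma> L"

text \<open>
  The axioms of \<open>AL\<^sup>\<omega>\<close> over a language \<open>L\<close>: the Girard translation of those of \<open>IL\<^sup>\<omega>\<close>.
  As axiom schemata of an \<open>AL\<close>-theory, the translated equality and boolean schemata range
  over all \<open>AL\<close>-formulas of \<open>L\<close>, not only over translations of intuitionistic formulas.
\<close>

inductive_set ALomega_axioms :: "('f, 'p) omega_symbols \<Rightarrow> ('f, 'p) language \<Rightarrow>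
    (('f, 'p) lfm multiset \<times> ('f, 'p) lfm) set"
  for \<Sigma> L where
  translated: "X \<in> girard_axs (ILomega_axioms \<Sigma> L) \<Longrightarrow> X \<in> ALomega_axioms \<Sigma> L"
| eq_schema: "wf_trm L s \<Longrightarrow> wf_trm L t \<Longrightarrow> wf_lfm L A \<Longrightarrow>
    ({#Bang (Pred (eqP \<Sigma>) [s, t]), Bang (A\<lbrakk>s/z\<rbrakk>)#}, A\<lbrakk>t/z\<rbrakk>) \<in> ALomega_axioms \<Sigma> L"
| bool_schema: "wf_lfm L A \<Longrightarrow>
    ({#Bang (A\<lbrakk>tt \<Sigma>/z\<rbrakk>), Bang (A\<lbrakk>ff \<Sigma>/z\<rbrakk>), Bang (Pred (boolP \<Sigma>) [Var z])#}, A)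
    \<in> ALomega_axioms \<Sigma> L"

definition extends_ALomega :: "('f, 'p) omega_symbols \<Rightarrow> ('f, 'p, ('f, 'p) lfm) thy \<Rightarrow> bool" where
  "extends_ALomega \<Sigma> T \<longleftrightarrow> has_omega_symbols \<Sigma> (lang T) \<and> ALomega_axioms \<Sigma> (lang T) \<subseteq> axs T"


subsection \<open>Tuples\<close>

text \<open>\<open>fun_ty \<rho>s \<sigma>\<close> and \<open>fun_tys \<rho>s \<sigma>s\<close> are the curried function types on tuples.\<close>

definition fun_ty :: "ty list \<Rightarrow> ty \<Rightarrow> ty" where
  "fun_ty \<rho>s \<sigma> = foldr (\<rightarrow>) \<rho>s \<sigma>"

definition fun_tys :: "ty list \<Rightarrow> ty list \<Rightarrow> ty list" (infixr "\<Rrightarrow>" 65) where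
  "\<rho>s \<Rrightarrow> \<sigma>s = map (fun_ty \<rho>s) \<sigma>s"

definition apps :: "('f, 'p) omega_symbols \<Rightarrow> 'f trm list \<Rightarrow> 'f trm list \<Rightarrow> 'f trm list" where
  "apps \<Sigma> ts ss = map (\<lambda>t. foldl (app \<Sigma>) t ss) ts"

definition vars :: "nat \<Rightarrow> 'f trm list" where
  "vars n = map Var [0..<n]"

text \<open>The empty tensor is rendered as the provable formula \<open>\<bottom> \<multimap> \<bottom>\<close>.\<close>

fun tensor_list :: "('f, 'p) lfm list \<Rightarrow> ('f, 'p) lfm" where
  "tensor_list [] = Lolli Bot Bot"
| "tensor_list [A] = A"
| "tensor_list (A # As) = Tensor A (tensor_list As)"


section \<open>The interpretation\<close>

text \<open>
  The parameters of the interpretation: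
  \<^item> \<open>comp_preds\<close>: the computational predicate symbols;
  \<^item> \<open>wtype P\<close> and \<open>wfm P\<close>: the witnessing type of \<open>P\<close> and the formula \<open>P\<^sup>~(x, a)\<close>, in which the
    arguments \<open>x\<close> are the indices \<open>0, \<dots>, n - 1\<close> and \<open>a\<close> is the index \<open>n\<close>, \<open>n\<close> the arity of \<open>P\<close>;
  \<^item> \<open>Wfm \<tau>\<close>: the formula \<open>W\<^sub>\<tau>(x)\<close>, in which \<open>x\<close> is the index \<open>0\<close>;
  \<^item> \<open>hat\<close>: the bounding types of a tuple of types;
  \<^item> \<open>bq \<tau>s a A\<close>: the formula \<open>\<forall>x \<sqsubset> a. A\<close>, binding the indices \<open>0, \<dots>, length \<tau>s - 1\<close> of \<open>A\<close>.
\<close>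

record ('f, 'p) params =
  comp_preds :: "'p set"
  wtype :: "'p \<Rightarrow> ty"
  wfm :: "'p \<Rightarrow> ('f, 'p) lfm"
  Wfm :: "ty \<Rightarrow> ('f, 'p) lfm"
  hat :: "ty list \<Rightarrow> ty list"
  bq :: "ty list \<Rightarrow> 'f trm list \<Rightarrow> ('f, 'p) lfm \<Rightarrow> ('f, 'p) lfm"
  eta :: "ty list \<Rightarrow> 'f trm list"
  join :: "ty list \<Rightarrow> 'f trm list"
  circ :: "ty list \<Rightarrow> ty list \<Rightarrow> 'f trm list"

definition witP :: "('f, 'p) params \<Rightarrow> 'p \<Rightarrow> 'f trm list \<Rightarrow> 'f trm \<Rightarrow> ('f, 'p) lfm" where
  "witP \<Pi> P ts a = inst (ts @ [a]) (wfm \<Pi> P)"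

definition W_list :: "('f, 'p) params \<Rightarrow> ty list \<Rightarrow> 'f trm list \<Rightarrow> ('f, 'p) lfm list" where
  "W_list \<Pi> \<tau>s ts = map2 (\<lambda>\<tau> t. inst [t] (Wfm \<Pi> \<tau>)) \<tau>s ts"

definition W_suc :: "('f, 'p) params \<Rightarrow> ty list \<Rightarrow> 'f trm list \<Rightarrow> ('f, 'p) lfm" where
  "W_suc \<Pi> \<tau>s ts = tensor_list (W_list \<Pi> \<tau>s ts)"

text \<open>The antecedent \<open>!W(t)\<close>.\<close>

definition bangW :: "('f, 'p) params \<Rightarrow> ty list \<Rightarrow> 'f trm list \<Rightarrow> ('f, 'p) lfm multiset" where
  "bangW \<Pi> \<tau>s ts = image_mset Bang (mset (W_list \<Pi> \<tau>s ts))"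

fun tpos :: "('f, 'p) params \<Rightarrow> ('f, 'p) lfm \<Rightarrow> ty list"
  and tneg :: "('f, 'p) params \<Rightarrow> ('f, 'p) lfm \<Rightarrow> ty list" where
  "tpos \<Pi> Bot = []"
| "tpos \<Pi> (Pred P ts) = (if P \<in> comp_preds \<Pi> then [wtype \<Pi> P] else [])"
| "tpos \<Pi> (Tensor A B) = tpos \<Pi> A @ tpos \<Pi> B"
| "tpos \<Pi> (Lolli A B) = (tpos \<Pi> A \<Rrightarrow> tpos \<Pi> B) @ (tpos \<Pi> A \<Rrightarrow> tneg \<Pi> B \<Rrightarrow> tneg \<Pi> A)"
| "tpos \<Pi> (All A) = tpos \<Pi> A"
| "tpos \<Pi> (Ex A) = tpos \<Pi> A"
| "tpos \<Pi> (Bang A) = tpos \<Pi> A"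
| "tneg \<Pi> Bot = []"
| "tneg \<Pi> (Pred P ts) = []"
| "tneg \<Pi> (Tensor A B) = tneg \<Pi> A @ tneg \<Pi> B"
| "tneg \<Pi> (Lolli A B) = tpos \<Pi> A @ tneg \<Pi> B"
| "tneg \<Pi> (All A) = tneg \<Pi> A"
| "tneg \<Pi> (Ex A) = tneg \<Pi> A"
| "tneg \<Pi> (Bang A) = hat \<Pi> (tneg \<Pi> A)"

primrec fm_size :: "('f, 'p) lfm \<Rightarrow> nat" where
  "fm_size Bot = 0"
| "fm_size (Pred P ts) = 0"
| "fm_size (Tensor A B) = fm_size A + fm_size B + 1"
| "fm_size (Lolli A B) = fm_size A + fm_size B + 1"
| "fm_size (All A) = fm_size A + 1"
| "fm_size (Ex A) = fm_size A + 1"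
| "fm_size (Bang A) = fm_size A + 1"

lemma fm_size_subst [simp]: "fm_size (subst_lfm \<sigma> A) = fm_size A"
  by (induction A arbitrary: \<sigma>) auto

lemma fm_size_shift [simp]: "fm_size (shift_lfm k A) = fm_size A"
  by (simp add: shift_lfm_def)

text \<open>
  \<open>interp \<Sigma> \<Pi> A xs ys\<close> is \<open>|A|\<close> with upper tuple \<open>xs\<close> (of types \<open>\<tau>\<^sup>+\<close>) and lower tuple \<open>ys\<close>
  (of types \<open>\<tau>\<^sup>-\<close>); it is meaningful only if the lengths of the tuples are right. Both
  tuples live in the context of \<open>A\<close>, hence they are shifted under binders.
\<close>

function interp :: "('f, 'p) omega_symbols \<Rightarrow> ('f, 'p) params \<Rightarrow> ('f, 'p) lfm \<Rightarrow>
    'f trm list \<Rightarrow> 'f trm list \<Rightarrow> ('f, 'p) lfm" where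
  "interp \<Sigma> \<Pi> Bot xs ys = Bot"
| "interp \<Sigma> \<Pi> (Pred P ts) xs ys = (if P \<in> comp_preds \<Pi> then witP \<Pi> P ts (hd xs) else Pred P ts)"
| "interp \<Sigma> \<Pi> (Tensor A B) xs ys =
    (let m = length (tpos \<Pi> A); n = length (tneg \<Pi> A) in
     Tensor (interp \<Sigma> \<Pi> A (take m xs) (take n ys)) (interp \<Sigma> \<Pi> B (drop m xs) (drop n ys)))"
| "interp \<Sigma> \<Pi> (Lolli A B) xs ys =
    (let fs = take (length (tpos \<Pi> B)) xs; gs = drop (length (tpos \<Pi> B)) xs;
         us = take (length (tpos \<Pi> A)) ys; ws = drop (length (tpos \<Pi> A)) ys in
     Lolli (interp \<Sigma> \<Pi> A us (apps \<Sigma> gs (us @ ws))) (interp \<Sigma> \<Pi> B (apps \<Sigma> fs us) ws))"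
| "interp \<Sigma> \<Pi> (All A) xs ys = All (interp \<Sigma> \<Pi> A (map (shift_trm 1) xs) (map (shift_trm 1) ys))"
| "interp \<Sigma> \<Pi> (Ex A) xs ys = Ex (interp \<Sigma> \<Pi> A (map (shift_trm 1) xs) (map (shift_trm 1) ys))"
| "interp \<Sigma> \<Pi> (Bang A) xs as =
    (let k = length (tneg \<Pi> A) in
     Bang (bq \<Pi> (tneg \<Pi> A) as (interp \<Sigma> \<Pi> (shift_lfm k A) (map (shift_trm k) xs) (vars k))))"
  by pat_completeness auto

termination by (relation "measure (\<lambda>(\<Sigma>, \<Pi>, A, xs, ys). fm_size A)") auto

definition tpos_list :: "('f, 'p) params \<Rightarrow> ('f, 'p) lfm list \<Rightarrow> ty list" where
  "tpos_list \<Pi> \<Gamma> = concat (map (tpos \<Pi>) \<Gamma>)"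

definition tneg_list :: "('f, 'p) params \<Rightarrow> ('f, 'p) lfm list \<Rightarrow> ty list" where
  "tneg_list \<Pi> \<Gamma> = concat (map (tneg \<Pi>) \<Gamma>)"

primrec interp_list :: "('f, 'p) omega_symbols \<Rightarrow> ('f, 'p) params \<Rightarrow> ('f, 'p) lfm list \<Rightarrow>
    'f trm list \<Rightarrow> 'f trm list \<Rightarrow> ('f, 'p) lfm list" where
  "interp_list \<Sigma> \<Pi> [] xs ys = []"
| "interp_list \<Sigma> \<Pi> (A # \<Gamma>) xs ys =
    (let m = length (tpos \<Pi> A); n = length (tneg \<Pi> A) in
     interp \<Sigma> \<Pi> A (take m xs) (take n ys) # interp_list \<Sigma> \<Pi> \<Gamma> (drop m xs) (drop n ys))"

text \<open>
  \<open>trms L \<tau>s ts\<close>: \<open>ts\<close> is a tuple of terms matching the tuple of types \<open>\<tau>s\<close>. Terms are not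
  typed by themselves; typing is expressed by predicates of the theory.

  Here and in all the conditions below, a sequent with free variables \<open>x\<close> that do not occur in
  the formulas and terms it is about is stated for all terms in place of \<open>x\<close>; by the
  quantifier rules, this amounts to the sequent with variables.
\<close>

definition trms :: "('f, 'p) language \<Rightarrow> ty list \<Rightarrow> 'f trm list \<Rightarrow> bool" where
  "trms L \<tau>s ts \<longleftrightarrow> length ts = length \<tau>s \<and> list_all (wf_trm L) ts"

definition closed_trms :: "('f, 'p) language \<Rightarrow> ty list \<Rightarrow> 'f trm list \<Rightarrow> bool" where
  "closed_trms L \<tau>s ts \<longleftrightarrow> length ts = length \<tau>s \<and> list_all (closed_trm L) ts"

definition witnessable :: "('f, 'p) omega_symbols \<Rightarrow> ('f, 'p) params \<Rightarrow> ('f, 'p, ('f, 'p) lfm) thy \<Rightarrow>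
    ('f, 'p) lfm list \<Rightarrow> ('f, 'p) lfm \<Rightarrow> bool" where
  "witnessable \<Sigma> \<Pi> T \<Gamma> A \<longleftrightarrow>
    (let \<gamma>ty = tpos_list \<Pi> \<Gamma> \<Rrightarrow> tneg \<Pi> A \<Rrightarrow> tneg_list \<Pi> \<Gamma>;
         aty = tpos_list \<Pi> \<Gamma> \<Rrightarrow> tpos \<Pi> A in
     \<exists>\<gamma> a. closed_trms (lang T) \<gamma>ty \<gamma> \<and> closed_trms (lang T) aty a \<and>
       entails T {#} (W_suc \<Pi> \<gamma>ty \<gamma>) \<and> entails T {#} (W_suc \<Pi> aty a) \<and>
       (\<forall>xs ws. trms (lang T) (tpos_list \<Pi> \<Gamma>) xs \<longrightarrow> trms (lang T) (tneg \<Pi> A) ws \<longrightarrow>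
         entails T
           (bangW \<Pi> (tpos_list \<Pi> \<Gamma>) xs + bangW \<Pi> (tneg \<Pi> A) ws +
            mset (interp_list \<Sigma> \<Pi> \<Gamma> xs (apps \<Sigma> \<gamma> (xs @ ws))))
           (interp \<Sigma> \<Pi> A (apps \<Sigma> a xs) ws)))"


section \<open>Conditions on the parameters\<close>

definition A1 :: "('f, 'p) omega_symbols \<Rightarrow> ('f, 'p, ('f, 'p) lfm) thy \<Rightarrow> bool" where
  "A1 \<Sigma> T \<longleftrightarrow> extends_ALomega \<Sigma> T"

text \<open>The function symbols are included, since \<open>|P(t)|\<close> contains the terms \<open>t\<close> of the source theory.\<close>

definition A2 :: "('f, 'p) params \<Rightarrow> ('f, 'p, ('f, 'p) lfm) thy \<Rightarrow> ('f, 'p, ('f, 'p) lfm) thy \<Rightarrow> bool" where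
  "A2 \<Pi> S T \<longleftrightarrow> sublanguage (lang S) (lang T) \<and> comp_preds \<Pi> \<subseteq> dom (pred_ar (lang S))"

definition A3 :: "('f, 'p) params \<Rightarrow> ('f, 'p, ('f, 'p) lfm) thy \<Rightarrow> ('f, 'p, ('f, 'p) lfm) thy \<Rightarrow> bool" where
  "A3 \<Pi> S T \<longleftrightarrow> (\<forall>P n. P \<in> comp_preds \<Pi> \<longrightarrow> pred_ar (lang S) P = Some n \<longrightarrow>
     wf_lfm (lang T) (wfm \<Pi> P) \<and> fv_lfm (wfm \<Pi> P) \<subseteq> {..n} \<and>
     (\<forall>xs a. length xs = n \<longrightarrow> list_all (wf_trm (lang T)) xs \<longrightarrow> wf_trm (lang T) a \<longrightarrow>
       entails T {#witP \<Pi> P xs a#} (Pred P xs)))"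

definition A4 :: "('f, 'p) omega_symbols \<Rightarrow> ('f, 'p) params \<Rightarrow> ('f, 'p, ('f, 'p) lfm) thy \<Rightarrow>
    ('f, 'p, ('f, 'p) lfm) thy \<Rightarrow> bool" where
  "A4 \<Sigma> \<Pi> S T \<longleftrightarrow>
     (\<forall>\<tau>. wf_lfm (lang T) (Wfm \<Pi> \<tau>) \<and> fv_lfm (Wfm \<Pi> \<tau>) \<subseteq> {0}) \<and>
     (\<forall>P n xs a. P \<in> comp_preds \<Pi> \<longrightarrow> pred_ar (lang S) P = Some n \<longrightarrow> length xs = n \<longrightarrow>
       list_all (wf_trm (lang T)) xs \<longrightarrow> wf_trm (lang T) a \<longrightarrow>
       entails T {#witP \<Pi> P xs a#} (W_suc \<Pi> [wtype \<Pi> P] [a])) \<and>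
     (\<forall>\<rho> \<sigma>. entails T {#} (W_suc \<Pi> [\<rho> \<rightarrow> \<sigma> \<rightarrow> \<rho>] [K_trm \<Sigma> \<rho> \<sigma>])) \<and>
     (\<forall>\<rho> \<sigma> \<tau>. entails T {#}
       (W_suc \<Pi> [(\<rho> \<rightarrow> \<sigma> \<rightarrow> \<tau>) \<rightarrow> (\<rho> \<rightarrow> \<sigma>) \<rightarrow> \<rho> \<rightarrow> \<tau>] [S_trm \<Sigma> \<rho> \<sigma> \<tau>])) \<and>
     (\<forall>\<tau> \<rho> x f. wf_trm (lang T) x \<longrightarrow> wf_trm (lang T) f \<longrightarrow>
       entails T (mset (W_list \<Pi> [\<tau>, \<tau> \<rightarrow> \<rho>] [x, f])) (W_suc \<Pi> [\<rho>] [app \<Sigma> f x]))"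

text \<open>
  \<open>bq\<close> yields formulas of the language and, as a variable binding operator, commutes with
  substitution. The latter also yields that \<open>x\<close> is not free in \<open>\<forall>x \<sqsubset> a. A\<close>, and that the free
  variables of this formula are among the other ones of \<open>A\<close> and those of \<open>a\<close>.
\<close>

definition bq_formula :: "('f, 'p) params \<Rightarrow> ('f, 'p, ('f, 'p) lfm) thy \<Rightarrow> bool" where
  "bq_formula \<Pi> T \<longleftrightarrow> (\<forall>\<tau>s a A. trms (lang T) (hat \<Pi> \<tau>s) a \<longrightarrow> wf_lfm (lang T) A \<longrightarrow>
     wf_lfm (lang T) (bq \<Pi> \<tau>s a A) \<and>
     (\<forall>\<sigma>. (\<forall>n. wf_trm (lang T) (\<sigma> n)) \<longrightarrow>
       subst_lfm \<sigma> (bq \<Pi> \<tau>s a A) =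
       bq \<Pi> \<tau>s (map (subst_trm \<sigma>) a) (subst_lfm (lift_sub (length \<tau>s) \<sigma>) A)))"

text \<open>
  Monotonicity is a rule of the theory, and as such applies in the presence of side formulas
  \<open>!\<Delta>\<close> in which \<open>x\<close> is not free. Moreover, \<open>x\<close> ranges over elements of \<open>W\<close>, as expressed by
  \<open>Q2\<close>, so that \<open>!W(x)\<close> may be used in the premise.
\<close>

definition Q1 :: "('f, 'p) params \<Rightarrow> ('f, 'p, ('f, 'p) lfm) thy \<Rightarrow> bool" where
  "Q1 \<Pi> T \<longleftrightarrow> (\<forall>\<tau>s a \<Delta> A B. trms (lang T) (hat \<Pi> \<tau>s) a \<longrightarrow>
     (\<forall>D \<in># \<Delta>. wf_lfm (lang T) D) \<longrightarrow> wf_lfm (lang T) A \<longrightarrow> wf_lfm (lang T) B \<longrightarrow>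
     entails T (image_mset Bang (image_mset (shift_lfm (length \<tau>s)) \<Delta>) +
       bangW \<Pi> \<tau>s (vars (length \<tau>s)) + {#A#}) B \<longrightarrow>
     entails T (image_mset Bang \<Delta> + {#bq \<Pi> \<tau>s a A#}) (bq \<Pi> \<tau>s a B))"

definition Q2 :: "('f, 'p) params \<Rightarrow> ('f, 'p, ('f, 'p) lfm) thy \<Rightarrow> bool" where
  "Q2 \<Pi> T \<longleftrightarrow> (\<forall>\<tau>s a. trms (lang T) (hat \<Pi> \<tau>s) a \<longrightarrow>
     entails T {#} (bq \<Pi> \<tau>s a (Bang (W_suc \<Pi> \<tau>s (vars (length \<tau>s))))))"

definition C_eta :: "('f, 'p) omega_symbols \<Rightarrow> ('f, 'p) params \<Rightarrow> ('f, 'p, ('f, 'p) lfm) thy \<Rightarrow> bool" where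
  "C_eta \<Sigma> \<Pi> T \<longleftrightarrow> (\<forall>\<tau>s.
     closed_trms (lang T) (\<tau>s \<Rrightarrow> hat \<Pi> \<tau>s) (eta \<Pi> \<tau>s) \<and>
     entails T {#} (W_suc \<Pi> (\<tau>s \<Rrightarrow> hat \<Pi> \<tau>s) (eta \<Pi> \<tau>s)) \<and>
     (\<forall>A zs. wf_lfm (lang T) A \<longrightarrow> trms (lang T) \<tau>s zs \<longrightarrow>
       entails T (bangW \<Pi> \<tau>s zs + {#Bang (bq \<Pi> \<tau>s (apps \<Sigma> (eta \<Pi> \<tau>s) zs) A)#}) (inst zs A)))"

definition C_join :: "('f, 'p) omega_symbols \<Rightarrow> ('f, 'p) params \<Rightarrow> ('f, 'p, ('f, 'p) lfm) thy \<Rightarrow> bool" where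
  "C_join \<Sigma> \<Pi> T \<longleftrightarrow> (\<forall>\<tau>s. let jty = hat \<Pi> \<tau>s \<Rrightarrow> hat \<Pi> \<tau>s \<Rrightarrow> hat \<Pi> \<tau>s in
     closed_trms (lang T) jty (join \<Pi> \<tau>s) \<and>
     entails T {#} (W_suc \<Pi> jty (join \<Pi> \<tau>s)) \<and>
     (\<forall>A xs ys. wf_lfm (lang T) A \<longrightarrow> trms (lang T) (hat \<Pi> \<tau>s) xs \<longrightarrow> trms (lang T) (hat \<Pi> \<tau>s) ys \<longrightarrow>
       entails T
         (bangW \<Pi> (hat \<Pi> \<tau>s) xs + bangW \<Pi> (hat \<Pi> \<tau>s) ys +
          {#Bang (bq \<Pi> \<tau>s (apps \<Sigma> (join \<Pi> \<tau>s) (xs @ ys)) A)#})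
         (Tensor (bq \<Pi> \<tau>s xs A) (bq \<Pi> \<tau>s ys A))))"

text \<open>
  In the succedent of the following condition, \<open>A\<close> is under two bounded quantifiers, the inner
  one over \<open>x\<close>; since \<open>y\<close> is not free in \<open>A\<close>, the indices of \<open>A\<close> from \<open>length \<tau>s\<close> on are
  shifted past \<open>y\<close>.
\<close>

definition C_circ :: "('f, 'p) omega_symbols \<Rightarrow> ('f, 'p) params \<Rightarrow> ('f, 'p, ('f, 'p) lfm) thy \<Rightarrow> bool" where
  "C_circ \<Sigma> \<Pi> T \<longleftrightarrow> (\<forall>\<rho>s \<tau>s.
     let fty = \<rho>s \<Rrightarrow> hat \<Pi> \<tau>s; cty = fty \<Rrightarrow> hat \<Pi> \<rho>s \<Rrightarrow> hat \<Pi> \<tau>s; m = length \<rho>s in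
     closed_trms (lang T) cty (circ \<Pi> \<rho>s \<tau>s) \<and>
     entails T {#} (W_suc \<Pi> cty (circ \<Pi> \<rho>s \<tau>s)) \<and>
     (\<forall>A fs zs. wf_lfm (lang T) A \<longrightarrow> trms (lang T) fty fs \<longrightarrow> trms (lang T) (hat \<Pi> \<rho>s) zs \<longrightarrow>
       entails T
         (bangW \<Pi> fty fs + bangW \<Pi> (hat \<Pi> \<rho>s) zs +
          {#Bang (bq \<Pi> \<tau>s (apps \<Sigma> (circ \<Pi> \<rho>s \<tau>s) (fs @ zs)) A)#})
         (bq \<Pi> \<rho>s zs (Bang (bq \<Pi> \<tau>s (apps \<Sigma> (map (shift_trm m) fs) (vars m))
           (subst_lfm (lift_sub (length \<tau>s) (\<lambda>n. Var (n + m))) A))))))"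

definition A5 :: "('f, 'p) omega_symbols \<Rightarrow> ('f, 'p) params \<Rightarrow> ('f, 'p, ('f, 'p) lfm) thy \<Rightarrow> bool" where
  "A5 \<Sigma> \<Pi> T \<longleftrightarrow> bq_formula \<Pi> T \<and> Q1 \<Pi> T \<and> Q2 \<Pi> T \<and> C_eta \<Sigma> \<Pi> T \<and> C_join \<Sigma> \<Pi> T \<and> C_circ \<Sigma> \<Pi> T"

definition A6 :: "('f, 'p) omega_symbols \<Rightarrow> ('f, 'p) params \<Rightarrow> ('f, 'p, ('f, 'p) lfm) thy \<Rightarrow>
    ('f, 'p, ('f, 'p) lfm) thy \<Rightarrow> bool" where
  "A6 \<Sigma> \<Pi> S T \<longleftrightarrow>
     (\<forall>P n. P \<in> comp_preds \<Pi> \<longrightarrow> pred_ar (lang S) P = Some n \<longrightarrow>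
       (\<exists>m. closed_trm (lang T) m \<and>
         entails T {#} (W_suc \<Pi> [wtype \<Pi> (boolP \<Sigma>) \<rightarrow> wtype \<Pi> P \<rightarrow> wtype \<Pi> P \<rightarrow> wtype \<Pi> P] [m]) \<and>
         (\<forall>xs x1 x2 z b. length xs = n \<longrightarrow> list_all (wf_trm (lang T)) (xs @ [x1, x2, z, b]) \<longrightarrow>
           entails T
             (bangW \<Pi> [wtype \<Pi> P, wtype \<Pi> P] [x1, x2] +
              {#Bang (witP \<Pi> (boolP \<Sigma>) [z] b), Bang (witP \<Pi> P xs (ite \<Sigma> z x1 x2))#})
             (witP \<Pi> P xs (app \<Sigma> (app \<Sigma> (app \<Sigma> m b) x1) x2))))) \<and>
     (\<exists>t. wf_trm (lang T) t \<and> entails T {#} (witP \<Pi> (boolP \<Sigma>) [tt \<Sigma>] t)) \<and>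
     (\<exists>t. wf_trm (lang T) t \<and> entails T {#} (witP \<Pi> (boolP \<Sigma>) [ff \<Sigma>] t))"

end

theory Submission
  imports Defs
begin

text \<open>
  By induction on a formula \<open>C\<close> in the image of the Girard translation, one finds closed terms
  \<open>m\<close> merging two witnesses along a witness \<open>b\<close> of a boolean, and closed terms \<open>g\<close>
  transforming challenges, such that \<open>|C|\<close> with witness \<open>m b x1 x2\<close> and challenge \<open>w\<close>
  follows from \<open>|C|\<close> with witness \<open>x1\<close> and challenge \<open>g w\<close> if \<open>b\<close> witnesses \<open>\<bool>(T)\<close>, and
  similarly for \<open>x2\<close> and \<open>F\<close>. For atoms this is \<open>A6\<close>; for \<open>!A -o B\<close> the functions are merged
  pointwise and the bounds on the challenges to \<open>A\<close> are joined by \<open>\<squnion>\<close>; for \<open>\<exists>z !A\<close> the bound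
  \<open>a\<close> is turned into \<open>(\<lambda>w. \<eta> (g w)) \<circ> a\<close>. The theorem then follows by the boolean case
  distinction of the target theory, applied to the interpreted formula with a fresh variable in
  place of \<open>z\<close>.
\<close>

text \<open>The witnessing terms have to be closed, so they cannot branch on \<open>z\<close>
  itself: all they see of \<open>z\<close> is a witness \<open>b\<close> of its being boolean.
  \<open>A6\<close> trades \<open>if(z, x1, x2)\<close> for a term in \<open>b\<close> at atoms
  only, and the work lies in carrying this through the connectives. The bangs put in by the
  translation make it possible. In \<open>!A -o B\<close> the two given functions may raise
  different challenges to \<open>A\<close>; since \<open>A\<close> is banged, these are bounds, and
  bounds can be joined. In \<open>\<exists>z !A\<close> the bang makes the body a hypothesis that
  can be used repeatedly, although the quantifier rule supplies it only once. In the final sequent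
  every antecedent formula is banged as well, so that all derivations can be carried out as in
  intuitionistic logic. The concluding case distinction cannot be applied to \<open>|C|\<close>
  alone: only \<open>B~(z, b)\<close> is known, not \<open>B~(T, b)\<close> or
  \<open>B~(F, b)\<close>. Therefore it is applied to the implication from \<open>!B~(u, b)\<close>
  to \<open>|C[u/z]|\<close>, whose premise becomes a local assumption of each case.\<close>

subsection \<open>Substitution\<close>

lemma subst_trm_cong: "(\<And>n. n \<in> fv_trm t \<Longrightarrow> \<sigma> n = \<tau> n) \<Longrightarrow> subst_trm \<sigma> t = subst_trm \<tau> t"
  by (induction t) auto

lemma subst_trm_Var [simp]: "subst_trm Var t = t"
  by (induction t) (auto simp: map_idI)

lemma subst_trm_comp: "subst_trm \<sigma> (subst_trm \<tau> t) = subst_trm (\<lambda>n. subst_trm \<sigma> (\<tau> n)) t"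
  by (induction t) auto

lemma subst_closed_trm: "closed_trm L t \<Longrightarrow> subst_trm \<sigma> t = t"
  using subst_trm_cong[of t \<sigma> Var] by (simp add: closed_trm_def)

lemma lift_sub_Var [simp]: "lift_sub k Var = Var"
  by (auto simp: lift_sub_def shift_trm_def fun_eq_iff)

lemma lift_sub_comp:
  "subst_trm (lift_sub k \<sigma>) (lift_sub k \<tau> n) = lift_sub k (\<lambda>n. subst_trm \<sigma> (\<tau> n)) n"
  by (auto simp: lift_sub_def shift_trm_def subst_trm_comp intro!: subst_trm_cong)

lemma subst_lfm_cong: "(\<And>n. n \<in> fv_lfm A \<Longrightarrow> \<sigma> n = \<tau> n) \<Longrightarrow> subst_lfm \<sigma> A = subst_lfm \<tau> A"
proof (induction A arbitrary: \<sigma> \<tau>)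
  case (Pred P ts)
  then show ?case by (auto intro!: subst_trm_cong)
next
  case (Tensor A B)
  show ?case using Tensor.prems Tensor.IH(1)[of \<sigma> \<tau>] Tensor.IH(2)[of \<sigma> \<tau>] by auto
next
  case (Lolli A B)
  show ?case using Lolli.prems Lolli.IH(1)[of \<sigma> \<tau>] Lolli.IH(2)[of \<sigma> \<tau>] by auto
next
  case (All A)
  have "subst_lfm (lift_sub 1 \<sigma>) A = subst_lfm (lift_sub 1 \<tau>) A"
    using All.prems by (intro All.IH) (auto simp: lift_sub_def)
  then show ?case by simp
next
  case (Ex A)
  have "subst_lfm (lift_sub 1 \<sigma>) A = subst_lfm (lift_sub 1 \<tau>) A"
    using Ex.prems by (intro Ex.IH) (auto simp: lift_sub_def)
  then show ?case by simp
next
  case (Bang A)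
  show ?case using Bang.prems Bang.IH[of \<sigma> \<tau>] by auto
qed simp

lemma subst_lfm_Var [simp]: "subst_lfm Var A = A"
  by (induction A) (auto simp: map_idI)

lemma subst_lfm_comp: "subst_lfm \<sigma> (subst_lfm \<tau> A) = subst_lfm (\<lambda>n. subst_trm \<sigma> (\<tau> n)) A"
  by (induction A arbitrary: \<sigma> \<tau>) (simp_all add: subst_trm_comp lift_sub_comp[abs_def])

lemma subst_lfm_id: "(\<And>n. \<sigma> n = Var n) \<Longrightarrow> subst_lfm \<sigma> A = A"
  using subst_lfm_cong[of A \<sigma> Var] by simp

text \<open>Named so that \<open>inst\<close> becomes an ordinary substitution, to which the
  congruence and composition lemmas apply.\<close>

definition inst_sub :: "'f trm list \<Rightarrow> nat \<Rightarrow> 'f trm" where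
  "inst_sub ts n = (if n < length ts then ts ! n else Var (n - length ts))"

lemma inst_eq: "inst ts = subst_lfm (inst_sub ts)"
  by (simp add: inst_def inst_sub_def[abs_def])

lemma wf_subst_trm: "wf_trm L t \<Longrightarrow> (\<And>n. wf_trm L (\<sigma> n)) \<Longrightarrow> wf_trm L (subst_trm \<sigma> t)"
  by (induction t) (auto simp: list_all_iff)

lemma wf_shift_trm [simp]: "wf_trm L t \<Longrightarrow> wf_trm L (shift_trm k t)"
  by (simp add: shift_trm_def wf_subst_trm)

lemma wf_lift_sub: "(\<And>n. wf_trm L (\<sigma> n)) \<Longrightarrow> wf_trm L (lift_sub k \<sigma> n)"
  by (simp add: lift_sub_def)

lemma wf_subst_lfm: "wf_lfm L A \<Longrightarrow> (\<And>n. wf_trm L (\<sigma> n)) \<Longrightarrow> wf_lfm L (subst_lfm \<sigma> A)"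
proof (induction A arbitrary: \<sigma>)
  case (Pred P ts)
  then show ?case by (auto simp: list_all_iff wf_subst_trm)
qed (auto simp: wf_lift_sub)

lemma wf_shift_lfm [simp]: "wf_lfm L A \<Longrightarrow> wf_lfm L (shift_lfm k A)"
  by (simp add: shift_lfm_def wf_subst_lfm)

lemma wf_inst_sub: "list_all (wf_trm L) ts \<Longrightarrow> wf_trm L (inst_sub ts n)"
  by (simp add: inst_sub_def list_all_length)

lemma wf_inst: "wf_lfm L A \<Longrightarrow> list_all (wf_trm L) ts \<Longrightarrow> wf_lfm L (inst ts A)"
  by (simp add: inst_eq wf_subst_lfm wf_inst_sub)

lemma inst_shift: "length ts = k \<Longrightarrow> inst ts (shift_lfm k A) = A"
  by (simp add: inst_eq shift_lfm_def subst_lfm_comp inst_sub_def)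

lemma shift_trm_inst: "length ts = k \<Longrightarrow> subst_trm (inst_sub ts) (shift_trm k t) = t"
  by (simp add: shift_trm_def subst_trm_comp inst_sub_def)

lemma inst_Nil: "inst [] A = A"
  by (simp add: inst_eq inst_sub_def[abs_def])

lemma shift_0 [simp]: "shift_trm 0 t = t" "shift_lfm 0 A = A"
  by (simp_all add: shift_trm_def shift_lfm_def)

lemma subst_lift_shift_trm: "subst_trm (lift_sub k \<sigma>) (shift_trm k t) = shift_trm k (subst_trm \<sigma> t)"
  by (simp add: shift_trm_def subst_trm_comp lift_sub_def)

lemma subst_lift_shift_lfm: "subst_lfm (lift_sub k \<sigma>) (shift_lfm k A) = shift_lfm k (subst_lfm \<sigma> A)"
  by (simp add: shift_lfm_def subst_lfm_comp lift_sub_def shift_trm_def)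

text \<open>Shifting a quantified formula past a fresh index 0 shifts its body under the binder;
  instantiating that binder by the fresh variable gives the body back. This is how an eigenvariable
  is put in place of a bound variable.\<close>

lemma inst_Var0_lift_shift: "inst [Var 0] (subst_lfm (lift_sub 1 (\<lambda>n. Var (n + 1))) A) = A"
proof -
  have "subst_trm (inst_sub [Var 0]) (lift_sub 1 (\<lambda>n. Var (n + 1)) n) = (Var n :: 'a trm)" for n
    by (simp add: lift_sub_def shift_trm_def inst_sub_def)
  then show ?thesis
    by (simp add: inst_eq subst_lfm_comp subst_lfm_id)
qed

text \<open>Connects the two kinds of substitution: the axiom schemata replace a free variable and
  keep the other indices, while the quantifier rules remove a binder.\<close>

lemma subst_var0_shift: "D\<lbrakk>shift_trm 1 s/0\<rbrakk> = shift_lfm 1 (inst [s] D)"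
  by (auto simp: subst_var_def shift_lfm_def inst_eq subst_lfm_comp inst_sub_def shift_trm_def
      intro!: subst_lfm_cong)

lemma wf_girard: "wf_ifm L A \<Longrightarrow> wf_lfm L (girard A)"
  by (induction A) auto

lemma wf_trm_sublanguage: "wf_trm L t \<Longrightarrow> sublanguage L L' \<Longrightarrow> wf_trm L' t"
  by (induction t) (auto simp: sublanguage_def list_all_iff map_le_def dom_def)

lemma wf_lfm_sublanguage: "wf_lfm L A \<Longrightarrow> sublanguage L L' \<Longrightarrow> wf_lfm L' A"
proof (induction A)
  case (Pred P ts)
  then show ?case
    by (auto simp: list_all_iff wf_trm_sublanguage) (auto simp: sublanguage_def map_le_def dom_def)
qed auto

subsection \<open>Derivability from banged formulas\<close>

lemma entails_bang_context: "entails T (M + N) A \<Longrightarrow> entails T (image_mset Bang M + N) A"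
proof (induction M arbitrary: N)
  case (add B M)
  have "entails T (add_mset (Bang B) (M + N)) A"
    using add.prems by (auto intro: bangL)
  then show ?case using add.IH[of "add_mset (Bang B) N"] by simp
qed simp

lemma entails_weaken: "entails T M A \<Longrightarrow> \<forall>B \<in># N. wf_lfm (lang T) B \<Longrightarrow> entails T (M + N) A"
  by (induction N) (auto intro: weaken)

text \<open>Since the hypotheses are used under \<open>!\<close>, they may be collected in a set.\<close>

definition prov :: "('f, 'p, ('f, 'p) lfm) thy \<Rightarrow> ('f, 'p) lfm set \<Rightarrow> ('f, 'p) lfm \<Rightarrow> bool" where
  "prov T K A \<longleftrightarrow> (\<exists>M. set_mset M \<subseteq> K \<and> entails T (image_mset Bang M) A)"

lemma provI: "entails T (image_mset Bang M) A \<Longrightarrow> set_mset M \<subseteq> K \<Longrightarrow> prov T K A"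
  by (auto simp: prov_def)

lemma prov_entails: "entails T M A \<Longrightarrow> set_mset M \<subseteq> K \<Longrightarrow> prov T K A"
  using entails_bang_context[of T M "{#}" A] by (auto intro: provI)

lemma prov_mono: "prov T K A \<Longrightarrow> K \<subseteq> K' \<Longrightarrow> prov T K' A"
  by (auto simp: prov_def)

lemma prov_hyp: "A \<in> K \<Longrightarrow> wf_lfm (lang T) A \<Longrightarrow> prov T K A"
  by (rule prov_entails[OF ident]) auto

lemma prov_bang: "prov T K A \<Longrightarrow> prov T K (Bang A)"
  by (auto simp: prov_def intro: bangR)

text \<open>Several copies are merged by contraction; the case of no copy at all needs weakening,
  hence the well-formedness of \<open>B\<close>.\<close>

lemma entails_contract_replicate:
  "entails T (image_mset Bang (replicate_mset n B + N)) A \<Longrightarrow> wf_lfm (lang T) B \<Longrightarrow>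
    entails T (add_mset (Bang B) (image_mset Bang N)) A"
proof (induction n)
  case 0
  then show ?case by (auto intro: weaken)
next
  case (Suc n)
  show ?case
  proof (cases n)
    case (Suc k)
    have "entails T (image_mset Bang (replicate_mset n B + N)) A"
      using Suc.prems(1) unfolding Suc by (auto dest!: contract)
    then show ?thesis using Suc.IH Suc.prems(2) by blast
  qed (use Suc.prems in simp)
qed

lemma insert_decompose:
  assumes "set_mset M \<subseteq> insert A K"
  obtains n N where "M = replicate_mset n A + N" "set_mset N \<subseteq> K"
proof
  show "M = replicate_mset (count M A) A + filter_mset (\<lambda>x. x \<noteq> A) M"
    by (rule multiset_eqI) simp
  show "set_mset (filter_mset (\<lambda>x. x \<noteq> A) M) \<subseteq> K" using assms by auto
qed

text \<open>A formula derived from banged hypotheses may be promoted by \<open>bangR\<close>, so it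
  can be cut against a banged occurrence. The multiset \<open>N\<close> accumulates the hypotheses
  used so far.\<close>

lemma prov_cut_list:
  assumes "entails T (image_mset Bang M + image_mset Bang N) B" "\<And>A. A \<in># M \<Longrightarrow> prov T K A"
    "set_mset N \<subseteq> K"
  shows "prov T K B"
  using assms
proof (induction M arbitrary: N)
  case (add A M)
  obtain P where P: "set_mset P \<subseteq> K" "entails T (image_mset Bang P) A"
    using add.prems(2)[of A] by (auto simp: prov_def)
  have "entails T (image_mset Bang P + (image_mset Bang M + image_mset Bang N)) B"
    using add.prems(1) by (intro cut[OF bangR[OF P(2)]]) simp
  then have "entails T (image_mset Bang M + image_mset Bang (P + N)) B"
    by (simp add: ac_simps)
  from add.IH[OF this] show ?case using add.prems P by auto
qed (auto intro: provI)

lemma prov_cut: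
  assumes "prov T K A" "prov T (insert A K) B" shows "prov T K B"
proof -
  obtain M where M: "set_mset M \<subseteq> insert A K" "entails T (image_mset Bang M) B"
    using assms(2) by (auto simp: prov_def)
  obtain n N where N: "M = replicate_mset n A + N" "set_mset N \<subseteq> K"
    using M(1) by (rule insert_decompose)
  show ?thesis
    by (rule prov_cut_list[of T "replicate_mset n A" N B])
      (use assms(1) M(2) N in \<open>auto simp del: image_replicate_mset split: if_splits\<close>)
qed

lemma prov_cuts: "prov T K B \<Longrightarrow> (\<And>A. A \<in> K \<Longrightarrow> prov T K' A) \<Longrightarrow> prov T K' B"
  unfolding prov_def[of T K B] using prov_cut_list[of T _ "{#}" B K'] by auto

lemma prov_app: "entails T M B \<Longrightarrow> (\<And>A. A \<in># M \<Longrightarrow> prov T K A) \<Longrightarrow> prov T K B"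
  using prov_entails[of T M B "set_mset M"] prov_cuts by blast

lemma prov_app_bang:
  "entails T (image_mset Bang M) B \<Longrightarrow> (\<And>A. A \<in># M \<Longrightarrow> prov T K A) \<Longrightarrow> prov T K B"
  using provI[of T M B "set_mset M"] prov_cuts by blast

lemma prov_bang_E: "prov T K (Bang A) \<Longrightarrow> wf_lfm (lang T) A \<Longrightarrow> prov T K A"
  using bangL[OF ident, of T A] by (auto intro: prov_app)

lemma entails_iff_prov: "entails T {#} A \<longleftrightarrow> prov T {} A"
  by (auto simp: prov_def intro: exI[of _ "{#}"])

text \<open>The deduction theorem: the uses of \<open>A\<close>, possibly several or none, are
  gathered into a single banged copy before it is discharged.\<close>

lemma prov_imp_I:
  assumes "prov T (insert A K) B" "wf_lfm (lang T) A"
  shows "prov T K (Lolli (Bang A) B)"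
proof -
  obtain M where M: "set_mset M \<subseteq> insert A K" "entails T (image_mset Bang M) B"
    using assms(1) by (auto simp: prov_def)
  obtain n N where N: "M = replicate_mset n A + N" "set_mset N \<subseteq> K"
    using M(1) by (rule insert_decompose)
  have "entails T (add_mset (Bang A) (image_mset Bang N)) B"
    using M(2) assms(2) unfolding N by (rule entails_contract_replicate)
  then show ?thesis using N by (auto intro: provI lolliR)
qed

lemma prov_imp_E:
  assumes "prov T K (Lolli (Bang A) B)" "prov T K A" "wf_lfm (lang T) A" "wf_lfm (lang T) B"
  shows "prov T K B"
proof -
  have "entails T (add_mset (Lolli (Bang A) B) ({#Bang A#} + {#})) B"
    using assms(3,4) by (intro lolliL) (auto intro: ident prov_bang)
  from prov_app[OF this] show ?thesis using assms(1,2) by (auto intro: prov_bang)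
qed

lemma prov_tensor_I: "prov T K A \<Longrightarrow> prov T K B \<Longrightarrow> prov T K (Tensor A B)"
proof -
  assume "prov T K A" "prov T K B"
  then obtain M N where "set_mset M \<subseteq> K" "set_mset N \<subseteq> K"
    "entails T (image_mset Bang M) A" "entails T (image_mset Bang N) B"
    by (auto simp: prov_def)
  then show ?thesis
    using tensorR[of T "image_mset Bang M" A "image_mset Bang N" B] by (intro provI[of T "M + N"]) auto
qed

lemma prov_tensor_E:
  assumes "prov T K (Tensor A B)" "wf_lfm (lang T) A" "wf_lfm (lang T) B"
  shows "prov T K A" "prov T K B"
proof -
  have "entails T {#Tensor A B#} A"
    using weaken[OF ident[OF assms(2)] assms(3)] by (auto intro: tensorL simp: add_mset_commute)
  then show "prov T K A" by (rule prov_app) (use assms(1) in simp)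
  have "entails T {#Tensor A B#} B"
    using weaken[OF ident[OF assms(3)] assms(2)] by (auto intro: tensorL)
  then show "prov T K B" by (rule prov_app) (use assms(1) in simp)
qed

text \<open>\<open>allR\<close> and \<open>exL\<close> demand a context that is literally the shift
  of a multiset, while \<open>prov\<close> only says that its elements lie in the image of a set.
  The multiset is recovered here.\<close>

lemma mset_preimage:
  assumes "set_mset M \<subseteq> f ` K" obtains N where "M = image_mset f N" "set_mset N \<subseteq> K"
proof -
  from assms have "\<exists>N. M = image_mset f N \<and> set_mset N \<subseteq> K"
  proof (induction M)
    case (add x M)
    then obtain N y where "M = image_mset f N" "set_mset N \<subseteq> K" "x = f y" "y \<in> K" by auto
    then show ?case by (intro exI[of _ "add_mset y N"]) auto
  qed auto
  then show ?thesis using that by blast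
qed

lemma shift_Bang: "shift_lfm k (Bang A) = Bang (shift_lfm k A)"
  by (simp add: shift_lfm_def)

lemma prov_all_I:
  assumes "prov T (shift_lfm 1 ` K) A" shows "prov T K (All A)"
proof -
  obtain M where M: "set_mset M \<subseteq> shift_lfm 1 ` K" "entails T (image_mset Bang M) A"
    using assms by (auto simp: prov_def)
  obtain N where N: "M = image_mset (shift_lfm 1) N" "set_mset N \<subseteq> K"
    using M(1) by (rule mset_preimage)
  have "image_mset Bang M = image_mset (shift_lfm 1) (image_mset Bang N)"
    by (simp add: N image_mset.compositionality o_def shift_Bang)
  then have "entails T (image_mset Bang N) (All A)"
    using M(2) by (intro allR) (simp only:)
  then show ?thesis using N(2) by (rule provI)
qed

lemma prov_all_E:
  assumes "prov T K (All A)" "wf_trm (lang T) t" "wf_lfm (lang T) A"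
  shows "prov T K (inst [t] A)"
proof -
  have "entails T {#All A#} (inst [t] A)"
    using assms(2,3) by (auto intro!: allL[of _ t] ident wf_inst)
  then show ?thesis using assms(1) by (auto intro: prov_app)
qed

text \<open>Index 0 occurs in none of the formulas, so generalising over it and instantiating the
  quantifier again removes the shift.\<close>

lemma prov_unshift:
  assumes "prov T (shift_lfm 1 ` K) (shift_lfm 1 A)" "wf_lfm (lang T) A"
  shows "prov T K A"
proof -
  have "prov T K (inst [Var 0] (shift_lfm 1 A))"
    using prov_all_I[OF assms(1)] assms(2) by (auto intro: prov_all_E)
  then show ?thesis by (simp add: inst_shift)
qed

lemma prov_all_mono:
  assumes "prov T (insert A (shift_lfm 1 ` K)) B" "All A \<in> K" "wf_lfm (lang T) A"
  shows "prov T K (All B)"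
proof (rule prov_all_I)
  let ?A = "subst_lfm (lift_sub 1 (\<lambda>n. Var (n + 1))) A"
  have wf: "wf_lfm (lang T) ?A" using assms(3) by (simp add: wf_subst_lfm wf_lift_sub)
  have "All ?A \<in> shift_lfm 1 ` K"
    using imageI[OF assms(2), of "shift_lfm 1"] by (simp add: shift_lfm_def)
  then have "prov T (shift_lfm 1 ` K) (inst [Var 0] ?A)"
    using wf by (intro prov_all_E prov_hyp) simp_all
  then have "prov T (shift_lfm 1 ` K) A" by (simp only: inst_Var0_lift_shift)
  then show "prov T (shift_lfm 1 ` K) B" using assms(1) by (rule prov_cut)
qed

text \<open>The bang below the quantifier is essential: \<open>exL\<close> supplies one copy of the
  body, and only a banged copy can serve as a hypothesis of \<open>prov\<close>. All formulas on the
  left being banged, \<open>B\<close> can then be promoted.\<close>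

lemma prov_ex_mono:
  assumes "prov T (insert A (shift_lfm 1 ` K)) B" "prov T K (Ex (Bang A))"
    "wf_lfm (lang T) A" "wf_lfm (lang T) B"
  shows "prov T K (Ex (Bang B))"
proof -
  let ?B = "subst_lfm (lift_sub 1 (\<lambda>n. Var (n + 1))) B"
  obtain M where M: "set_mset M \<subseteq> insert A (shift_lfm 1 ` K)" "entails T (image_mset Bang M) B"
    using assms(1) by (auto simp: prov_def)
  obtain n N where N: "M = replicate_mset n A + N" "set_mset N \<subseteq> shift_lfm 1 ` K"
    using M(1) by (rule insert_decompose)
  obtain P where P: "N = image_mset (shift_lfm 1) P" "set_mset P \<subseteq> K"
    using N(2) by (rule mset_preimage)
  have "entails T (add_mset (Bang A) (image_mset Bang N)) B"
    using M(2) assms(3) unfolding N by (rule entails_contract_replicate)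
  moreover have N': "image_mset Bang N = image_mset (shift_lfm 1) (image_mset Bang P)"
    by (simp add: P image_mset.compositionality o_def shift_Bang)
  ultimately have "entails T (image_mset Bang (add_mset A N)) B" by simp
  from bangR[OF this] have "entails T (add_mset (Bang A) (image_mset (shift_lfm 1) (image_mset Bang P))) (Bang B)"
    by (simp add: N')
  \<comment> \<open>The existential quantifier on the right is witnessed by the eigenvariable
    itself.\<close>
  also have "Bang B = inst [Var 0] (Bang ?B)"
    using inst_Var0_lift_shift[of B] by (simp add: inst_eq)
  finally have "entails T (add_mset (Bang A) (image_mset (shift_lfm 1) (image_mset Bang P)))
      (Ex (Bang ?B))"
    using assms(4) by (intro exR) (auto simp: wf_subst_lfm wf_lift_sub)
  also have "Ex (Bang ?B) = shift_lfm 1 (Ex (Bang B))" by (simp add: shift_lfm_def)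
  finally have *: "entails T (add_mset (Ex (Bang A)) (image_mset Bang P)) (Ex (Bang B))" by (rule exL)
  have "entails T (image_mset Bang {#Ex (Bang A)#} + image_mset Bang P) (Ex (Bang B))"
    using bangL[OF *] by simp
  from prov_cut_list[OF this _ P(2)] show ?thesis using assms(2) by auto
qed

text \<open>The way back to a sequent with a prescribed antecedent: \<open>N\<close> is added by
  weakening, and each formula actually used is then contracted with its copy in
  \<open>N\<close>.\<close>

lemma entails_if_prov:
  assumes "prov T K A" "K \<subseteq> set_mset N" "\<forall>B \<in># N. wf_lfm (lang T) B"
  shows "entails T (image_mset Bang N) A"
proof -
  obtain M where M: "set_mset M \<subseteq> set_mset N" "entails T (image_mset Bang M) A"
    using assms(1,2) by (auto simp: prov_def)
  have "entails T (image_mset Bang N + image_mset Bang M') A"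
    if "entails T (image_mset Bang (N + M)+ image_mset Bang M') A" "set_mset M \<subseteq> set_mset N" for M M'
    using that
  proof (induction M arbitrary: M')
    case (add B M)
    obtain N' where N': "N = add_mset B N'" using add.prems(2) by (auto dest: multi_member_split)
    have "entails T (add_mset (Bang B) (add_mset (Bang B) (image_mset Bang N' + image_mset Bang M + image_mset Bang M'))) A"
      using add.prems(1) by (simp add: N' ac_simps)
    then have "entails T (add_mset (Bang B) (image_mset Bang N' + image_mset Bang M + image_mset Bang M')) A"
      by (rule contract)
    then show ?case using add.IH[of M'] add.prems(2) by (simp add: N' ac_simps)
  qed auto
  from this[of M "{#}"] show ?thesis
    using entails_weaken[OF M(2), of "image_mset Bang N"] M(1) assms(3) by (auto simp: ac_simps)
qed

subsection \<open>Equality and booleans in the target theory\<close>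

locale target =
  fixes \<Sigma> :: "('f, 'p) omega_symbols" and \<Pi> :: "('f, 'p) params"
    and S T :: "('f, 'p, ('f, 'p) lfm) thy"
  assumes A1: "A1 \<Sigma> T" and A2: "A2 \<Pi> S T" and A3: "A3 \<Pi> S T"
    and A4: "A4 \<Sigma> \<Pi> S T" and A5: "A5 \<Sigma> \<Pi> T"
begin

abbreviation wft :: "'f trm \<Rightarrow> bool" where "wft \<equiv> wf_trm (lang T)"
abbreviation wff :: "('f, 'p) lfm \<Rightarrow> bool" where "wff \<equiv> wf_lfm (lang T)"
abbreviation proves :: "('f, 'p) lfm set \<Rightarrow> ('f, 'p) lfm \<Rightarrow> bool" (infix "\<tturnstile>" 40) where
  "K \<tturnstile> A \<equiv> prov T K A"

lemma symbols [simp]: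
  "pred_ar (lang T) (eqP \<Sigma>) = Some (Suc (Suc 0))" "pred_ar (lang T) (boolP \<Sigma>) = Some (Suc 0)"
  "fun_ar (lang T) (trueF \<Sigma>) = Some 0" "fun_ar (lang T) (falseF \<Sigma>) = Some 0"
  "fun_ar (lang T) (ifF \<Sigma>) = Some (Suc (Suc (Suc 0)))" "fun_ar (lang T) (appF \<Sigma>) = Some (Suc (Suc 0))"
  "fun_ar (lang T) (KF \<Sigma> \<rho> \<sigma>) = Some 0" "fun_ar (lang T) (SF \<Sigma> \<rho> \<sigma> \<tau>) = Some 0"
  using A1 by (auto simp: A1_def extends_ALomega_def has_omega_symbols_def has_bool_symbols_def
      eval_nat_numeral)

lemma wft_simps [simp]:
  "wft (app \<Sigma> s t) \<longleftrightarrow> wft s \<and> wft t" "wft (tt \<Sigma>)" "wft (ff \<Sigma>)"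
  "wft (ite \<Sigma> r s t) \<longleftrightarrow> wft r \<and> wft s \<and> wft t"
  "wft (K_trm \<Sigma> \<rho> \<sigma>)" "wft (S_trm \<Sigma> \<rho> \<sigma> \<tau>)"
  "wff (Pred (eqP \<Sigma>) [s, t]) \<longleftrightarrow> wft s \<and> wft t" "wff (Pred (boolP \<Sigma>) [t]) \<longleftrightarrow> wft t"
  by simp_all

lemma omega_axiom:
  assumes "({#}, A) \<in> ILomega_axioms \<Sigma> (lang T)" shows "K \<tturnstile> girard A"
proof -
  have "({#}, girard A) \<in> girard_axs (ILomega_axioms \<Sigma> (lang T))"
    using assms by (force simp: girard_axs_def)
  then have "({#}, girard A) \<in> axs T"
    using A1 by (auto simp: A1_def extends_ALomega_def intro: ALomega_axioms.translated)
  then show ?thesis by (intro prov_entails[OF axm]) auto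
qed

lemma eq_refl: "wft t \<Longrightarrow> K \<tturnstile> Pred (eqP \<Sigma>) [t, t]"
  using omega_axiom[of "IPred (eqP \<Sigma>) [t, t]"] by (simp add: ILomega_axioms.ILB ILB_axioms.eq_refl)

text \<open>The axiom is taken at shifted terms, with index 0 as the replaced variable. Then index 0
  no longer occurs in it, and \<open>prov_unshift\<close> gives the rule for
  \<open>inst\<close>.\<close>

lemma eq_rule:
  assumes "K \<tturnstile> Pred (eqP \<Sigma>) [s, t]" "K \<tturnstile> inst [s] D" "wft s" "wft t" "wff D"
  shows "K \<tturnstile> inst [t] D"
proof -
  let ?K = "{Pred (eqP \<Sigma>) [s, t], inst [s] D}"
  have "({#Bang (Pred (eqP \<Sigma>) [shift_trm 1 s, shift_trm 1 t]), Bang (D\<lbrakk>shift_trm 1 s/0\<rbrakk>)#},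
      D\<lbrakk>shift_trm 1 t/0\<rbrakk>) \<in> axs T"
    using A1 assms(3-5) unfolding A1_def extends_ALomega_def
    by (blast intro: ALomega_axioms.eq_schema wf_shift_trm)
  then have "shift_lfm 1 ` ?K \<tturnstile> shift_lfm 1 (inst [t] D)"
    unfolding subst_var0_shift
    by (intro provI[of T "{#Pred (eqP \<Sigma>) [shift_trm 1 s, shift_trm 1 t], shift_lfm 1 (inst [s] D)#}"])
      (auto dest: axm simp: shift_lfm_def shift_trm_def)
  then have "?K \<tturnstile> inst [t] D"
    using assms by (rule_tac prov_unshift) (auto simp: wf_inst)
  then show ?thesis by (rule prov_cuts) (use assms(1,2) in auto)
qed

text \<open>The axiom speaks of a variable. Discharging its boolean hypothesis and generalising over
  the variable extends it to an arbitrary term \<open>u\<close>.\<close>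

lemma bool_rule:
  assumes "K \<tturnstile> inst [tt \<Sigma>] D" "K \<tturnstile> inst [ff \<Sigma>] D" "K \<tturnstile> Pred (boolP \<Sigma>) [u]" "wft u" "wff D"
  shows "K \<tturnstile> inst [u] D"
proof -
  let ?K = "{inst [tt \<Sigma>] D, inst [ff \<Sigma>] D}" and ?B = "\<lambda>u. Pred (boolP \<Sigma>) [u]"
  have "({#Bang (D\<lbrakk>tt \<Sigma>/0\<rbrakk>), Bang (D\<lbrakk>ff \<Sigma>/0\<rbrakk>), Bang (?B (Var 0))#}, D) \<in> axs T"
    using A1 assms(5) unfolding A1_def extends_ALomega_def by (blast intro: ALomega_axioms.bool_schema)
  then have "insert (?B (Var 0)) (shift_lfm 1 ` ?K) \<tturnstile> D"
    using subst_var0_shift[of D "tt \<Sigma>"] subst_var0_shift[of D "ff \<Sigma>"]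
    by (intro provI[of T "{#D\<lbrakk>tt \<Sigma>/0\<rbrakk>, D\<lbrakk>ff \<Sigma>/0\<rbrakk>, ?B (Var 0)#}"]) (auto dest: axm simp: shift_trm_def)
  then have "?K \<tturnstile> All (Lolli (Bang (?B (Var 0))) D)"
    by (intro prov_all_I prov_imp_I) simp_all
  then have "?K \<tturnstile> inst [u] (Lolli (Bang (?B (Var 0))) D)"
    using assms(4,5) by (intro prov_all_E) simp_all
  moreover have "inst [u] (Lolli (Bang (?B (Var 0))) D) = Lolli (Bang (?B u)) (inst [u] D)"
    by (simp add: inst_def)
  ultimately have "K \<tturnstile> Lolli (Bang (?B u)) (inst [u] D)"
    using prov_cuts[of T ?K _ K] assms(1,2) by auto
  then show ?thesis by (rule prov_imp_E) (use assms(3-5) in \<open>simp_all add: wf_inst\<close>)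
qed

text \<open>Equations are asked to hold without hypotheses, as they come from the combinator and
  \<open>if\<close> axioms; they may then be used with any \<open>K\<close>. Well-formedness is
  included to keep side conditions out of chains of equations.\<close>

definition eqv :: "'f trm \<Rightarrow> 'f trm \<Rightarrow> bool" (infix "\<approx>" 50) where
  "s \<approx> t \<longleftrightarrow> wft s \<and> wft t \<and> {} \<tturnstile> Pred (eqP \<Sigma>) [s, t]"

abbreviation eqvs :: "'f trm list \<Rightarrow> 'f trm list \<Rightarrow> bool" (infix "\<approx>\<^sub>l" 50) where
  "ss \<approx>\<^sub>l ts \<equiv> list_all2 (\<approx>) ss ts"

lemma eqv_refl: "wft t \<Longrightarrow> t \<approx> t"
  by (simp add: eqv_def eq_refl)

lemma eqv_subst1:
  assumes "s \<approx> t" "K \<tturnstile> subst_lfm (\<sigma>(i := s)) A" "\<And>n. wft (\<sigma> n)" "wff A"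
  shows "K \<tturnstile> subst_lfm (\<sigma>(i := t)) A"
proof -
  \<comment> \<open>Index \<open>i\<close> is abstracted: index 0 of \<open>D\<close> is its
    placeholder, and everything else is shifted past it.\<close>
  define D where "D = subst_lfm (\<lambda>n. if n = i then Var 0 else shift_trm 1 (\<sigma> n)) A"
  have inst: "inst [r] D = subst_lfm (\<sigma>(i := r)) A" for r
    unfolding D_def inst_eq subst_lfm_comp
    by (intro arg_cong[of _ _ "\<lambda>\<sigma>. subst_lfm \<sigma> A"]) (auto simp: fun_eq_iff shift_trm_inst inst_sub_def)
  have "wff D" using assms(3,4) unfolding D_def by (intro wf_subst_lfm) auto
  then show ?thesis
    using assms(1,2) eq_rule[of K s t D] prov_mono[of T "{}" _ K] unfolding inst eqv_def by blast
qed

lemma eqv_subst: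
  assumes "K \<tturnstile> subst_lfm \<sigma> A" "\<And>n. n < k \<Longrightarrow> \<sigma> n \<approx> \<tau> n" "\<And>n. n \<ge> k \<Longrightarrow> \<sigma> n = \<tau> n"
    "\<And>n. wft (\<sigma> n)" "\<And>n. wft (\<tau> n)" "wff A"
  shows "K \<tturnstile> subst_lfm \<tau> A"
proof -
  \<comment> \<open>The indices are changed one at a time; \<open>\<rho> j\<close> is the
    substitution after the first \<open>j\<close> of them.\<close>
  define \<rho> where "\<rho> j n = (if n < j then \<tau> n else \<sigma> n)" for j n
  have "K \<tturnstile> subst_lfm (\<rho> j) A" if "j \<le> k" for j
    using that
  proof (induction j)
    case 0
    then show ?case using assms(1) by (simp add: \<rho>_def)
  next
    case (Suc j)
    have *: "(\<rho> j)(j := \<sigma> j) = \<rho> j" "(\<rho> j)(j := \<tau> j) = \<rho> (Suc j)"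
      by (auto simp: \<rho>_def fun_eq_iff)
    show ?case
    proof (rule eqv_subst1[of "\<sigma> j" "\<tau> j" K "\<rho> j" j A, unfolded *])
      show "K \<tturnstile> subst_lfm (\<rho> j) A" using Suc by simp
      show "wft (\<rho> j n)" for n using assms(4,5) by (simp add: \<rho>_def)
    qed (use Suc.prems assms(2,6) in auto)
  qed
  moreover have "\<rho> k = \<tau>" using assms(3) by (auto simp: \<rho>_def fun_eq_iff)
  ultimately show ?thesis by force
qed

lemma eqvs_inst:
  assumes "ss \<approx>\<^sub>l ts" "K \<tturnstile> inst ss A" "wff A" shows "K \<tturnstile> inst ts A"
  unfolding inst_eq
proof (rule eqv_subst)
  have wf: "list_all wft ss" "list_all wft ts"
    using assms(1) by (auto simp: list_all2_conv_all_nth list_all_length eqv_def)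
  show "K \<tturnstile> subst_lfm (inst_sub ss) A" using assms(2) by (simp add: inst_eq)
  show "wft (inst_sub ss n)" "wft (inst_sub ts n)" for n using wf by (auto intro: wf_inst_sub)
  show "inst_sub ss n \<approx> inst_sub ts n" if "n < length ss" for n
    using that assms(1) by (auto simp: inst_sub_def list_all2_conv_all_nth)
  show "inst_sub ss n = inst_sub ts n" if "length ss \<le> n" for n
    using that assms(1) by (auto simp: inst_sub_def dest: list_all2_lengthD)
qed fact

lemma eqv_inst_trm:
  assumes "ss \<approx>\<^sub>l ts" "wft r" shows "subst_trm (inst_sub ss) r \<approx> subst_trm (inst_sub ts) r"
proof -
  \<comment> \<open>The left side of the equation is shifted past the placeholders, so that
    instantiation leaves it fixed while the right side varies. Reflexivity at \<open>ss\<close> is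
    then transported to \<open>ts\<close>.\<close>
  define l where "l = shift_trm (length ss) (subst_trm (inst_sub ss) r)"
  have wf: "list_all wft ss" "list_all wft ts" and len: "length ts = length ss"
    using assms(1) by (auto simp: list_all2_conv_all_nth list_all_length eqv_def)
  have wfs: "wft (subst_trm (inst_sub ss) r)" "wft (subst_trm (inst_sub ts) r)"
    using assms(2) wf by (auto intro!: wf_subst_trm wf_inst_sub)
  have inst: "inst us (Pred (eqP \<Sigma>) [l, r]) =
      Pred (eqP \<Sigma>) [subst_trm (inst_sub ss) r, subst_trm (inst_sub us) r]" if "length us = length ss" for us
    using that by (simp add: inst_eq l_def shift_trm_inst)
  have "{} \<tturnstile> inst ss (Pred (eqP \<Sigma>) [l, r])" using wfs by (simp add: inst eq_refl)
  then have "{} \<tturnstile> inst ts (Pred (eqP \<Sigma>) [l, r])"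
    using assms wfs by (rule_tac eqvs_inst) (auto simp: l_def)
  then show ?thesis using wfs len by (simp add: eqv_def inst)
qed

lemma eqv_sym: assumes "s \<approx> t" shows "t \<approx> s"
proof -
  let ?D = "Pred (eqP \<Sigma>) [Var 0, shift_trm 1 s]"
  have inst: "inst [r] ?D = Pred (eqP \<Sigma>) [r, s]" for r
    using shift_trm_inst[of "[r]" 1 s] by (simp add: inst_eq inst_sub_def)
  have "{} \<tturnstile> inst [t] ?D"
    using assms by (rule_tac eqvs_inst[of "[s]"]) (auto simp: inst eq_refl eqv_def simp del: One_nat_def)
  then show ?thesis using assms unfolding inst by (simp add: eqv_def)
qed

lemma eqv_trans [trans]: assumes "r \<approx> s" "s \<approx> t" shows "r \<approx> t"
proof -
  let ?D = "Pred (eqP \<Sigma>) [shift_trm 1 r, Var 0]"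
  have inst: "inst [u] ?D = Pred (eqP \<Sigma>) [r, u]" for u
    using shift_trm_inst[of "[u]" 1 r] by (simp add: inst_eq inst_sub_def)
  have "{} \<tturnstile> inst [t] ?D"
    using assms by (rule_tac eqvs_inst[of "[s]"]) (auto simp: inst eqv_def simp del: One_nat_def)
  then show ?thesis using assms unfolding inst by (simp add: eqv_def)
qed

lemma eqv_app: assumes "s \<approx> s'" "t \<approx> t'" shows "app \<Sigma> s t \<approx> app \<Sigma> s' t'"
  using eqv_inst_trm[of "[s, t]" "[s', t']" "app \<Sigma> (Var 0) (Var 1)"] assms by (simp add: inst_sub_def)

lemma eqv_foldl: "s \<approx> s' \<Longrightarrow> ts \<approx>\<^sub>l ts' \<Longrightarrow> foldl (app \<Sigma>) s ts \<approx> foldl (app \<Sigma>) s' ts'"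
proof (induction ts arbitrary: s s' ts')
  case (Cons t ts)
  obtain u us where "ts' = u # us" "t \<approx> u" "ts \<approx>\<^sub>l us"
    using Cons.prems(2) by (auto simp: list_all2_Cons1)
  then show ?case using Cons.IH[OF eqv_app[OF Cons.prems(1)]] by simp
qed simp

lemma eqvs_refl: "list_all wft ts \<Longrightarrow> ts \<approx>\<^sub>l ts"
  by (auto simp: list_all_length list_all2_conv_all_nth eqv_refl)

lemma eqvs_sym: "ss \<approx>\<^sub>l ts \<Longrightarrow> ts \<approx>\<^sub>l ss"
  by (auto simp: list_all2_conv_all_nth eqv_sym)

lemma wft_foldl: "wft t \<Longrightarrow> list_all wft ts \<Longrightarrow> wft (foldl (app \<Sigma>) t ts)"
  by (induction ts arbitrary: t) auto

lemma wft_apps: "list_all wft ss \<Longrightarrow> list_all wft ts \<Longrightarrow> list_all wft (apps \<Sigma> ss ts)"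
  by (auto simp: apps_def list_all_iff wft_foldl)

lemma length_apps [simp]: "length (apps \<Sigma> ss ts) = length ss"
  by (simp add: apps_def)

lemma subst_foldl: "subst_trm \<sigma> (foldl (app \<Sigma>) t ts) = foldl (app \<Sigma>) (subst_trm \<sigma> t) (map (subst_trm \<sigma>) ts)"
  by (induction ts arbitrary: t) auto

lemma map_subst_apps:
  "map (subst_trm \<sigma>) (apps \<Sigma> ss ts) = apps \<Sigma> (map (subst_trm \<sigma>) ss) (map (subst_trm \<sigma>) ts)"
  by (simp add: apps_def subst_foldl)

subsection \<open>The interpretation under substitution\<close>

lemma length_fun_tys [simp]: "length (\<rho>s \<Rrightarrow> \<sigma>s) = length \<sigma>s"
  by (simp add: fun_tys_def)

lemma length_vars [simp]: "length (vars k) = k"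
  by (simp add: vars_def)

lemma wft_vars [simp]: "list_all wft (vars k)"
  by (simp add: vars_def list_all_iff)

lemma tpos_tneg_subst [simp]:
  "tpos \<Pi> (subst_lfm \<sigma> A) = tpos \<Pi> A" "tneg \<Pi> (subst_lfm \<sigma> A) = tneg \<Pi> A"
  by (induction A arbitrary: \<sigma>) simp_all

lemma tpos_tneg_shift [simp]: "tpos \<Pi> (shift_lfm k A) = tpos \<Pi> A" "tneg \<Pi> (shift_lfm k A) = tneg \<Pi> A"
  by (simp_all add: shift_lfm_def)

lemma map_shift_map: "map (subst_trm (lift_sub k \<sigma>)) (map (shift_trm k) ts) =
    map (shift_trm k) (map (subst_trm \<sigma>) ts)"
  by (simp add: subst_lift_shift_trm)

lemma map_lift_vars: "map (subst_trm (lift_sub k \<sigma>)) (vars k) = vars k"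
  by (simp add: vars_def lift_sub_def)

text \<open>\<open>A3\<close>, \<open>A4\<close> and \<open>A6\<close> speak of arities in the
  source language, whereas well-formedness is checked in the target language. By \<open>A2\<close>
  the two agree on computational symbols.\<close>

lemma comp_pred_ar: "P \<in> comp_preds \<Pi> \<Longrightarrow> pred_ar (lang T) P = Some n \<Longrightarrow> pred_ar (lang S) P = Some n"
  using A2 by (auto simp: A2_def sublanguage_def map_le_def dom_def subset_iff)

lemma witP_wf:
  assumes "P \<in> comp_preds \<Pi>" "pred_ar (lang T) P = Some (length ts)" "list_all wft ts" "wft a"
  shows "wff (witP \<Pi> P ts a)"
  using A3 assms comp_pred_ar unfolding A3_def witP_def by (intro wf_inst) auto

lemma witP_subst:
  assumes "P \<in> comp_preds \<Pi>" "pred_ar (lang T) P = Some (length ts)"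
  shows "subst_lfm \<sigma> (witP \<Pi> P ts a) = witP \<Pi> P (map (subst_trm \<sigma>) ts) (subst_trm \<sigma> a)"
proof -
  have "fv_lfm (wfm \<Pi> P) \<subseteq> {..length ts}"
    using A3 assms comp_pred_ar unfolding A3_def by auto
  then show ?thesis
    unfolding witP_def inst_eq subst_lfm_comp
    by (intro subst_lfm_cong) (auto simp: inst_sub_def nth_append less_Suc_eq_le nth_Cons' dest!: subsetD)
qed

lemma bq_wf: "trms (lang T) (hat \<Pi> \<tau>s) a \<Longrightarrow> wff A \<Longrightarrow> wff (bq \<Pi> \<tau>s a A)"
  using A5 by (auto simp: A5_def bq_formula_def)

lemma bq_subst: "trms (lang T) (hat \<Pi> \<tau>s) a \<Longrightarrow> wff A \<Longrightarrow> (\<And>n. wft (\<sigma> n)) \<Longrightarrow>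
   subst_lfm \<sigma> (bq \<Pi> \<tau>s a A) = bq \<Pi> \<tau>s (map (subst_trm \<sigma>) a) (subst_lfm (lift_sub (length \<tau>s) \<sigma>) A)"
  using A5 by (auto simp: A5_def bq_formula_def)

lemma trmsD: "trms L \<tau>s ts \<Longrightarrow> length ts = length \<tau>s" "trms L \<tau>s ts \<Longrightarrow> list_all (wf_trm L) ts"
  by (auto simp: trms_def)

lemma trms_append: "trms L (\<tau>s @ \<rho>s) ts \<longleftrightarrow>
    trms L \<tau>s (take (length \<tau>s) ts) \<and> trms L \<rho>s (drop (length \<tau>s) ts)"
proof -
  have "list_all (wf_trm L) ts \<longleftrightarrow> list_all (wf_trm L) (take (length \<tau>s) ts) \<and> list_all (wf_trm L) (drop (length \<tau>s) ts)"
    by (metis append_take_drop_id list_all_append)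
  then show ?thesis by (auto simp: trms_def)
qed

lemma trms_append_append: "length ss = length \<tau>s \<Longrightarrow> trms L (\<tau>s @ \<rho>s) (ss @ ts) \<longleftrightarrow> trms L \<tau>s ss \<and> trms L \<rho>s ts"
  by (simp add: trms_append)

lemma trms_map: "trms L \<tau>s ts \<Longrightarrow> (\<And>t. wf_trm L t \<Longrightarrow> wf_trm L (f t)) \<Longrightarrow> trms L \<tau>s (map f ts)"
  by (auto simp: trms_def list_all_iff)

lemma trms_vars [simp]: "trms (lang T) \<tau>s (vars (length \<tau>s))"
  by (simp add: trms_def)

lemma map_subst_Var [simp]: "map (subst_trm Var) ts = ts"
  by (simp add: map_idI)

text \<open>Both claims are proved together, because bounded quantification is known to commute with
  substitution only for a well-formed body. The induction is on \<open>fm_size\<close>, since for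
  \<open>!B\<close> the interpretation continues with a shift of \<open>B\<close>, which is not a
  subformula.\<close>

lemma interp_wf_subst:
  assumes "wff A" "trms (lang T) (tpos \<Pi> A) xs" "trms (lang T) (tneg \<Pi> A) ys" "\<And>n. wft (\<sigma> n)"
  shows "wff (interp \<Sigma> \<Pi> A xs ys) \<and> subst_lfm \<sigma> (interp \<Sigma> \<Pi> A xs ys) =
    interp \<Sigma> \<Pi> (subst_lfm \<sigma> A) (map (subst_trm \<sigma>) xs) (map (subst_trm \<sigma>) ys)"
  using assms
proof (induction A arbitrary: xs ys \<sigma> rule: measure_induct_rule[of fm_size])
  case (less A)
  have shift: "trms (lang T) \<tau>s (map (shift_trm k) ts)" if "trms (lang T) \<tau>s ts" for \<tau>s ts k
    using that by (rule trms_map) simp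
  show ?case
  proof (cases A)
    case Bot
    then show ?thesis by simp
  next
    case (Pred P ts)
    then show ?thesis using less.prems
      by (cases xs) (auto simp: trms_def witP_wf witP_subst list_all_iff wf_subst_trm)
  next
    case (Tensor B C)
    have *: "trms (lang T) (tpos \<Pi> B) (take (length (tpos \<Pi> B)) xs)" "trms (lang T) (tpos \<Pi> C) (drop (length (tpos \<Pi> B)) xs)"
      "trms (lang T) (tneg \<Pi> B) (take (length (tneg \<Pi> B)) ys)" "trms (lang T) (tneg \<Pi> C) (drop (length (tneg \<Pi> B)) ys)"
      using less.prems(2,3) by (simp_all add: Tensor trms_append)
    show ?thesis
      using less.IH[of B _ _ \<sigma>, OF _ _ *(1,3)] less.IH[of C _ _ \<sigma>, OF _ _ *(2,4)] less.prems(1,4)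
      by (simp add: Tensor Let_def take_map drop_map)
  next
    case (Lolli B C)
    let ?fs = "take (length (tpos \<Pi> C)) xs" and ?gs = "drop (length (tpos \<Pi> C)) xs"
    let ?us = "take (length (tpos \<Pi> B)) ys" and ?ws = "drop (length (tpos \<Pi> B)) ys"
    have fs: "trms (lang T) (tpos \<Pi> B \<Rrightarrow> tpos \<Pi> C) ?fs" and gs: "trms (lang T) (tpos \<Pi> B \<Rrightarrow> tneg \<Pi> C \<Rrightarrow> tneg \<Pi> B) ?gs"
      and us: "trms (lang T) (tpos \<Pi> B) ?us" and ws: "trms (lang T) (tneg \<Pi> C) ?ws"
      using less.prems(2,3) by (simp_all add: Lolli trms_append)
    have gs': "trms (lang T) (tneg \<Pi> B) (apps \<Sigma> ?gs (?us @ ?ws))"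
      using gs us ws by (simp add: trms_def wft_apps del: append_take_drop_id)
    have fs': "trms (lang T) (tpos \<Pi> C) (apps \<Sigma> ?fs ?us)"
      using fs us by (simp add: trms_def wft_apps)
    show ?thesis
      using less.IH[of B _ _ \<sigma>, OF _ _ us gs'] less.IH[of C _ _ \<sigma>, OF _ _ fs' ws] less.prems(1,4)
      by (simp add: Lolli Let_def map_subst_apps flip: take_map drop_map)
  next
    case (All B)
    then show ?thesis
      using less.IH[of B "map (shift_trm 1) xs" "map (shift_trm 1) ys" "lift_sub 1 \<sigma>"] less.prems
      by (simp add: shift wf_lift_sub map_shift_map del: map_map)
  next
    case (Ex B)
    then show ?thesis
      using less.IH[of B "map (shift_trm 1) xs" "map (shift_trm 1) ys" "lift_sub 1 \<sigma>"] less.prems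
      by (simp add: shift wf_lift_sub map_shift_map del: map_map)
  next
    case (Bang B)
    let ?k = "length (tneg \<Pi> B)"
    let ?B = "interp \<Sigma> \<Pi> (shift_lfm ?k B) (map (shift_trm ?k) xs) (vars ?k)"
    have *: "wff ?B \<and> subst_lfm (lift_sub ?k \<sigma>) ?B =
        interp \<Sigma> \<Pi> (shift_lfm ?k (subst_lfm \<sigma> B)) (map (shift_trm ?k) (map (subst_trm \<sigma>) xs)) (vars ?k)"
      using less.IH[of "shift_lfm ?k B" "map (shift_trm ?k) xs" "vars ?k" "lift_sub ?k \<sigma>"] less.prems
      by (simp add: Bang shift wf_lift_sub map_shift_map map_lift_vars subst_lift_shift_lfm del: map_map)
    then show ?thesis
      using less.prems by (simp add: Bang Let_def bq_wf bq_subst del: map_map)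
  qed
qed

lemma interp_wf:
  "wff A \<Longrightarrow> trms (lang T) (tpos \<Pi> A) xs \<Longrightarrow> trms (lang T) (tneg \<Pi> A) ys \<Longrightarrow> wff (interp \<Sigma> \<Pi> A xs ys)"
  using interp_wf_subst[where \<sigma> = Var] by simp

lemmas interp_subst = interp_wf_subst[THEN conjunct2]

subsection \<open>Witnesses\<close>

abbreviation W :: "ty \<Rightarrow> 'f trm \<Rightarrow> ('f, 'p) lfm" where "W \<tau> t \<equiv> inst [t] (Wfm \<Pi> \<tau>)"

lemma W_wf: "wft t \<Longrightarrow> wff (W \<tau> t)"
  using A4 by (auto simp: A4_def intro: wf_inst)

lemma W_subst: "subst_lfm \<sigma> (W \<tau> t) = W \<tau> (subst_trm \<sigma> t)"
proof -
  have "fv_lfm (Wfm \<Pi> \<tau>) \<subseteq> {0}" using A4 by (auto simp: A4_def)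
  then show ?thesis
    unfolding inst_eq subst_lfm_comp by (intro subst_lfm_cong) (auto simp: inst_sub_def dest!: subsetD)
qed

lemma W_suc_single: "W_suc \<Pi> [\<tau>] [t] = W \<tau> t"
  by (simp add: W_suc_def W_list_def)

lemma W_app:
  assumes "K \<tturnstile> W (\<tau> \<rightarrow> \<rho>) f" "K \<tturnstile> W \<tau> x" "wft f" "wft x" shows "K \<tturnstile> W \<rho> (app \<Sigma> f x)"
proof -
  have "entails T (mset (W_list \<Pi> [\<tau>, \<tau> \<rightarrow> \<rho>] [x, f])) (W \<rho> (app \<Sigma> f x))"
    using A4 assms(3,4) unfolding A4_def W_suc_single by blast
  from prov_app[OF this] show ?thesis using assms(1,2) by (auto simp: W_list_def)
qed

abbreviation Ws :: "('f, 'p) lfm set \<Rightarrow> ty list \<Rightarrow> 'f trm list \<Rightarrow> bool" where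
  "Ws K \<tau>s ts \<equiv> list_all2 (\<lambda>\<tau> t. wft t \<and> K \<tturnstile> W \<tau> t) \<tau>s ts"

lemma Ws_trms: "Ws K \<tau>s ts \<Longrightarrow> trms (lang T) \<tau>s ts"
  by (auto simp: trms_def list_all2_conv_all_nth list_all_length)

lemma Ws_mono: "Ws K \<tau>s ts \<Longrightarrow> K \<subseteq> K' \<Longrightarrow> Ws K' \<tau>s ts"
  by (auto elim!: list_all2_mono intro: prov_mono)

lemma W_list_wf: "trms (lang T) \<tau>s ts \<Longrightarrow> A \<in> set (W_list \<Pi> \<tau>s ts) \<Longrightarrow> wff A"
  by (auto simp: W_list_def set_zip trms_def list_all_length W_wf)

lemma Ws_hyp: "trms (lang T) \<tau>s ts \<Longrightarrow> set (W_list \<Pi> \<tau>s ts) \<subseteq> K \<Longrightarrow> Ws K \<tau>s ts"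
  by (fastforce simp: W_list_def set_zip trms_def list_all_length list_all2_conv_all_nth
      intro!: prov_hyp W_wf)

lemma Ws_W_list: "Ws K \<tau>s ts \<Longrightarrow> A \<in> set (W_list \<Pi> \<tau>s ts) \<Longrightarrow> K \<tturnstile> A"
  by (auto simp: W_list_def set_zip list_all2_conv_all_nth)

lemma W_list_subst: "map (subst_lfm \<sigma>) (W_list \<Pi> \<tau>s ts) = W_list \<Pi> \<tau>s (map (subst_trm \<sigma>) ts)"
  by (simp add: W_list_def W_subst zip_map2 case_prod_unfold)

lemma fun_ty_simps [simp]: "fun_ty [] \<sigma> = \<sigma>" "fun_ty (\<rho> # \<rho>s) \<sigma> = (\<rho> \<rightarrow> fun_ty \<rho>s \<sigma>)"
  by (simp_all add: fun_ty_def)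

lemma fun_ty_append: "fun_ty (\<rho>s @ \<tau>s) \<sigma> = fun_ty \<rho>s (fun_ty \<tau>s \<sigma>)"
  by (simp add: fun_ty_def)

lemma fun_tys_append_left: "(\<rho>s @ \<tau>s) \<Rrightarrow> \<sigma>s = \<rho>s \<Rrightarrow> \<tau>s \<Rrightarrow> \<sigma>s"
  by (simp add: fun_tys_def fun_ty_append)

lemma fun_tys_append_right: "\<rho>s \<Rrightarrow> (\<sigma>s @ \<tau>s) = (\<rho>s \<Rrightarrow> \<sigma>s) @ (\<rho>s \<Rrightarrow> \<tau>s)"
  by (simp add: fun_tys_def)

lemma fun_tys_Nil [simp]: "[] \<Rrightarrow> \<sigma>s = \<sigma>s" "\<rho>s \<Rrightarrow> [] = []"
  by (simp_all add: fun_tys_def map_idI)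

lemma apps_append: "apps \<Sigma> ts (us @ vs) = apps \<Sigma> (apps \<Sigma> ts us) vs"
  by (simp add: apps_def)

lemma apps_append_left: "apps \<Sigma> (ss @ ts) us = apps \<Sigma> ss us @ apps \<Sigma> ts us"
  by (simp add: apps_def)

lemma apps_Nil [simp]: "apps \<Sigma> ts [] = ts" "apps \<Sigma> [] us = []"
  by (simp_all add: apps_def)

lemma W_foldl: "K \<tturnstile> W (fun_ty \<rho>s \<sigma>) t \<Longrightarrow> wft t \<Longrightarrow> Ws K \<rho>s xs \<Longrightarrow> K \<tturnstile> W \<sigma> (foldl (app \<Sigma>) t xs)"
proof (induction \<rho>s arbitrary: t xs)
  case (Cons \<rho> \<rho>s)
  obtain y ys where xs: "xs = y # ys" "wft y" "K \<tturnstile> W \<rho> y" "Ws K \<rho>s ys"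
    using Cons.prems(3) by (auto simp: list_all2_Cons1)
  then have "K \<tturnstile> W (fun_ty \<rho>s \<sigma>) (app \<Sigma> t y)"
    using Cons.prems by (intro W_app[where \<tau> = \<rho>]) auto
  then show ?case using Cons.IH[of "app \<Sigma> t y" ys] xs Cons.prems(2) by simp
qed simp

lemma Ws_apps: "Ws K (\<rho>s \<Rrightarrow> \<sigma>s) ts \<Longrightarrow> Ws K \<rho>s xs \<Longrightarrow> Ws K \<sigma>s (apps \<Sigma> ts xs)"
  using Ws_trms[of K \<rho>s xs]
  by (auto simp: list_all2_conv_all_nth fun_tys_def apps_def trms_def
      intro!: W_foldl[unfolded list_all2_conv_all_nth] wft_foldl)

subsection \<open>Combinatory completeness for tuples\<close>

definition closed_W :: "ty \<Rightarrow> 'f trm \<Rightarrow> bool" where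
  "closed_W \<tau> t \<longleftrightarrow> closed_trm (lang T) t \<and> {} \<tturnstile> W \<tau> t"

abbreviation closed_Ws :: "ty list \<Rightarrow> 'f trm list \<Rightarrow> bool" where
  "closed_Ws \<equiv> list_all2 closed_W"

lemma closed_W_wf: "closed_W \<tau> t \<Longrightarrow> wft t"
  by (simp add: closed_W_def closed_trm_def)

lemma closed_W_app: "closed_W (\<sigma> \<rightarrow> \<tau>) s \<Longrightarrow> closed_W \<sigma> t \<Longrightarrow> closed_W \<tau> (app \<Sigma> s t)"
  by (auto simp: closed_W_def closed_trm_def intro: W_app)

lemma closed_W_K: "closed_W (\<rho> \<rightarrow> \<sigma> \<rightarrow> \<rho>) (K_trm \<Sigma> \<rho> \<sigma>)"
  using A4 by (simp add: closed_W_def closed_trm_def A4_def W_suc_single entails_iff_prov)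

lemma closed_W_S: "closed_W ((\<rho> \<rightarrow> \<sigma> \<rightarrow> \<tau>) \<rightarrow> (\<rho> \<rightarrow> \<sigma>) \<rightarrow> \<rho> \<rightarrow> \<tau>) (S_trm \<Sigma> \<rho> \<sigma> \<tau>)"
  using A4 by (simp add: closed_W_def closed_trm_def A4_def W_suc_single entails_iff_prov)

lemma K_eqv: "wft s \<Longrightarrow> wft t \<Longrightarrow> app \<Sigma> (app \<Sigma> (K_trm \<Sigma> \<rho> \<sigma>) s) t \<approx> s"
  using omega_axiom[OF ILomega_axioms.K_eq[of "lang T" s t \<Sigma> \<rho> \<sigma>]] by (simp add: eqv_def)

lemma S_eqv: "wft r \<Longrightarrow> wft s \<Longrightarrow> wft t \<Longrightarrow>
    app \<Sigma> (app \<Sigma> (app \<Sigma> (S_trm \<Sigma> \<rho> \<sigma> \<tau>) r) s) t \<approx> app \<Sigma> (app \<Sigma> r t) (app \<Sigma> s t)"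
  using omega_axiom[OF ILomega_axioms.S_eq[of "lang T" r s t \<Sigma> \<rho> \<sigma> \<tau>]] by (simp add: eqv_def)

lemma I_comb: obtains i where "closed_W (\<sigma> \<rightarrow> \<sigma>) i" "\<And>t. wft t \<Longrightarrow> app \<Sigma> i t \<approx> t"
proof
  let ?K = "K_trm \<Sigma> \<sigma> (\<sigma> \<rightarrow> \<sigma>)" and ?K' = "K_trm \<Sigma> \<sigma> \<sigma>"
  let ?i = "app \<Sigma> (app \<Sigma> (S_trm \<Sigma> \<sigma> (\<sigma> \<rightarrow> \<sigma>) \<sigma>) ?K) ?K'"
  show "closed_W (\<sigma> \<rightarrow> \<sigma>) ?i"
    by (rule closed_W_app[OF closed_W_app[OF closed_W_S closed_W_K] closed_W_K])
  show "app \<Sigma> ?i t \<approx> t" if "wft t" for t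
    using eqv_trans[OF S_eqv K_eqv] that by simp
qed

text \<open>The combinator \<open>K\<close> for a curried tuple of arguments to be
  discarded.\<close>

lemma K_tuple:
  "\<exists>k. closed_W (\<sigma> \<rightarrow> fun_ty \<rho>s \<sigma>) k \<and>
     (\<forall>t xs. wft t \<longrightarrow> trms (lang T) \<rho>s xs \<longrightarrow> foldl (app \<Sigma>) (app \<Sigma> k t) xs \<approx> t)"
proof (induction \<rho>s)
  case Nil
  obtain i where "closed_W (\<sigma> \<rightarrow> \<sigma>) i" "\<And>t. wft t \<Longrightarrow> app \<Sigma> i t \<approx> t"
    using I_comb by blast
  then show ?case by (auto simp: trms_def)
next
  case (Cons \<rho> \<rho>s)
  let ?X = "fun_ty \<rho>s \<sigma>"
  obtain k where k: "closed_W (\<sigma> \<rightarrow> ?X) k"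
    "\<And>t xs. wft t \<Longrightarrow> trms (lang T) \<rho>s xs \<Longrightarrow> foldl (app \<Sigma>) (app \<Sigma> k t) xs \<approx> t"
    using Cons.IH by blast
  \<comment> \<open>The new term is \<open>S (K K) k\<close>: applied to \<open>t\<close> it gives
    \<open>K (k t)\<close>, which discards one further argument before \<open>k t\<close> discards
    the rest.\<close>
  let ?KK = "app \<Sigma> (K_trm \<Sigma> (?X \<rightarrow> \<rho> \<rightarrow> ?X) \<sigma>) (K_trm \<Sigma> ?X \<rho>)"
  let ?k = "app \<Sigma> (app \<Sigma> (S_trm \<Sigma> \<sigma> ?X (\<rho> \<rightarrow> ?X)) ?KK) k"
  have wf: "wft k" using k(1) by (rule closed_W_wf)
  have "closed_W (\<sigma> \<rightarrow> \<rho> \<rightarrow> ?X) ?k"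
    by (rule closed_W_app[OF closed_W_app[OF closed_W_S closed_W_app[OF closed_W_K closed_W_K]] k(1)])
  moreover have "foldl (app \<Sigma>) (app \<Sigma> ?k t) xs \<approx> t" if t: "wft t" and xs: "trms (lang T) (\<rho> # \<rho>s) xs" for t xs
  proof -
    obtain x ys where xs': "xs = x # ys" "wft x" "trms (lang T) \<rho>s ys"
      using xs by (cases xs) (auto simp: trms_def)
    have "app \<Sigma> ?k t \<approx> app \<Sigma> (app \<Sigma> ?KK t) (app \<Sigma> k t)"
      using t wf by (intro S_eqv) auto
    also have "app \<Sigma> (app \<Sigma> ?KK t) (app \<Sigma> k t) \<approx> app \<Sigma> (K_trm \<Sigma> ?X \<rho>) (app \<Sigma> k t)"
      using t wf by (intro eqv_app K_eqv eqv_refl) auto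
    finally have "app \<Sigma> (app \<Sigma> ?k t) x \<approx> app \<Sigma> (app \<Sigma> (K_trm \<Sigma> ?X \<rho>) (app \<Sigma> k t)) x"
      by (rule eqv_app[OF _ eqv_refl]) (rule xs'(2))
    also have "app \<Sigma> (app \<Sigma> (K_trm \<Sigma> ?X \<rho>) (app \<Sigma> k t)) x \<approx> app \<Sigma> k t"
      using t wf xs' by (intro K_eqv) auto
    finally have "foldl (app \<Sigma>) (app \<Sigma> (app \<Sigma> ?k t) x) ys \<approx> foldl (app \<Sigma>) (app \<Sigma> k t) ys"
      using xs' by (intro eqv_foldl eqvs_refl) (auto simp: trms_def)
    also have "\<dots> \<approx> t" using t xs' by (intro k(2))
    finally show ?thesis by (simp add: xs'(1))
  qed
  ultimately show ?case by (intro exI[of _ ?k]) simp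
qed

text \<open>The combinator \<open>S\<close> for a curried tuple of shared arguments. It is what
  makes representable functions closed under application.\<close>

lemma S_tuple:
  "\<exists>s. closed_W (fun_ty \<rho>s (\<sigma> \<rightarrow> \<tau>) \<rightarrow> fun_ty \<rho>s \<sigma> \<rightarrow> fun_ty \<rho>s \<tau>) s \<and>
     (\<forall>t u xs. wft t \<longrightarrow> wft u \<longrightarrow> trms (lang T) \<rho>s xs \<longrightarrow>
       foldl (app \<Sigma>) (app \<Sigma> (app \<Sigma> s t) u) xs \<approx> app \<Sigma> (foldl (app \<Sigma>) t xs) (foldl (app \<Sigma>) u xs))"
proof (induction \<rho>s)
  case Nil
  obtain i where "closed_W ((\<sigma> \<rightarrow> \<tau>) \<rightarrow> (\<sigma> \<rightarrow> \<tau>)) i" "\<And>t. wft t \<Longrightarrow> app \<Sigma> i t \<approx> t"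
    using I_comb by blast
  then show ?case by (auto simp: trms_def intro!: eqv_app eqv_refl)
next
  case (Cons \<rho> \<rho>s)
  let ?X = "fun_ty \<rho>s (\<sigma> \<rightarrow> \<tau>)" and ?Y = "fun_ty \<rho>s \<sigma>" and ?Z = "fun_ty \<rho>s \<tau>"
  obtain s where s: "closed_W (?X \<rightarrow> ?Y \<rightarrow> ?Z) s"
    "\<And>t u xs. wft t \<Longrightarrow> wft u \<Longrightarrow> trms (lang T) \<rho>s xs \<Longrightarrow>
       foldl (app \<Sigma>) (app \<Sigma> (app \<Sigma> s t) u) xs \<approx> app \<Sigma> (foldl (app \<Sigma>) t xs) (foldl (app \<Sigma>) u xs)"
    using Cons.IH by blast
  have wf: "wft s" using s(1) by (rule closed_W_wf)
  \<comment> \<open>The new term is \<open>S (K S) (S (K s))\<close>; applied to \<open>t\<close>,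
    \<open>u\<close> and \<open>x\<close> it gives \<open>s (t x) (u x)\<close>, which leaves the
    remaining arguments to \<open>s\<close>.\<close>
  let ?Ks = "app \<Sigma> (K_trm \<Sigma> (?X \<rightarrow> ?Y \<rightarrow> ?Z) \<rho>) s"
  let ?c = "app \<Sigma> (S_trm \<Sigma> \<rho> ?X (?Y \<rightarrow> ?Z)) ?Ks"
  let ?S = "S_trm \<Sigma> \<rho> ?Y ?Z"
  let ?KS = "app \<Sigma> (K_trm \<Sigma> ((\<rho> \<rightarrow> ?Y \<rightarrow> ?Z) \<rightarrow> (\<rho> \<rightarrow> ?Y) \<rightarrow> (\<rho> \<rightarrow> ?Z)) (\<rho> \<rightarrow> ?X)) ?S"
  let ?s = "app \<Sigma> (app \<Sigma> (S_trm \<Sigma> (\<rho> \<rightarrow> ?X) (\<rho> \<rightarrow> ?Y \<rightarrow> ?Z) ((\<rho> \<rightarrow> ?Y) \<rightarrow> (\<rho> \<rightarrow> ?Z))) ?KS) ?c"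
  have "closed_W ((\<rho> \<rightarrow> ?X) \<rightarrow> (\<rho> \<rightarrow> ?Y) \<rightarrow> (\<rho> \<rightarrow> ?Z)) ?s"
    by (rule closed_W_app[OF closed_W_app[OF closed_W_S closed_W_app[OF closed_W_K closed_W_S]]
        closed_W_app[OF closed_W_S closed_W_app[OF closed_W_K s(1)]]])
  moreover have "foldl (app \<Sigma>) (app \<Sigma> (app \<Sigma> ?s t) u) xs \<approx> app \<Sigma> (foldl (app \<Sigma>) t xs) (foldl (app \<Sigma>) u xs)"
    if tu: "wft t" "wft u" and xs: "trms (lang T) (\<rho> # \<rho>s) xs" for t u xs
  proof -
    obtain x ys where xs': "xs = x # ys" "wft x" "trms (lang T) \<rho>s ys"
      using xs by (cases xs) (auto simp: trms_def)
    have "app \<Sigma> ?s t \<approx> app \<Sigma> (app \<Sigma> ?KS t) (app \<Sigma> ?c t)"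
      using tu wf by (intro S_eqv) auto
    also have "\<dots> \<approx> app \<Sigma> ?S (app \<Sigma> ?c t)"
      using tu wf by (intro eqv_app K_eqv eqv_refl) auto
    finally have "app \<Sigma> (app \<Sigma> (app \<Sigma> ?s t) u) x \<approx> app \<Sigma> (app \<Sigma> (app \<Sigma> ?S (app \<Sigma> ?c t)) u) x"
      by (rule eqv_app[OF eqv_app[OF _ eqv_refl[OF tu(2)]] eqv_refl[OF xs'(2)]])
    also have "\<dots> \<approx> app \<Sigma> (app \<Sigma> (app \<Sigma> ?c t) x) (app \<Sigma> u x)"
      using tu wf xs' by (intro S_eqv) auto
    also have "\<dots> \<approx> app \<Sigma> (app \<Sigma> (app \<Sigma> ?Ks x) (app \<Sigma> t x)) (app \<Sigma> u x)"
      using tu wf xs' by (intro eqv_app S_eqv eqv_refl) auto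
    also have "\<dots> \<approx> app \<Sigma> (app \<Sigma> s (app \<Sigma> t x)) (app \<Sigma> u x)"
      using tu wf xs' by (intro eqv_app K_eqv eqv_refl) auto
    finally have "foldl (app \<Sigma>) (app \<Sigma> (app \<Sigma> (app \<Sigma> ?s t) u) x) ys \<approx>
        foldl (app \<Sigma>) (app \<Sigma> (app \<Sigma> s (app \<Sigma> t x)) (app \<Sigma> u x)) ys"
      using xs' by (intro eqv_foldl eqvs_refl) (auto simp: trms_def)
    also have "\<dots> \<approx> app \<Sigma> (foldl (app \<Sigma>) (app \<Sigma> t x) ys) (foldl (app \<Sigma>) (app \<Sigma> u x) ys)"
      using tu xs' by (intro s(2)) auto
    finally show ?thesis by (simp add: xs'(1))
  qed
  ultimately show ?case by (intro exI[of _ ?s]) simp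
qed

text \<open>
  Instead of using abstraction on terms, functions on tuples of terms are shown to be given by a
  closed term in \<open>W\<close> up to provable equality.
\<close>

definition rep :: "ty list \<Rightarrow> ty \<Rightarrow> ('f trm list \<Rightarrow> 'f trm) \<Rightarrow> bool" where
  "rep \<rho>s \<sigma> F \<longleftrightarrow> (\<exists>t. closed_W (fun_ty \<rho>s \<sigma>) t \<and>
     (\<forall>xs. trms (lang T) \<rho>s xs \<longrightarrow> foldl (app \<Sigma>) t xs \<approx> F xs))"

definition reps :: "ty list \<Rightarrow> ty list \<Rightarrow> ('f trm list \<Rightarrow> 'f trm list) \<Rightarrow> bool" where
  "reps \<rho>s \<sigma>s F \<longleftrightarrow> (\<forall>xs. trms (lang T) \<rho>s xs \<longrightarrow> length (F xs) = length \<sigma>s) \<and>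
     (\<forall>i < length \<sigma>s. rep \<rho>s (\<sigma>s ! i) (\<lambda>xs. F xs ! i))"

lemma rep_cong: "rep \<rho>s \<sigma> F \<Longrightarrow> (\<And>xs. trms (lang T) \<rho>s xs \<Longrightarrow> F xs = G xs) \<Longrightarrow> rep \<rho>s \<sigma> G"
  by (auto simp: rep_def)

lemma rep_const:
  assumes "closed_W \<sigma> t" shows "rep \<rho>s \<sigma> (\<lambda>xs. t)"
proof -
  obtain k where k: "closed_W (\<sigma> \<rightarrow> fun_ty \<rho>s \<sigma>) k"
    "\<forall>t xs. wft t \<longrightarrow> trms (lang T) \<rho>s xs \<longrightarrow> foldl (app \<Sigma>) (app \<Sigma> k t) xs \<approx> t"
    using K_tuple by blast
  then show ?thesis
    unfolding rep_def using assms closed_W_wf[OF assms] by (intro exI[of _ "app \<Sigma> k t"]) (auto intro: closed_W_app)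
qed

text \<open>At position 0 the other arguments are discarded by \<open>K_tuple\<close>; at a later
  position \<open>K\<close> discards the head and the induction hypothesis treats the tail.\<close>

lemma rep_nth: "i < length \<rho>s \<Longrightarrow> rep \<rho>s (\<rho>s ! i) (\<lambda>xs. xs ! i)"
proof (induction \<rho>s arbitrary: i)
  case (Cons \<rho> \<rho>s)
  show ?case
  proof (cases i)
    case 0
    obtain k where k: "closed_W (\<rho> \<rightarrow> fun_ty \<rho>s \<rho>) k"
      "\<forall>t xs. wft t \<longrightarrow> trms (lang T) \<rho>s xs \<longrightarrow> foldl (app \<Sigma>) (app \<Sigma> k t) xs \<approx> t"
      using K_tuple by blast
    have "foldl (app \<Sigma>) k xs \<approx> xs ! i" if "trms (lang T) (\<rho> # \<rho>s) xs" for xs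
      using that k(2) 0 by (cases xs) (auto simp: trms_def)
    then show ?thesis unfolding rep_def using k(1) 0 by (intro exI[of _ k]) simp
  next
    case (Suc j)
    obtain t where t: "closed_W (fun_ty \<rho>s (\<rho>s ! j)) t"
      "\<And>xs. trms (lang T) \<rho>s xs \<Longrightarrow> foldl (app \<Sigma>) t xs \<approx> xs ! j"
      using Cons.IH[of j] Cons.prems Suc by (auto simp: rep_def)
    let ?t = "app \<Sigma> (K_trm \<Sigma> (fun_ty \<rho>s (\<rho>s ! j)) \<rho>) t"
    have "foldl (app \<Sigma>) ?t xs \<approx> xs ! i" if xs: "trms (lang T) (\<rho> # \<rho>s) xs" for xs
    proof -
      obtain x ys where xs': "xs = x # ys" "wft x" "trms (lang T) \<rho>s ys"
        using xs by (cases xs) (auto simp: trms_def)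
      have "foldl (app \<Sigma>) (app \<Sigma> ?t x) ys \<approx> foldl (app \<Sigma>) t ys"
        using xs' closed_W_wf[OF t(1)] by (intro eqv_foldl eqvs_refl K_eqv) (auto simp: trms_def)
      also have "\<dots> \<approx> ys ! j" using xs' by (intro t(2))
      finally show ?thesis by (simp add: xs' Suc)
    qed
    then show ?thesis
      unfolding rep_def using closed_W_app[OF closed_W_K t(1)] by (intro exI[of _ ?t]) (simp add: Suc)
  qed
qed simp

lemma rep_app:
  assumes "rep \<rho>s (\<sigma> \<rightarrow> \<tau>) F" "rep \<rho>s \<sigma> G" shows "rep \<rho>s \<tau> (\<lambda>xs. app \<Sigma> (F xs) (G xs))"
proof -
  obtain s where s: "closed_W (fun_ty \<rho>s (\<sigma> \<rightarrow> \<tau>) \<rightarrow> fun_ty \<rho>s \<sigma> \<rightarrow> fun_ty \<rho>s \<tau>) s"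
    "\<And>t u xs. wft t \<Longrightarrow> wft u \<Longrightarrow> trms (lang T) \<rho>s xs \<Longrightarrow>
       foldl (app \<Sigma>) (app \<Sigma> (app \<Sigma> s t) u) xs \<approx> app \<Sigma> (foldl (app \<Sigma>) t xs) (foldl (app \<Sigma>) u xs)"
    using S_tuple by blast
  obtain f where f: "closed_W (fun_ty \<rho>s (\<sigma> \<rightarrow> \<tau>)) f"
    "\<And>xs. trms (lang T) \<rho>s xs \<Longrightarrow> foldl (app \<Sigma>) f xs \<approx> F xs"
    using assms(1) by (auto simp: rep_def)
  obtain g where g: "closed_W (fun_ty \<rho>s \<sigma>) g" "\<And>xs. trms (lang T) \<rho>s xs \<Longrightarrow> foldl (app \<Sigma>) g xs \<approx> G xs"
    using assms(2) by (auto simp: rep_def)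
  have "foldl (app \<Sigma>) (app \<Sigma> (app \<Sigma> s f) g) xs \<approx> app \<Sigma> (F xs) (G xs)" if "trms (lang T) \<rho>s xs" for xs
    using eqv_trans[OF s(2) eqv_app[OF f(2) g(2)]] that closed_W_wf[OF f(1)] closed_W_wf[OF g(1)] by blast
  then show ?thesis
    unfolding rep_def using closed_W_app[OF closed_W_app[OF s(1) f(1)] g(1)] by blast
qed

lemma reps_closed_terms:
  assumes "reps \<rho>s \<sigma>s F"
  obtains ts where "closed_Ws (\<rho>s \<Rrightarrow> \<sigma>s) ts" "\<And>xs. trms (lang T) \<rho>s xs \<Longrightarrow> apps \<Sigma> ts xs \<approx>\<^sub>l F xs"
proof -
  obtain t where t: "\<And>i. i < length \<sigma>s \<Longrightarrow> closed_W (fun_ty \<rho>s (\<sigma>s ! i)) (t i)"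
    "\<And>i xs. i < length \<sigma>s \<Longrightarrow> trms (lang T) \<rho>s xs \<Longrightarrow> foldl (app \<Sigma>) (t i) xs \<approx> F xs ! i"
    using assms unfolding reps_def rep_def by metis
  show ?thesis
  proof (rule that[of "map t [0..<length \<sigma>s]"])
    show "closed_Ws (\<rho>s \<Rrightarrow> \<sigma>s) (map t [0..<length \<sigma>s])"
      using t(1) by (auto simp: list_all2_conv_all_nth fun_tys_def)
    show "apps \<Sigma> (map t [0..<length \<sigma>s]) xs \<approx>\<^sub>l F xs" if "trms (lang T) \<rho>s xs" for xs
      using t(2)[OF _ that] assms that by (auto simp: list_all2_conv_all_nth apps_def reps_def)
  qed
qed

lemma reps_const: "closed_Ws \<sigma>s ts \<Longrightarrow> reps \<rho>s \<sigma>s (\<lambda>xs. ts)"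
  by (auto simp: reps_def list_all2_conv_all_nth intro: rep_const)

text \<open>Blocks of arguments are addressed by offset and length, in accordance with the way
  \<open>interp\<close> splits its tuples. The sums of lengths in the constructions below are such
  offsets.\<close>

lemma reps_block:
  "\<rho>s = \<alpha>s @ \<sigma>s @ \<beta>s \<Longrightarrow> n = length \<alpha>s \<Longrightarrow> k = length \<sigma>s \<Longrightarrow> reps \<rho>s \<sigma>s (\<lambda>xs. take k (drop n xs))"
  unfolding reps_def
proof (intro conjI allI impI)
  fix i assume *: "i < length \<sigma>s" "\<rho>s = \<alpha>s @ \<sigma>s @ \<beta>s" "n = length \<alpha>s" "k = length \<sigma>s"
  then have "rep \<rho>s (\<sigma>s ! i) (\<lambda>xs. xs ! (n + i))"
    using rep_nth[of "n + i" \<rho>s] by (simp add: nth_append)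
  then show "rep \<rho>s (\<sigma>s ! i) (\<lambda>xs. take k (drop n xs) ! i)"
    by (rule rep_cong) (use * in \<open>auto simp: trms_def\<close>)
qed (auto simp: trms_def)

lemma reps_append:
  assumes "reps \<rho>s \<sigma>s F" "reps \<rho>s \<tau>s G" shows "reps \<rho>s (\<sigma>s @ \<tau>s) (\<lambda>xs. F xs @ G xs)"
  unfolding reps_def
proof (intro conjI allI impI)
  fix i assume i: "i < length (\<sigma>s @ \<tau>s)"
  show "rep \<rho>s ((\<sigma>s @ \<tau>s) ! i) (\<lambda>xs. (F xs @ G xs) ! i)"
  proof (cases "i < length \<sigma>s")
    case True
    then have "rep \<rho>s ((\<sigma>s @ \<tau>s) ! i) (\<lambda>xs. F xs ! i)"
      using assms(1) by (simp add: reps_def nth_append)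
    then show ?thesis
      by (rule rep_cong) (use True assms(1) in \<open>auto simp: nth_append reps_def\<close>)
  next
    case False
    then have "rep \<rho>s (\<tau>s ! (i - length \<sigma>s)) (\<lambda>xs. G xs ! (i - length \<sigma>s))"
      using assms(2) i by (auto simp: reps_def)
    then have "rep \<rho>s ((\<sigma>s @ \<tau>s) ! i) (\<lambda>xs. G xs ! (i - length \<sigma>s))"
      using False by (simp add: nth_append)
    then show ?thesis
      by (rule rep_cong) (use False assms(1) in \<open>auto simp: nth_append reps_def\<close>)
  qed
qed (use assms in \<open>auto simp: reps_def\<close>)

lemma rep_foldl:
  "rep \<rho>s (fun_ty \<sigma>s \<tau>) F \<Longrightarrow> reps \<rho>s \<sigma>s G \<Longrightarrow> rep \<rho>s \<tau> (\<lambda>xs. foldl (app \<Sigma>) (F xs) (G xs))"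
proof (induction \<sigma>s arbitrary: F G)
  case Nil
  then show ?case by (auto simp: reps_def elim: rep_cong)
next
  case (Cons \<sigma> \<sigma>s)
  have hd: "rep \<rho>s \<sigma> (\<lambda>xs. G xs ! 0)"
    using Cons.prems(2) unfolding reps_def by force
  have "reps \<rho>s \<sigma>s (\<lambda>xs. tl (G xs))"
    unfolding reps_def
  proof (intro conjI allI impI)
    fix i assume "i < length \<sigma>s"
    then have "rep \<rho>s ((\<sigma> # \<sigma>s) ! Suc i) (\<lambda>xs. G xs ! Suc i)"
      using Cons.prems(2) unfolding reps_def by (metis Suc_less_eq length_Cons)
    moreover have "G xs ! Suc i = tl (G xs) ! i" if "trms (lang T) \<rho>s xs" for xs
      using Cons.prems(2) that \<open>i < length \<sigma>s\<close> by (auto simp: reps_def nth_tl)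
    ultimately show "rep \<rho>s (\<sigma>s ! i) (\<lambda>xs. tl (G xs) ! i)" by (auto elim: rep_cong)
  qed (use Cons.prems(2) in \<open>auto simp: reps_def\<close>)
  from Cons.IH[OF rep_app[OF Cons.prems(1)[simplified] hd] this]
  show ?case
  proof (rule rep_cong)
    fix xs assume "trms (lang T) \<rho>s xs"
    then have "length (G xs) = Suc (length \<sigma>s)" using Cons.prems(2) by (simp add: reps_def)
    then show "foldl (app \<Sigma>) (app \<Sigma> (F xs) (G xs ! 0)) (tl (G xs)) = foldl (app \<Sigma>) (F xs) (G xs)"
      by (cases "G xs") auto
  qed
qed

lemma reps_apps:
  assumes "reps \<rho>s (\<sigma>s \<Rrightarrow> \<tau>s) F" "reps \<rho>s \<sigma>s G"
  shows "reps \<rho>s \<tau>s (\<lambda>xs. apps \<Sigma> (F xs) (G xs))"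
  unfolding reps_def
proof (intro conjI allI impI)
  fix i assume i: "i < length \<tau>s"
  then have "rep \<rho>s (fun_ty \<sigma>s (\<tau>s ! i)) (\<lambda>xs. F xs ! i)"
    using assms(1) by (auto simp: reps_def fun_tys_def)
  from rep_foldl[OF this assms(2)] show "rep \<rho>s (\<tau>s ! i) (\<lambda>xs. apps \<Sigma> (F xs) (G xs) ! i)"
    by (rule rep_cong) (use i assms(1) in \<open>auto simp: reps_def apps_def\<close>)
qed (use assms(1) in \<open>auto simp: reps_def\<close>)

subsection \<open>Replacing terms by provably equal ones\<close>

lemma trms_appendE:
  assumes "trms L (\<tau>s @ \<rho>s) ts"
  obtains us vs where "ts = us @ vs" "trms L \<tau>s us" "trms L \<rho>s vs"
  using assms unfolding trms_append by (metis append_take_drop_id)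

lemma trms_eqvs: "ss \<approx>\<^sub>l ts \<Longrightarrow> length ss = length \<tau>s \<Longrightarrow> trms (lang T) \<tau>s ss \<and> trms (lang T) \<tau>s ts"
  by (auto simp: trms_def list_all2_conv_all_nth list_all_length eqv_def)

text \<open>Equals are replaced through \<open>inst\<close>. The two tuples are therefore abstracted
  to fresh indices, past which \<open>A\<close> is shifted, and the interpretation at a given pair
  of tuples is an instance of the resulting formula.\<close>

lemma interp_eqv:
  assumes "K \<tturnstile> interp \<Sigma> \<Pi> A xs ys" "xs \<approx>\<^sub>l xs'" "ys \<approx>\<^sub>l ys'" "wff A"
    "trms (lang T) (tpos \<Pi> A) xs" "trms (lang T) (tneg \<Pi> A) ys"
  shows "K \<tturnstile> interp \<Sigma> \<Pi> A xs' ys'"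
proof -
  let ?p = "length xs" and ?q = "length ys"
  let ?xs = "vars ?p" and ?ys = "map (shift_trm ?p) (vars ?q)"
  define F where "F = interp \<Sigma> \<Pi> (shift_lfm (?p + ?q) A) ?xs ?ys"
  have vs: "trms (lang T) (tpos \<Pi> A) ?xs" "trms (lang T) (tneg \<Pi> A) ?ys"
    using assms(5,6) by (auto simp: trms_def list_all_iff vars_def)
  have inst: "inst (us @ vs) F = interp \<Sigma> \<Pi> A us vs"
    if "length us = ?p" "length vs = ?q" "list_all wft us" "list_all wft vs" for us vs
  proof -
    have "map (subst_trm (inst_sub (us @ vs))) ?xs = us" "map (subst_trm (inst_sub (us @ vs))) ?ys = vs"
      using that by (auto simp: vars_def shift_trm_def inst_sub_def nth_append intro: nth_equalityI)
    moreover have "subst_lfm (inst_sub (us @ vs)) (shift_lfm (?p + ?q) A) = A"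
      using inst_shift[of "us @ vs" "?p + ?q" A] that by (simp add: inst_eq)
    moreover have "\<And>n. wft (inst_sub (us @ vs) n)" using that by (intro wf_inst_sub) simp
    ultimately show ?thesis
      unfolding F_def inst_eq using assms(4) vs by (subst interp_subst) (simp_all del: map_map)
  qed
  have wf: "wff F" unfolding F_def using assms(4) vs by (intro interp_wf) auto
  have eqs: "xs @ ys \<approx>\<^sub>l xs' @ ys'" using assms(2,3) by (rule list_all2_appendI)
  have "K \<tturnstile> inst (xs' @ ys') F"
    by (rule eqvs_inst[OF eqs _ wf]) (use assms in \<open>auto simp: inst trms_def\<close>)
  moreover have "list_all wft xs'" "list_all wft ys'" "length xs' = ?p" "length ys' = ?q"
    using assms(2,3) by (auto simp: list_all2_conv_all_nth list_all_length eqv_def)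
  ultimately show ?thesis by (simp add: inst)
qed

lemma bq_eqv:
  assumes "K \<tturnstile> bq \<Pi> \<tau>s ss A" "ss \<approx>\<^sub>l ts" "wff A" "trms (lang T) (hat \<Pi> \<tau>s) ss"
  shows "K \<tturnstile> bq \<Pi> \<tau>s ts A"
proof -
  let ?h = "length ss" and ?k = "length \<tau>s"
  \<comment> \<open>The indices below \<open>?k\<close> are bound by the quantifier; only the others
    are shifted past the placeholders for the bound.\<close>
  let ?A = "subst_lfm (lift_sub ?k (\<lambda>n. Var (n + ?h))) A"
  define F where "F = bq \<Pi> \<tau>s (vars ?h) ?A"
  have vs: "trms (lang T) (hat \<Pi> \<tau>s) (vars ?h)" using assms(4) by (simp add: trms_def)
  have wfA: "wff ?A" using assms(3) by (simp add: wf_subst_lfm wf_lift_sub)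
  have inst: "inst us F = bq \<Pi> \<tau>s us A" if us: "length us = ?h" "list_all wft us" for us
  proof -
    have "subst_lfm (lift_sub ?k (inst_sub us)) ?A = A"
      unfolding subst_lfm_comp lift_sub_comp using us by (simp add: inst_sub_def)
    moreover have "map (subst_trm (inst_sub us)) (vars ?h) = us"
      using us by (auto simp: vars_def inst_sub_def intro: nth_equalityI)
    ultimately show ?thesis
      unfolding F_def inst_eq using vs wfA us by (simp add: bq_subst wf_inst_sub)
  qed
  have "wff F" unfolding F_def using vs wfA by (rule bq_wf)
  then have "K \<tturnstile> inst ts F"
    by (rule eqvs_inst[OF assms(2), rotated]) (use assms in \<open>auto simp: inst trms_def\<close>)
  moreover have "list_all wft ts" "length ts = ?h"
    using assms(2) by (auto simp: list_all2_conv_all_nth list_all_length eqv_def)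
  ultimately show ?thesis by (simp add: inst)
qed

lemma witP_eqv:
  assumes "K \<tturnstile> witP \<Pi> P ts a" "a \<approx> a'" "P \<in> comp_preds \<Pi>" "wff (Pred P ts)"
  shows "K \<tturnstile> witP \<Pi> P ts a'"
  unfolding witP_def
proof (rule eqvs_inst)
  show "ts @ [a] \<approx>\<^sub>l ts @ [a']" using assms(2,4) by (intro list_all2_appendI eqvs_refl) auto
  show "wff (wfm \<Pi> P)" using A3 assms(3,4) comp_pred_ar by (auto simp: A3_def)
qed (use assms(1) in \<open>simp add: witP_def\<close>)

lemma closed_Ws_wf: "closed_Ws \<tau>s ts \<Longrightarrow> list_all wft ts"
  by (auto simp: list_all2_conv_all_nth list_all_length closed_W_wf)

lemma closed_Ws_subst: "closed_Ws \<tau>s ts \<Longrightarrow> map (subst_trm \<sigma>) ts = ts"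
  by (auto simp: list_all2_conv_all_nth closed_W_def subst_closed_trm[of "lang T"] intro!: nth_equalityI)

lemma closed_Ws_shift: "closed_Ws \<tau>s ts \<Longrightarrow> map (shift_trm k) ts = ts"
  by (simp add: shift_trm_def closed_Ws_subst)

lemma closed_Ws_Ws: "closed_Ws \<tau>s ts \<Longrightarrow> Ws K \<tau>s ts"
  by (auto elim!: list_all2_mono simp: closed_W_def closed_trm_def intro: prov_mono)

lemma prov_W_suc:
  assumes "trms (lang T) \<tau>s ts" shows "K \<tturnstile> W_suc \<Pi> \<tau>s ts \<longleftrightarrow> Ws K \<tau>s ts"
proof -
  have *: "K \<tturnstile> tensor_list As \<longleftrightarrow> (\<forall>A \<in> set As. K \<tturnstile> A)" if "\<forall>A \<in> set As. wff A" for As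
    using that
  proof (induction As rule: tensor_list.induct)
    case 1
    have "K \<tturnstile> Lolli Bot Bot" by (intro prov_entails[OF lolliR[OF ident]]) auto
    then show ?case by simp
  next
    case (3 A B As)
    have "wff (tensor_list (B # As))"
      using 3(2) by (induction As arbitrary: B) auto
    then show ?case using 3 by (auto intro: prov_tensor_I dest: prov_tensor_E)
  qed simp
  show ?thesis
    using *[of "W_list \<Pi> \<tau>s ts"] assms
    unfolding W_suc_def list_all_iff[symmetric]
    by (auto simp: W_wf W_list_def list_all2_conv_all_nth trms_def list_all_length)
qed

text \<open>Turns the pair of conditions found in \<open>witnessable\<close> and in the requirements
  on \<open>eta\<close>, \<open>join\<close> and \<open>circ\<close> into a single componentwise
  relation.\<close>

lemma closed_Ws_iff: "closed_Ws \<tau>s ts \<longleftrightarrow> closed_trms (lang T) \<tau>s ts \<and> entails T {#} (W_suc \<Pi> \<tau>s ts)"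
proof (cases "closed_trms (lang T) \<tau>s ts")
  case True
  then have "trms (lang T) \<tau>s ts" by (auto simp: trms_def closed_trms_def list_all_iff closed_trm_def)
  then show ?thesis
    using True
    by (auto simp: entails_iff_prov prov_W_suc closed_trms_def closed_W_def list_all2_conv_all_nth
        list_all_length closed_trm_def)
next
  case False
  then show ?thesis
    by (auto simp: closed_trms_def closed_W_def list_all2_conv_all_nth list_all_length)
qed

section \<open>The bounding terms and the rules for bounded quantifiers\<close>

lemma eta_closed: "closed_Ws (\<tau>s \<Rrightarrow> hat \<Pi> \<tau>s) (eta \<Pi> \<tau>s)"
  using A5 by (simp add: closed_Ws_iff A5_def C_eta_def)

lemma join_closed: "closed_Ws (hat \<Pi> \<tau>s \<Rrightarrow> hat \<Pi> \<tau>s \<Rrightarrow> hat \<Pi> \<tau>s) (join \<Pi> \<tau>s)"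
  using A5 by (simp add: closed_Ws_iff A5_def C_join_def Let_def)

lemma circ_closed:
  "closed_Ws ((\<rho>s \<Rrightarrow> hat \<Pi> \<tau>s) \<Rrightarrow> hat \<Pi> \<rho>s \<Rrightarrow> hat \<Pi> \<tau>s) (circ \<Pi> \<rho>s \<tau>s)"
  using A5 by (simp add: closed_Ws_iff A5_def C_circ_def Let_def)

lemma eta_rule:
  assumes "K \<tturnstile> bq \<Pi> \<tau>s (apps \<Sigma> (eta \<Pi> \<tau>s) zs) A" "Ws K \<tau>s zs" "wff A"
  shows "K \<tturnstile> inst zs A"
proof -
  have "entails T (image_mset Bang (mset (W_list \<Pi> \<tau>s zs) + {#bq \<Pi> \<tau>s (apps \<Sigma> (eta \<Pi> \<tau>s) zs) A#})) (inst zs A)"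
    using A5 assms(3) Ws_trms[OF assms(2)] by (simp add: A5_def C_eta_def bangW_def)
  from prov_app_bang[OF this] show ?thesis using assms(1) Ws_W_list[OF assms(2)] by auto
qed

lemma join_rule:
  assumes "K \<tturnstile> bq \<Pi> \<tau>s (apps \<Sigma> (join \<Pi> \<tau>s) (xs @ ys)) A" "Ws K (hat \<Pi> \<tau>s) xs" "Ws K (hat \<Pi> \<tau>s) ys" "wff A"
  shows "K \<tturnstile> bq \<Pi> \<tau>s xs A" "K \<tturnstile> bq \<Pi> \<tau>s ys A"
proof -
  have "entails T (image_mset Bang (mset (W_list \<Pi> (hat \<Pi> \<tau>s) xs) + mset (W_list \<Pi> (hat \<Pi> \<tau>s) ys) +
      {#bq \<Pi> \<tau>s (apps \<Sigma> (join \<Pi> \<tau>s) (xs @ ys)) A#})) (Tensor (bq \<Pi> \<tau>s xs A) (bq \<Pi> \<tau>s ys A))"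
    using A5 assms(4) Ws_trms[OF assms(2)] Ws_trms[OF assms(3)]
    by (simp add: A5_def C_join_def bangW_def Let_def)
  from prov_app_bang[OF this] have "K \<tturnstile> Tensor (bq \<Pi> \<tau>s xs A) (bq \<Pi> \<tau>s ys A)"
    using assms(1) Ws_W_list[OF assms(2)] Ws_W_list[OF assms(3)] by auto
  then show "K \<tturnstile> bq \<Pi> \<tau>s xs A" "K \<tturnstile> bq \<Pi> \<tau>s ys A"
    using assms(4) Ws_trms[OF assms(2)] Ws_trms[OF assms(3)] by (auto dest: prov_tensor_E intro: bq_wf)
qed

lemma circ_rule:
  assumes "K \<tturnstile> bq \<Pi> \<tau>s (apps \<Sigma> (circ \<Pi> \<rho>s \<tau>s) (fs @ zs)) A"
    "Ws K (\<rho>s \<Rrightarrow> hat \<Pi> \<tau>s) fs" "Ws K (hat \<Pi> \<rho>s) zs" "wff A"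
  shows "K \<tturnstile> bq \<Pi> \<rho>s zs (Bang (bq \<Pi> \<tau>s (apps \<Sigma> (map (shift_trm (length \<rho>s)) fs) (vars (length \<rho>s)))
    (subst_lfm (lift_sub (length \<tau>s) (\<lambda>n. Var (n + length \<rho>s))) A)))" (is "K \<tturnstile> ?G")
proof -
  have "entails T (image_mset Bang (mset (W_list \<Pi> (\<rho>s \<Rrightarrow> hat \<Pi> \<tau>s) fs) + mset (W_list \<Pi> (hat \<Pi> \<rho>s) zs) +
      {#bq \<Pi> \<tau>s (apps \<Sigma> (circ \<Pi> \<rho>s \<tau>s) (fs @ zs)) A#})) ?G"
    using A5 assms(4) Ws_trms[OF assms(2)] Ws_trms[OF assms(3)]
    by (simp add: A5_def C_circ_def bangW_def Let_def)
  from prov_app_bang[OF this] show ?thesis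
    using assms(1) Ws_W_list[OF assms(2)] Ws_W_list[OF assms(3)] by auto
qed

text \<open>\<open>Q1\<close> is applied with \<open>Bang A\<close> in place of \<open>A\<close>,
  since a derivation in the sense of \<open>prov\<close> may use \<open>A\<close> repeatedly;
  \<open>circ_rule\<close> delivers a banged body of this kind. The side formulas form a list
  because \<open>Q1\<close> needs finitely many of them, shifted past the bound variables.\<close>

lemma bq_mono_rule:
  assumes "set (map (shift_lfm (length \<tau>s)) Ks) \<union> set (W_list \<Pi> \<tau>s (vars (length \<tau>s))) \<union> {A} \<tturnstile> B"
    "K \<tturnstile> bq \<Pi> \<tau>s a (Bang A)" "set Ks \<subseteq> K" "\<forall>D \<in> set Ks. wff D" "wff A" "wff B"
    "trms (lang T) (hat \<Pi> \<tau>s) a"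
  shows "K \<tturnstile> bq \<Pi> \<tau>s a B"
proof -
  let ?k = "length \<tau>s"
  let ?M = "mset (map (shift_lfm ?k) Ks) + mset (W_list \<Pi> \<tau>s (vars ?k)) + {#A#}"
  have "entails T (image_mset Bang ?M) B"
    by (rule entails_if_prov[OF assms(1)])
      (use assms(4,5) in \<open>auto dest: W_list_wf[OF trms_vars]\<close>)
  then have "entails T (image_mset Bang (image_mset (shift_lfm ?k) (mset Ks)) +
       bangW \<Pi> \<tau>s (vars ?k) + {#Bang A#}) B"
    by (simp add: bangW_def)
  moreover have "\<forall>D \<in># mset Ks. wff D" "wff (Bang A)" using assms(4,5) by auto
  ultimately have "entails T (image_mset Bang (mset Ks) + {#bq \<Pi> \<tau>s a (Bang A)#}) (bq \<Pi> \<tau>s a B)"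
    using A5 assms(6,7) unfolding A5_def Q1_def by blast
  then show ?thesis
    by (rule prov_app) (use assms(2-4) in \<open>auto intro: prov_bang prov_hyp\<close>)
qed

end

subsection \<open>Merging two witnesses along a boolean\<close>

locale bool_target = target \<Sigma> \<Pi> S T
  for \<Sigma> :: "('f, 'p) omega_symbols" and \<Pi> :: "('f, 'p) params"
    and S T :: "('f, 'p, ('f, 'p) lfm) thy" +
  assumes A6: "A6 \<Sigma> \<Pi> S T" and boolP_comp: "boolP \<Sigma> \<in> comp_preds \<Pi>"
begin

lemma W_list_single [simp]: "W_list \<Pi> [\<tau>] [t] = [W \<tau> t]"
  by (simp add: W_list_def)

abbreviation bty :: ty where "bty \<equiv> wtype \<Pi> (boolP \<Sigma>)"

abbreviation Bwit :: "'f trm \<Rightarrow> 'f trm \<Rightarrow> ('f, 'p) lfm" where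
  "Bwit u b \<equiv> witP \<Pi> (boolP \<Sigma>) [u] b"

lemma Bwit_wf: "wft u \<Longrightarrow> wft b \<Longrightarrow> wff (Bwit u b)"
  by (rule witP_wf[OF boolP_comp]) auto

lemma Bwit_subst: "subst_lfm \<sigma> (Bwit u b) = Bwit (subst_trm \<sigma> u) (subst_trm \<sigma> b)"
  by (subst witP_subst[OF boolP_comp]) auto

text \<open>Allows both cases of the distinction to be treated in one induction: \<open>e\<close> is
  the boolean constant of the case and \<open>x\<close> the tuple of witnesses that belongs to
  it.\<close>

definition branch :: "'f trm \<Rightarrow> 'f trm list \<Rightarrow> 'f trm list \<Rightarrow> 'f trm list \<Rightarrow> bool" where
  "branch e x x1 x2 \<longleftrightarrow> e = tt \<Sigma> \<and> x = x1 \<or> e = ff \<Sigma> \<and> x = x2"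

text \<open>A list, as required for the side formulas of \<open>bq_mono_rule\<close>. It depends on
  \<open>C\<close> only through its types, so substitution in \<open>C\<close>, a quantifier in
  front of \<open>C\<close> and shifting of \<open>C\<close> leave it unchanged.\<close>

definition merge_hyps :: "('f, 'p) lfm \<Rightarrow> 'f trm \<Rightarrow> 'f trm \<Rightarrow> 'f trm list \<Rightarrow> 'f trm list \<Rightarrow> 'f trm list \<Rightarrow>
    ('f, 'p) lfm list" where
  "merge_hyps C e b x1 x2 w =
     Bwit e b # W_list \<Pi> [bty] [b] @ W_list \<Pi> (tpos \<Pi> C) x1 @ W_list \<Pi> (tpos \<Pi> C) x2 @ W_list \<Pi> (tneg \<Pi> C) w"

definition valid_args :: "('f, 'p) lfm \<Rightarrow> 'f trm \<Rightarrow> 'f trm list \<Rightarrow> 'f trm list \<Rightarrow> 'f trm list \<Rightarrow> bool" where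
  "valid_args C b x1 x2 w \<longleftrightarrow> wft b \<and> trms (lang T) (tpos \<Pi> C) x1 \<and> trms (lang T) (tpos \<Pi> C) x2 \<and>
     trms (lang T) (tneg \<Pi> C) w"

text \<open>
  The terms \<open>m\<close> merge the witnesses \<open>x1\<close> and \<open>x2\<close> of the two cases; the terms \<open>g\<close> turn a challenge
  to the merged witness into one to the witness of the actual case. They do not depend on the
  terms occurring in \<open>C\<close>, hence the substitution \<open>\<sigma>\<close>.
\<close>

definition merges :: "('f, 'p) lfm \<Rightarrow> 'f trm list \<Rightarrow> 'f trm list \<Rightarrow> bool" where
  "merges C m g \<longleftrightarrow> closed_Ws ((bty # tpos \<Pi> C @ tpos \<Pi> C) \<Rrightarrow> tpos \<Pi> C) m \<and>
     closed_Ws (tneg \<Pi> C \<Rrightarrow> tneg \<Pi> C) g \<and>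
     (\<forall>\<sigma> e b x x1 x2 w. (\<forall>n. wft (\<sigma> n)) \<longrightarrow> valid_args C b x1 x2 w \<longrightarrow> branch e x x1 x2 \<longrightarrow>
        insert (interp \<Sigma> \<Pi> (subst_lfm \<sigma> C) x (apps \<Sigma> g w)) (set (merge_hyps C e b x1 x2 w)) \<tturnstile>
        interp \<Sigma> \<Pi> (subst_lfm \<sigma> C) (apps \<Sigma> m (b # x1 @ x2)) w)"

lemma branch_wf: "branch e x x1 x2 \<Longrightarrow> wft e"
  by (auto simp: branch_def)

lemma branch_closed: "branch e x x1 x2 \<Longrightarrow> subst_trm \<sigma> e = e"
  by (auto simp: branch_def)

lemma branch_trms: "branch e x x1 x2 \<Longrightarrow> trms (lang T) \<tau>s x1 \<Longrightarrow> trms (lang T) \<tau>s x2 \<Longrightarrow> trms (lang T) \<tau>s x"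
  by (auto simp: branch_def)

lemma branch_map: "branch e x x1 x2 \<Longrightarrow> branch e (f x) (f x1) (f x2)"
  by (auto simp: branch_def)

lemma merges_closed:
  assumes "merges C m g"
  shows "closed_Ws ((bty # tpos \<Pi> C @ tpos \<Pi> C) \<Rrightarrow> tpos \<Pi> C) m" "closed_Ws (tneg \<Pi> C \<Rrightarrow> tneg \<Pi> C) g"
  using assms by (auto simp: merges_def)

lemma trms_apps_closed:
  "closed_Ws (\<rho>s \<Rrightarrow> \<sigma>s) ts \<Longrightarrow> list_all wft us \<Longrightarrow> trms (lang T) \<sigma>s (apps \<Sigma> ts us)"
  using closed_Ws_wf[of "\<rho>s \<Rrightarrow> \<sigma>s" ts] by (auto simp: trms_def wft_apps dest!: list_all2_lengthD)

lemma mergesE: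
  assumes "merges C m g" "K \<tturnstile> interp \<Sigma> \<Pi> (subst_lfm \<sigma> C) x (apps \<Sigma> g w)" "K \<tturnstile> Bwit e b"
    "\<And>n. wft (\<sigma> n)" "branch e x x1 x2" "Ws K [bty] [b]" "Ws K (tpos \<Pi> C) x1" "Ws K (tpos \<Pi> C) x2"
    "Ws K (tneg \<Pi> C) w"
  shows "K \<tturnstile> interp \<Sigma> \<Pi> (subst_lfm \<sigma> C) (apps \<Sigma> m (b # x1 @ x2)) w"
proof (rule prov_cuts)
  have "valid_args C b x1 x2 w"
    using assms(6-9) by (auto simp: valid_args_def dest: Ws_trms)
  then show "insert (interp \<Sigma> \<Pi> (subst_lfm \<sigma> C) x (apps \<Sigma> g w)) (set (merge_hyps C e b x1 x2 w)) \<tturnstile>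
      interp \<Sigma> \<Pi> (subst_lfm \<sigma> C) (apps \<Sigma> m (b # x1 @ x2)) w"
    using assms(1,4,5) by (auto simp: merges_def)
qed (use assms in \<open>auto simp: merge_hyps_def dest: Ws_W_list\<close>)

lemma merge_hyps_prov:
  assumes "valid_args C b x1 x2 w" "branch e x x1 x2" "set (merge_hyps C e b x1 x2 w) \<subseteq> K"
  shows "K \<tturnstile> Bwit e b" "Ws K [bty] [b]" "Ws K (tpos \<Pi> C) x1" "Ws K (tpos \<Pi> C) x2" "Ws K (tneg \<Pi> C) w"
  using assms branch_wf[OF assms(2)]
  by (auto simp: merge_hyps_def valid_args_def trms_def intro!: prov_hyp Bwit_wf Ws_hyp)
    (auto simp: W_list_def intro!: prov_hyp W_wf)

lemma merge_hyps_wf: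
  assumes "valid_args C b x1 x2 w" "branch e x x1 x2" "D \<in> set (merge_hyps C e b x1 x2 w)"
  shows "wff D"
  using assms branch_wf[OF assms(2)] W_list_wf[of "[bty]" "[b]"]
  by (auto simp: merge_hyps_def valid_args_def intro: Bwit_wf W_list_wf simp: trms_def)

lemma merge_hyps_shift:
  assumes "branch e x x1 x2"
  shows "map (shift_lfm k) (merge_hyps C e b x1 x2 w) = merge_hyps C e (shift_trm k b)
    (map (shift_trm k) x1) (map (shift_trm k) x2) (map (shift_trm k) w)"
  using branch_closed[OF assms]
  by (simp add: merge_hyps_def W_list_subst W_subst Bwit_subst shift_lfm_def shift_trm_def[abs_def])

lemma valid_args_shift: "valid_args C b x1 x2 w \<Longrightarrow>
    valid_args C (shift_trm k b) (map (shift_trm k) x1) (map (shift_trm k) x2) (map (shift_trm k) w)"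
  by (auto simp: valid_args_def intro: trms_map)

text \<open>For the cases in which no binder is crossed, an arbitrary \<open>K\<close> hides the
  concrete hypotheses. The quantifiers and the bang work with the definition instead, because they
  shift the list of hypotheses.\<close>

lemma mergesI:
  assumes "closed_Ws ((bty # tpos \<Pi> C @ tpos \<Pi> C) \<Rrightarrow> tpos \<Pi> C) m" "closed_Ws (tneg \<Pi> C \<Rrightarrow> tneg \<Pi> C) g" "wff C"
    and "\<And>\<sigma> e b x x1 x2 w K. (\<And>n. wft (\<sigma> n)) \<Longrightarrow> wff (subst_lfm \<sigma> C) \<Longrightarrow> branch e x x1 x2 \<Longrightarrow>
      K \<tturnstile> Bwit e b \<Longrightarrow> Ws K [bty] [b] \<Longrightarrow> Ws K (tpos \<Pi> C) x1 \<Longrightarrow> Ws K (tpos \<Pi> C) x2 \<Longrightarrow> Ws K (tneg \<Pi> C) w \<Longrightarrow>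
      K \<tturnstile> interp \<Sigma> \<Pi> (subst_lfm \<sigma> C) x (apps \<Sigma> g w) \<Longrightarrow>
      K \<tturnstile> interp \<Sigma> \<Pi> (subst_lfm \<sigma> C) (apps \<Sigma> m (b # x1 @ x2)) w"
  shows "merges C m g"
  unfolding merges_def
proof (intro conjI assms(1,2) allI impI)
  fix \<sigma> :: "nat \<Rightarrow> 'f trm" and e b x x1 x2 w
  assume \<sigma>: "\<forall>n. wft (\<sigma> n)" and args: "valid_args C b x1 x2 w" and br: "branch e x x1 x2"
  let ?H = "interp \<Sigma> \<Pi> (subst_lfm \<sigma> C) x (apps \<Sigma> g w)"
  let ?K = "insert ?H (set (merge_hyps C e b x1 x2 w))"
  have wf: "wff (subst_lfm \<sigma> C)" using assms(3) \<sigma> by (simp add: wf_subst_lfm)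
  have "wff ?H"
    using wf args br assms(2)
    by (intro interp_wf) (auto simp: valid_args_def trms_def branch_def intro!: wft_apps
        dest: closed_Ws_wf list_all2_lengthD)
  then have "?K \<tturnstile> ?H" by (intro prov_hyp) auto
  then show "?K \<tturnstile> interp \<Sigma> \<Pi> (subst_lfm \<sigma> C) (apps \<Sigma> m (b # x1 @ x2)) w"
    using merge_hyps_prov[OF args br, of ?K] \<sigma> br wf by (intro assms(4)) auto
qed

section \<open>Merging at atoms, tensor and implication\<close>

lemma merges_trivial:
  assumes "tpos \<Pi> C = []" "tneg \<Pi> C = []" "wff C" shows "merges C [] []"
  by (rule mergesI) (use assms in \<open>auto simp: branch_def\<close>)

lemma ite_eqv:
  assumes "wft s" "wft t" shows "ite \<Sigma> (tt \<Sigma>) s t \<approx> s" "ite \<Sigma> (ff \<Sigma>) s t \<approx> t"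
  using assms omega_axiom[of "IPred (eqP \<Sigma>) [ite \<Sigma> (tt \<Sigma>) s t, s]"]
    omega_axiom[of "IPred (eqP \<Sigma>) [ite \<Sigma> (ff \<Sigma>) s t, t]"]
  by (simp_all add: eqv_def ILomega_axioms.ILB ILB_axioms.if_true ILB_axioms.if_false)

lemma merges_Pred:
  assumes "wff (Pred P ts)" "P \<in> comp_preds \<Pi>" shows "\<exists>m. merges (Pred P ts) m []"
proof -
  obtain m where m: "closed_trm (lang T) m"
    "entails T {#} (W_suc \<Pi> [bty \<rightarrow> wtype \<Pi> P \<rightarrow> wtype \<Pi> P \<rightarrow> wtype \<Pi> P] [m])"
    "\<And>xs x1 x2 z b. length xs = length ts \<Longrightarrow> list_all wft (xs @ [x1, x2, z, b]) \<Longrightarrow>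
       entails T (bangW \<Pi> [wtype \<Pi> P, wtype \<Pi> P] [x1, x2] +
              {#Bang (Bwit z b), Bang (witP \<Pi> P xs (ite \<Sigma> z x1 x2))#})
             (witP \<Pi> P xs (app \<Sigma> (app \<Sigma> (app \<Sigma> m b) x1) x2))"
    using A6 comp_pred_ar[of P "length ts"] assms unfolding A6_def by auto metis
  have "closed_Ws [bty \<rightarrow> wtype \<Pi> P \<rightarrow> wtype \<Pi> P \<rightarrow> wtype \<Pi> P] [m]"
    unfolding closed_Ws_iff using m(1,2) by (simp add: closed_trms_def)
  then have "merges (Pred P ts) [m] []"
  proof (rule_tac mergesI; simp add: fun_tys_def assms(2) del: wf_lfm.simps)
    show "wff (Pred P ts)" by (rule assms)
    fix \<sigma> :: "nat \<Rightarrow> 'f trm" and e b x x1 x2 w K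
    assume \<sigma>: "\<And>n. wft (\<sigma> n)" and br: "branch e x x1 x2" and wf: "wff (Pred P (map (subst_trm \<sigma>) ts))"
      and B: "K \<tturnstile> Bwit e b" and b: "wft b \<and> K \<tturnstile> W bty b"
      and x1: "Ws K [wtype \<Pi> P] x1" and x2: "Ws K [wtype \<Pi> P] x2"
      and H: "K \<tturnstile> witP \<Pi> P (map (subst_trm \<sigma>) ts) (hd x)"
    obtain y1 where y1: "x1 = [y1]" "wft y1" "K \<tturnstile> W (wtype \<Pi> P) y1" using x1 by (auto simp: list_all2_Cons1)
    obtain y2 where y2: "x2 = [y2]" "wft y2" "K \<tturnstile> W (wtype \<Pi> P) y2" using x2 by (auto simp: list_all2_Cons1)
    have wfts: "list_all wft (map (subst_trm \<sigma>) ts)" using wf by simp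
    \<comment> \<open>\<open>A6\<close> expects a witness of the form \<open>if(z, x1, x2)\<close>.
      With the constant \<open>e\<close> for \<open>z\<close> it is provably equal to the witness of
      the actual case.\<close>
    have "ite \<Sigma> e y1 y2 \<approx> hd x"
      using br y1 y2 by (auto simp: branch_def intro: ite_eqv)
    from witP_eqv[OF H eqv_sym[OF this] assms(2) wf]
    have *: "K \<tturnstile> witP \<Pi> P (map (subst_trm \<sigma>) ts) (ite \<Sigma> e y1 y2)" .
    have "entails T (image_mset Bang ({#W (wtype \<Pi> P) y1, W (wtype \<Pi> P) y2, Bwit e b,
        witP \<Pi> P (map (subst_trm \<sigma>) ts) (ite \<Sigma> e y1 y2)#}))
      (witP \<Pi> P (map (subst_trm \<sigma>) ts) (app \<Sigma> (app \<Sigma> (app \<Sigma> m b) y1) y2))"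
      using m(3)[of "map (subst_trm \<sigma>) ts" y1 y2 e b] y1 y2 b wfts branch_wf[OF br]
      by (simp add: bangW_def W_list_def add_mset_commute)
    from prov_app_bang[OF this] show "K \<tturnstile> witP \<Pi> P (map (subst_trm \<sigma>) ts) (hd (apps \<Sigma> [m] (b # x1 @ x2)))"
      using * B y1 y2 by (auto simp: apps_def)
  qed
  then show ?thesis by blast
qed

lemma closed_Ws_list_all: "closed_Ws \<tau>s ts \<Longrightarrow> list_all wft us \<Longrightarrow> list_all wft (apps \<Sigma> ts us)"
  by (simp add: wft_apps closed_Ws_wf)

lemma merges_Tensor:
  assumes "merges A mA gA" "merges B mB gB" "wff A" "wff B" shows "\<exists>m g. merges (Tensor A B) m g"
proof -
  let ?pA = "tpos \<Pi> A" and ?pB = "tpos \<Pi> B" and ?nA = "tneg \<Pi> A" and ?nB = "tneg \<Pi> B"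
  let ?a = "length ?pA" and ?b = "length ?pB" and ?c = "length ?nA" and ?d = "length ?nB"
  note cA = merges_closed[OF assms(1)] and cB = merges_closed[OF assms(2)]
  let ?\<rho> = "bty # (?pA @ ?pB) @ (?pA @ ?pB)"
  \<comment> \<open>The arguments are \<open>b\<close>, \<open>y1\<close>, \<open>z1\<close>,
    \<open>y2\<close>, \<open>z2\<close>, where each \<open>y\<close> belongs to \<open>A\<close>
    and each \<open>z\<close> to \<open>B\<close>; the blocks regroup them into \<open>b\<close>,
    \<open>y1\<close>, \<open>y2\<close> and \<open>b\<close>, \<open>z1\<close>,
    \<open>z2\<close>.\<close>
  have blocks: "reps ?\<rho> [bty] (\<lambda>xs. take 1 (drop 0 xs))"
    "reps ?\<rho> ?pA (\<lambda>xs. take ?a (drop 1 xs))" "reps ?\<rho> ?pA (\<lambda>xs. take ?a (drop (1 + ?a + ?b) xs))"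
    "reps ?\<rho> ?pB (\<lambda>xs. take ?b (drop (1 + ?a) xs))"
    "reps ?\<rho> ?pB (\<lambda>xs. take ?b (drop (1 + ?a + ?b + ?a) xs))"
    by (rule reps_block[of _ "[]"] reps_block[of _ "[bty]"] reps_block[of _ "bty # ?pA @ ?pB"]
        reps_block[of _ "bty # ?pA"] reps_block[of _ "bty # ?pA @ ?pB @ ?pA" _ "[]"]; simp; fail)+
  have "closed_Ws (([bty] @ ?pA @ ?pA) \<Rrightarrow> ?pA) mA" "closed_Ws (([bty] @ ?pB @ ?pB) \<Rrightarrow> ?pB) mB"
    using cA cB by simp_all
  from reps_append[OF
      reps_apps[OF reps_const[OF this(1)] reps_append[OF blocks(1) reps_append[OF blocks(2,3)]]]
      reps_apps[OF reps_const[OF this(2)] reps_append[OF blocks(1) reps_append[OF blocks(4,5)]]]]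
  obtain m where m: "closed_Ws (?\<rho> \<Rrightarrow> ?pA @ ?pB) m" "\<And>xs. trms (lang T) ?\<rho> xs \<Longrightarrow> apps \<Sigma> m xs \<approx>\<^sub>l
      apps \<Sigma> mA (take 1 (drop 0 xs) @ take ?a (drop 1 xs) @ take ?a (drop (1 + ?a + ?b) xs)) @
      apps \<Sigma> mB (take 1 (drop 0 xs) @ take ?b (drop (1 + ?a) xs) @ take ?b (drop (1 + ?a + ?b + ?a) xs))"
    by (rule reps_closed_terms) blast
  have "reps (?nA @ ?nB) ?nA (\<lambda>xs. take ?c (drop 0 xs))" "reps (?nA @ ?nB) ?nB (\<lambda>xs. take ?d (drop ?c xs))"
    by (rule reps_block[of _ "[]"] reps_block[of _ ?nA _ "[]"]; simp; fail)+
  from reps_append[OF reps_apps[OF reps_const[OF cA(2)] this(1)] reps_apps[OF reps_const[OF cB(2)] this(2)]]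
  obtain g where g: "closed_Ws ((?nA @ ?nB) \<Rrightarrow> ?nA @ ?nB) g" "\<And>xs. trms (lang T) (?nA @ ?nB) xs \<Longrightarrow>
      apps \<Sigma> g xs \<approx>\<^sub>l apps \<Sigma> gA (take ?c (drop 0 xs)) @ apps \<Sigma> gB (take ?d (drop ?c xs))"
    by (rule reps_closed_terms) blast
  have "merges (Tensor A B) m g"
  proof (rule mergesI)
    show "closed_Ws ((bty # tpos \<Pi> (Tensor A B) @ tpos \<Pi> (Tensor A B)) \<Rrightarrow> tpos \<Pi> (Tensor A B)) m"
      "closed_Ws (tneg \<Pi> (Tensor A B) \<Rrightarrow> tneg \<Pi> (Tensor A B)) g"
      using m(1) g(1) by simp_all
    show "wff (Tensor A B)" using assms by simp
    fix \<sigma> :: "nat \<Rightarrow> 'f trm" and e b x x1 x2 w K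
    let ?A = "subst_lfm \<sigma> A" and ?B = "subst_lfm \<sigma> B"
    assume \<sigma>: "\<And>n. wft (\<sigma> n)" and br: "branch e x x1 x2" and wf: "wff (subst_lfm \<sigma> (Tensor A B))"
      and B: "K \<tturnstile> Bwit e b" and b: "Ws K [bty] [b]"
      and x1: "Ws K (tpos \<Pi> (Tensor A B)) x1" and x2: "Ws K (tpos \<Pi> (Tensor A B)) x2"
      and w: "Ws K (tneg \<Pi> (Tensor A B)) w"
      and H: "K \<tturnstile> interp \<Sigma> \<Pi> (subst_lfm \<sigma> (Tensor A B)) x (apps \<Sigma> g w)"
    obtain y1 z1 where 1: "x1 = y1 @ z1" "Ws K ?pA y1" "Ws K ?pB z1"
      using x1 by (auto simp: list_all2_append1)
    obtain y2 z2 where 2: "x2 = y2 @ z2" "Ws K ?pA y2" "Ws K ?pB z2"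
      using x2 by (auto simp: list_all2_append1)
    obtain u v where 3: "w = u @ v" "Ws K ?nA u" "Ws K ?nB v"
      using w by (auto simp: list_all2_append1)
    obtain y z where 4: "x = y @ z" "branch e y y1 y2" "branch e z z1 z2"
      using br 1 2 by (auto simp: branch_def)
    note t = 1(2,3)[THEN Ws_trms] 2(2,3)[THEN Ws_trms] 3(2,3)[THEN Ws_trms] b[THEN Ws_trms]
    have t': "trms (lang T) ?pA y" "trms (lang T) ?pB z" using 4 t by (auto simp: branch_def)
    note len [simp] = t(1-6)[THEN trmsD(1)] t'[THEN trmsD(1)]
    note wft [simp] = t(1-6)[THEN trmsD(2)] t'[THEN trmsD(2)]
    have wb [simp]: "wft b" using b by simp
    have wfAB: "wff ?A" "wff ?B" using wf by simp_all
    have m_eq: "apps \<Sigma> m (b # x1 @ x2) \<approx>\<^sub>l apps \<Sigma> mA (b # y1 @ y2) @ apps \<Sigma> mB (b # z1 @ z2)"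
      using m(2)[of "b # x1 @ x2"] by (simp add: 1(1) 2(1) trms_def)
    have g_eq: "apps \<Sigma> g w \<approx>\<^sub>l apps \<Sigma> gA u @ apps \<Sigma> gB v"
      using g(2)[of w] by (simp add: 3(1) trms_def)
    have tg: "trms (lang T) ?nA (apps \<Sigma> gA u)" "trms (lang T) ?nB (apps \<Sigma> gB v)"
      using cA cB by (auto intro: trms_apps_closed)
    have tm: "trms (lang T) ?pA (apps \<Sigma> mA (b # y1 @ y2))" "trms (lang T) ?pB (apps \<Sigma> mB (b # z1 @ z2))"
      using cA cB by (auto intro: trms_apps_closed)
    have "K \<tturnstile> interp \<Sigma> \<Pi> (Tensor ?A ?B) x (apps \<Sigma> gA u @ apps \<Sigma> gB v)"
      by (rule interp_eqv[OF _ eqvs_refl g_eq])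
        (use H wfAB t' 3(1) g(1) in \<open>auto simp: 4(1) trms_append_append intro: trms_apps_closed\<close>)
    then have H': "K \<tturnstile> Tensor (interp \<Sigma> \<Pi> ?A y (apps \<Sigma> gA u)) (interp \<Sigma> \<Pi> ?B z (apps \<Sigma> gB v))"
      using tg[THEN trmsD(1)] by (simp add: 4(1) Let_def)
    have "wff (interp \<Sigma> \<Pi> ?A y (apps \<Sigma> gA u))" "wff (interp \<Sigma> \<Pi> ?B z (apps \<Sigma> gB v))"
      using wfAB t' tg by (auto intro: interp_wf)
    note HAB = prov_tensor_E[OF H' this]
    have "K \<tturnstile> interp \<Sigma> \<Pi> ?A (apps \<Sigma> mA (b # y1 @ y2)) u"
      by (rule mergesE[OF assms(1) HAB(1) B \<sigma> 4(2) b 1(2) 2(2) 3(2)])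
    moreover have "K \<tturnstile> interp \<Sigma> \<Pi> ?B (apps \<Sigma> mB (b # z1 @ z2)) v"
      by (rule mergesE[OF assms(2) HAB(2) B \<sigma> 4(3) b 1(3) 2(3) 3(3)])
    ultimately have "K \<tturnstile> interp \<Sigma> \<Pi> (Tensor ?A ?B) (apps \<Sigma> mA (b # y1 @ y2) @ apps \<Sigma> mB (b # z1 @ z2)) w"
      using tm[THEN trmsD(1)] by (auto simp: 3(1) Let_def intro: prov_tensor_I)
    then have "K \<tturnstile> interp \<Sigma> \<Pi> (Tensor ?A ?B) (apps \<Sigma> m (b # x1 @ x2)) w"
      by (rule interp_eqv[OF _ eqvs_sym[OF m_eq] eqvs_refl])
        (use wfAB tm t tm[THEN trmsD(1)] in \<open>auto simp: 3(1) trms_append_append\<close>)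
    then show "K \<tturnstile> interp \<Sigma> \<Pi> (subst_lfm \<sigma> (Tensor A B)) (apps \<Sigma> m (b # x1 @ x2)) w" by simp
  qed
  then show ?thesis by blast
qed

text \<open>The argument \<open>us\<close> for \<open>A\<close> is shared by the two functions, so
  only the values in \<open>B\<close> are merged. The challenges to \<open>A\<close> demanded by the
  two functions are bounds; assuming \<open>A\<close> up to their join gives the premise of the
  implication in either case.\<close>

lemma merges_Lolli:
  assumes "merges B mB gB" "wff A" "wff B" shows "\<exists>m g. merges (Lolli (Bang A) B) m g"
proof -
  let ?C = "Lolli (Bang A) B"
  let ?p = "tpos \<Pi> A" and ?h = "hat \<Pi> (tneg \<Pi> A)" and ?q = "tpos \<Pi> B" and ?r = "tneg \<Pi> B"
  let ?F = "?p \<Rrightarrow> ?q" and ?G = "?p \<Rrightarrow> ?r \<Rrightarrow> ?h"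
  let ?a = "length ?p" and ?b = "length ?q" and ?c = "length ?h" and ?d = "length ?r"
  let ?\<rho> = "bty # (?F @ ?G) @ (?F @ ?G)"
  note cB = merges_closed[OF assms(1)]
  have cB': "closed_Ws (([bty] @ ?q @ ?q) \<Rrightarrow> ?q) mB" using cB by simp
  \<comment> \<open>The arguments are \<open>b\<close>, \<open>f1\<close>, \<open>g1\<close>,
    \<open>f2\<close>, \<open>g2\<close> and \<open>us\<close>; for the second component of the
    merged witness, \<open>ws\<close> follows.\<close>
  have blocks: "reps (?\<rho> @ ?p) [bty] (\<lambda>xs. take 1 (drop 0 xs))"
    "reps (?\<rho> @ ?p) ?F (\<lambda>xs. take ?b (drop 1 xs))"
    "reps (?\<rho> @ ?p) ?F (\<lambda>xs. take ?b (drop (1 + ?b + ?c) xs))"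
    "reps (?\<rho> @ ?p) ?p (\<lambda>xs. take ?a (drop (1 + ?b + ?c + ?b + ?c) xs))"
    by (rule reps_block[of _ "[]"] reps_block[of _ "[bty]"] reps_block[of _ "bty # ?F @ ?G"]
        reps_block[of _ ?\<rho> _ "[]"]; simp; fail)+
  from reps_apps[OF reps_const[OF cB'] reps_append[OF blocks(1)
      reps_append[OF reps_apps[OF blocks(2,4)] reps_apps[OF blocks(3,4)]]]]
  obtain fm where fm: "closed_Ws ((?\<rho> @ ?p) \<Rrightarrow> ?q) fm" "\<And>xs. trms (lang T) (?\<rho> @ ?p) xs \<Longrightarrow>
      apps \<Sigma> fm xs \<approx>\<^sub>l apps \<Sigma> mB (take 1 (drop 0 xs) @
        apps \<Sigma> (take ?b (drop 1 xs)) (take ?a (drop (1 + ?b + ?c + ?b + ?c) xs)) @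
        apps \<Sigma> (take ?b (drop (1 + ?b + ?c) xs)) (take ?a (drop (1 + ?b + ?c + ?b + ?c) xs)))"
    by (rule reps_closed_terms) blast
  have blocks: "reps (?\<rho> @ ?p @ ?r) ((?p @ ?r) \<Rrightarrow> ?h) (\<lambda>xs. take ?c (drop (1 + ?b) xs))"
    "reps (?\<rho> @ ?p @ ?r) ((?p @ ?r) \<Rrightarrow> ?h) (\<lambda>xs. take ?c (drop (1 + ?b + ?c + ?b) xs))"
    "reps (?\<rho> @ ?p @ ?r) ?p (\<lambda>xs. take ?a (drop (1 + ?b + ?c + ?b + ?c) xs))"
    "reps (?\<rho> @ ?p @ ?r) ?r (\<lambda>xs. take ?d (drop (1 + ?b + ?c + ?b + ?c + ?a) xs))"
    unfolding fun_tys_append_left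
    by (rule reps_block[of _ "bty # ?F"] reps_block[of _ "bty # ?F @ ?G @ ?F"]
        reps_block[of _ ?\<rho>] reps_block[of _ "?\<rho> @ ?p" _ "[]"]; simp; fail)+
  \<comment> \<open>This is the tuple \<open>us\<close> followed by \<open>gB ws\<close>. The given
    implication will be used at the challenge \<open>gB ws\<close> to \<open>B\<close>, so the
    bounds on the challenges to \<open>A\<close> are computed there and not at
    \<open>ws\<close>.\<close>
  note chall = reps_append[OF blocks(3) reps_apps[OF reps_const[OF cB(2)] blocks(4)]]
  have "closed_Ws ((?h @ ?h) \<Rrightarrow> ?h) (join \<Pi> (tneg \<Pi> A))"
    unfolding fun_tys_append_left by (rule join_closed)
  from reps_apps[OF reps_const[OF this]
      reps_append[OF reps_apps[OF blocks(1) chall] reps_apps[OF blocks(2) chall]]]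
  obtain gm where gm: "closed_Ws ((?\<rho> @ ?p @ ?r) \<Rrightarrow> ?h) gm" "\<And>xs. trms (lang T) (?\<rho> @ ?p @ ?r) xs \<Longrightarrow>
      apps \<Sigma> gm xs \<approx>\<^sub>l apps \<Sigma> (join \<Pi> (tneg \<Pi> A))
       (apps \<Sigma> (take ?c (drop (1 + ?b) xs)) (take ?a (drop (1 + ?b + ?c + ?b + ?c) xs) @
          apps \<Sigma> gB (take ?d (drop (1 + ?b + ?c + ?b + ?c + ?a) xs))) @
        apps \<Sigma> (take ?c (drop (1 + ?b + ?c + ?b) xs)) (take ?a (drop (1 + ?b + ?c + ?b + ?c) xs) @
          apps \<Sigma> gB (take ?d (drop (1 + ?b + ?c + ?b + ?c + ?a) xs))))"
    by (rule reps_closed_terms) blast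
  have "reps (?p @ ?r) ?p (\<lambda>xs. take ?a (drop 0 xs))" "reps (?p @ ?r) ?r (\<lambda>xs. take ?d (drop ?a xs))"
    by (rule reps_block[of _ "[]"] reps_block[of _ ?p _ "[]"]; simp; fail)+
  from reps_append[OF this(1) reps_apps[OF reps_const[OF cB(2)] this(2)]]
  obtain g where g: "closed_Ws ((?p @ ?r) \<Rrightarrow> ?p @ ?r) g" "\<And>xs. trms (lang T) (?p @ ?r) xs \<Longrightarrow>
      apps \<Sigma> g xs \<approx>\<^sub>l take ?a (drop 0 xs) @ apps \<Sigma> gB (take ?d (drop ?a xs))"
    by (rule reps_closed_terms) blast
  have fgm: "closed_Ws (?\<rho> \<Rrightarrow> ?F @ ?G) (fm @ gm)"
    unfolding fun_tys_append_right using fm(1) gm(1)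
    by (intro list_all2_appendI) (simp_all only: fun_tys_append_left)
  have "merges ?C (fm @ gm) g"
  proof (rule mergesI)
    show "closed_Ws ((bty # tpos \<Pi> ?C @ tpos \<Pi> ?C) \<Rrightarrow> tpos \<Pi> ?C) (fm @ gm)"
      "closed_Ws (tneg \<Pi> ?C \<Rrightarrow> tneg \<Pi> ?C) g"
      using fgm g(1) by simp_all
    show "wff ?C" using assms by simp
    fix \<sigma> :: "nat \<Rightarrow> 'f trm" and e b x x1 x2 w K
    let ?A = "subst_lfm \<sigma> A" and ?B = "subst_lfm \<sigma> B"
    assume \<sigma>: "\<And>n. wft (\<sigma> n)" and br: "branch e x x1 x2" and wf: "wff (subst_lfm \<sigma> ?C)"
      and B: "K \<tturnstile> Bwit e b" and b: "Ws K [bty] [b]"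
      and x1: "Ws K (tpos \<Pi> ?C) x1" and x2: "Ws K (tpos \<Pi> ?C) x2" and w: "Ws K (tneg \<Pi> ?C) w"
      and H: "K \<tturnstile> interp \<Sigma> \<Pi> (subst_lfm \<sigma> ?C) x (apps \<Sigma> g w)"
    obtain f1 g1 where 1: "x1 = f1 @ g1" "Ws K ?F f1" "Ws K ?G g1"
      using x1 by (auto simp: list_all2_append1)
    obtain f2 g2 where 2: "x2 = f2 @ g2" "Ws K ?F f2" "Ws K ?G g2"
      using x2 by (auto simp: list_all2_append1)
    obtain us ws where 3: "w = us @ ws" "Ws K ?p us" "Ws K ?r ws"
      using w by (auto simp: list_all2_append1)
    obtain f g' where 4: "x = f @ g'" "branch e f f1 f2" "branch e g' g1 g2"
      using br 1 2 by (auto simp: branch_def)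
    note t = 1(2,3)[THEN Ws_trms] 2(2,3)[THEN Ws_trms] 3(2,3)[THEN Ws_trms]
    have t': "trms (lang T) ?F f" "trms (lang T) ?G g'" using 4 t by (auto simp: branch_def)
    note len [simp] = t[THEN trmsD(1), simplified] t'[THEN trmsD(1), simplified]
    note wft [simp] = t[THEN trmsD(2)] t'[THEN trmsD(2)]
    have wb [simp]: "wft b" using b by simp
    have wfAB: "wff ?A" "wff ?B" using wf by simp_all
    let ?k = "length (tneg \<Pi> A)" and ?vs = "apps \<Sigma> gB ws"
    let ?X = "interp \<Sigma> \<Pi> (shift_lfm ?k ?A) (map (shift_trm ?k) us) (vars ?k)"
    let ?xs = "b # x1 @ x2"
    let ?Fm = "apps \<Sigma> fm ?xs" and ?Gm = "apps \<Sigma> gm ?xs"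
    have wfX: "wff ?X"
      using wfAB t(5) by (intro interp_wf) (auto intro: trms_map)
    have tvs: "trms (lang T) ?r ?vs" using cB by (intro trms_apps_closed) auto
    have wvs: "list_all wft ?vs" using tvs by (rule trmsD)
    have [simp]: "length fm = ?b" "length gm = ?c"
      using list_all2_lengthD[OF fm(1)] list_all2_lengthD[OF gm(1)] by simp_all
    have wxs: "list_all wft ?xs" by (simp add: 1 2)
    have wFm: "list_all wft ?Fm" and wGm: "list_all wft ?Gm"
      using closed_Ws_list_all[OF fm(1) wxs] closed_Ws_list_all[OF gm(1) wxs] .
    have Fm_eq: "apps \<Sigma> ?Fm us \<approx>\<^sub>l apps \<Sigma> mB (b # apps \<Sigma> f1 us @ apps \<Sigma> f2 us)"
      unfolding apps_append[symmetric] using fm(2)[of "?xs @ us"] by (simp add: 1(1) 2(1) trms_def)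
    have Gm_eq: "apps \<Sigma> ?Gm (us @ ws) \<approx>\<^sub>l apps \<Sigma> (join \<Pi> (tneg \<Pi> A))
        (apps \<Sigma> g1 (us @ ?vs) @ apps \<Sigma> g2 (us @ ?vs))"
      unfolding apps_append[of _ ?xs, symmetric]
      using gm(2)[of "?xs @ us @ ws"] by (simp add: 1(1) 2(1) trms_def)
    have g_eq: "apps \<Sigma> g w \<approx>\<^sub>l us @ ?vs" using g(2)[of w] by (simp add: 3(1) trms_def)
    have tGm: "trms (lang T) ?h (apps \<Sigma> ?Gm (us @ ws))"
      using wGm by (simp add: trms_def wft_apps)
    have tc: "trms (lang T) ?h (apps \<Sigma> g' (us @ ?vs))" using wvs by (simp add: trms_def wft_apps)
    have tf: "trms (lang T) ?q (apps \<Sigma> f us)" by (simp add: trms_def wft_apps)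
    have "K \<tturnstile> interp \<Sigma> \<Pi> (Lolli (Bang ?A) ?B) x (us @ ?vs)"
      by (rule interp_eqv[OF _ eqvs_refl g_eq])
        (use H wfAB t' 3(1) g(1) in \<open>auto simp: 4(1) trms_append_append intro: trms_apps_closed\<close>)
    then have H': "K \<tturnstile> Lolli (Bang (bq \<Pi> (tneg \<Pi> A) (apps \<Sigma> g' (us @ ?vs)) ?X))
        (interp \<Sigma> \<Pi> ?B (apps \<Sigma> f us) ?vs)"
      by (simp add: 4(1) Let_def)
    \<comment> \<open>The premise of the implication to be proved, with the joined bound; it is
      assumed from here on and discharged at the end.\<close>
    let ?D = "bq \<Pi> (tneg \<Pi> A) (apps \<Sigma> ?Gm (us @ ws)) ?X"
    let ?K = "insert ?D K"
    have wfD: "wff ?D" using tGm wfX by (rule bq_wf)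
    have "?K \<tturnstile> bq \<Pi> (tneg \<Pi> A) (apps \<Sigma> (join \<Pi> (tneg \<Pi> A)) (apps \<Sigma> g1 (us @ ?vs) @ apps \<Sigma> g2 (us @ ?vs))) ?X"
      using Gm_eq wfX tGm by (rule_tac bq_eqv[OF prov_hyp]) (auto intro: wfD)
    moreover have mono: "Ws ?K \<tau>s ts" if "Ws K \<tau>s ts" for \<tau>s ts using that by (rule Ws_mono) auto
    have "Ws K (?p @ ?r) (us @ ?vs)"
      using 3 cB by (intro list_all2_appendI Ws_apps[OF closed_Ws_Ws]) auto
    then have "Ws ?K ?h (apps \<Sigma> g1 (us @ ?vs))" "Ws ?K ?h (apps \<Sigma> g2 (us @ ?vs))"
      using 1(3) 2(3) unfolding fun_tys_append_left[symmetric] by (auto intro: mono Ws_apps)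
    ultimately have "?K \<tturnstile> bq \<Pi> (tneg \<Pi> A) (apps \<Sigma> g' (us @ ?vs)) ?X"
      using 4(3) wfX by (auto simp: branch_def dest: join_rule)
    then have "?K \<tturnstile> interp \<Sigma> \<Pi> ?B (apps \<Sigma> f us) ?vs"
      by (rule prov_imp_E[OF prov_mono[OF H'], rotated])
        (use wfX wfAB tc tf tvs in \<open>auto intro: bq_wf interp_wf\<close>)
    moreover have "branch e (apps \<Sigma> f us) (apps \<Sigma> f1 us) (apps \<Sigma> f2 us)"
      using 4(2) by (auto simp: branch_def)
    moreover have "Ws ?K ?q (apps \<Sigma> f1 us)" "Ws ?K ?q (apps \<Sigma> f2 us)"
      using 1(2) 2(2) 3(2) by (auto intro: mono Ws_apps)
    moreover have "?K \<tturnstile> Bwit e b" using B by (rule prov_mono) auto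
    ultimately have "?K \<tturnstile> interp \<Sigma> \<Pi> ?B (apps \<Sigma> mB (b # apps \<Sigma> f1 us @ apps \<Sigma> f2 us)) ws"
      using mergesE[OF assms(1)] \<sigma> mono[OF b] mono[OF 3(3)] by blast
    then have "?K \<tturnstile> interp \<Sigma> \<Pi> ?B (apps \<Sigma> ?Fm us) ws"
      by (rule interp_eqv[OF _ eqvs_sym[OF Fm_eq] eqvs_refl])
        (use wfAB t cB in \<open>auto intro!: trms_apps_closed wft_apps\<close>)
    then have "K \<tturnstile> Lolli (Bang ?D) (interp \<Sigma> \<Pi> ?B (apps \<Sigma> ?Fm us) ws)"
      using wfD by (rule prov_imp_I)
    then show "K \<tturnstile> interp \<Sigma> \<Pi> (subst_lfm \<sigma> ?C) (apps \<Sigma> (fm @ gm) (b # x1 @ x2)) w"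
      by (simp add: 3(1) apps_append_left Let_def)
  qed
  then show ?thesis by blast
qed

section \<open>Merging under quantifiers and bang\<close>

lemma map_shift_apps_closed:
  "closed_Ws \<tau>s ts \<Longrightarrow> map (shift_trm k) (apps \<Sigma> ts us) = apps \<Sigma> ts (map (shift_trm k) us)"
  using closed_Ws_subst[of \<tau>s ts] by (simp add: shift_trm_def map_subst_apps)

text \<open>The terms \<open>m\<close> and \<open>g\<close> are closed, so a shift passes through
  them to their arguments, and merging applies to the shifted arguments and shifted
  hypotheses.\<close>

lemma merges_under_binder:
  assumes "merges A m g" "\<And>n. wft (\<sigma> n)" "valid_args A b x1 x2 w" "branch e x x1 x2"
    "shift_lfm k ` set (merge_hyps A e b x1 x2 w) \<subseteq> K"
    "K \<tturnstile> interp \<Sigma> \<Pi> (subst_lfm \<sigma> A) (map (shift_trm k) x) (map (shift_trm k) (apps \<Sigma> g w))"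
  shows "K \<tturnstile> interp \<Sigma> \<Pi> (subst_lfm \<sigma> A) (map (shift_trm k) (apps \<Sigma> m (b # x1 @ x2))) (map (shift_trm k) w)"
proof -
  note c = merges_closed[OF assms(1)]
  have "set (merge_hyps A e (shift_trm k b) (map (shift_trm k) x1) (map (shift_trm k) x2) (map (shift_trm k) w)) \<subseteq> K"
    using assms(5) by (simp flip: merge_hyps_shift[OF assms(4)])
  note h = merge_hyps_prov[OF valid_args_shift[OF assms(3)] branch_map[OF assms(4)] this]
  show ?thesis
    using mergesE[OF assms(1) _ h(1) assms(2) branch_map[OF assms(4)] h(2-5)] assms(6)
    by (simp add: map_shift_apps_closed[OF c(1)] map_shift_apps_closed[OF c(2)])
qed

text \<open>Quantifiers do not affect the types, so the terms for the body can be kept. The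
  substitution pushed under the binder is covered because \<open>merges\<close> ranges over all
  well-formed substitutions.\<close>

lemma merges_All:
  assumes "merges A m g" "wff A" shows "merges (All A) m g"
  unfolding merges_def
proof (intro conjI allI impI)
  note c = merges_closed[OF assms(1)]
  show "closed_Ws ((bty # tpos \<Pi> (All A) @ tpos \<Pi> (All A)) \<Rrightarrow> tpos \<Pi> (All A)) m"
    "closed_Ws (tneg \<Pi> (All A) \<Rrightarrow> tneg \<Pi> (All A)) g"
    using c by simp_all
  fix \<sigma> :: "nat \<Rightarrow> 'f trm" and e b x x1 x2 w
  assume \<sigma>: "\<forall>n. wft (\<sigma> n)" and "valid_args (All A) b x1 x2 w" and br: "branch e x x1 x2"
  then have args: "valid_args A b x1 x2 w" by (simp add: valid_args_def)
  have hyps: "merge_hyps (All A) e b x1 x2 w = merge_hyps A e b x1 x2 w" by (simp add: merge_hyps_def)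
  let ?A = "subst_lfm (lift_sub 1 \<sigma>) A"
  have wf\<sigma>: "\<And>n. wft (lift_sub 1 \<sigma> n)" using \<sigma> by (simp add: wf_lift_sub)
  have wfA: "wff ?A" using assms(2) wf\<sigma> by (rule wf_subst_lfm)
  let ?X = "interp \<Sigma> \<Pi> ?A (map (shift_trm 1) x) (map (shift_trm 1) (apps \<Sigma> g w))"
  let ?Y = "interp \<Sigma> \<Pi> ?A (map (shift_trm 1) (apps \<Sigma> m (b # x1 @ x2))) (map (shift_trm 1) w)"
  let ?K = "insert (All ?X) (set (merge_hyps A e b x1 x2 w))"
  have wfX: "wff ?X"
    using wfA args br c by (intro interp_wf trms_map branch_trms[OF br] trms_apps_closed)
      (auto simp: valid_args_def dest: trmsD)
  have "?K \<tturnstile> All ?Y"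
  proof (rule prov_all_mono)
    show "insert ?X (shift_lfm 1 ` ?K) \<tturnstile> ?Y"
      using wfX by (intro merges_under_binder[OF assms(1) wf\<sigma> args br]) (auto intro: prov_hyp)
  qed (use wfX in auto)
  then show "insert (interp \<Sigma> \<Pi> (subst_lfm \<sigma> (All A)) x (apps \<Sigma> g w)) (set (merge_hyps (All A) e b x1 x2 w)) \<tturnstile>
      interp \<Sigma> \<Pi> (subst_lfm \<sigma> (All A)) (apps \<Sigma> m (b # x1 @ x2)) w"
    by (simp add: hyps)
qed

text \<open>The value of the quantified variable is not part of the witness, so one eigenvariable
  serves premise and conclusion. Both bodies are banged, which is the form that
  \<open>prov_ex_mono\<close> requires.\<close>

lemma merges_Ex:
  assumes "merges (Bang A) m g" "wff A" shows "merges (Ex (Bang A)) m g"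
  unfolding merges_def
proof (intro conjI allI impI)
  let ?C = "Ex (Bang A)"
  note c = merges_closed[OF assms(1)]
  show "closed_Ws ((bty # tpos \<Pi> ?C @ tpos \<Pi> ?C) \<Rrightarrow> tpos \<Pi> ?C) m" "closed_Ws (tneg \<Pi> ?C \<Rrightarrow> tneg \<Pi> ?C) g"
    using c by simp_all
  fix \<sigma> :: "nat \<Rightarrow> 'f trm" and e b x x1 x2 w
  assume \<sigma>: "\<forall>n. wft (\<sigma> n)" and "valid_args ?C b x1 x2 w" and br: "branch e x x1 x2"
  then have args: "valid_args (Bang A) b x1 x2 w" by (simp add: valid_args_def)
  have hyps: "merge_hyps ?C e b x1 x2 w = merge_hyps (Bang A) e b x1 x2 w" by (simp add: merge_hyps_def)
  let ?A = "subst_lfm (lift_sub 1 \<sigma>) (Bang A)"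
  have wf\<sigma>: "\<And>n. wft (lift_sub 1 \<sigma> n)" using \<sigma> by (simp add: wf_lift_sub)
  have wfA: "wff ?A" using assms(2) wf\<sigma> by (intro wf_subst_lfm) auto
  let ?X = "interp \<Sigma> \<Pi> ?A (map (shift_trm 1) x) (map (shift_trm 1) (apps \<Sigma> g w))"
  let ?Y = "interp \<Sigma> \<Pi> ?A (map (shift_trm 1) (apps \<Sigma> m (b # x1 @ x2))) (map (shift_trm 1) w)"
  obtain X Y where X: "?X = Bang X" and Y: "?Y = Bang Y" by (simp add: Let_def)
  let ?K = "insert (Ex ?X) (set (merge_hyps (Bang A) e b x1 x2 w))"
  have "wff ?X" "wff ?Y"
    using wfA args br c by (intro interp_wf trms_map branch_trms[OF br] trms_apps_closed;
      auto simp: valid_args_def dest: trmsD)+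
  then have wf: "wff X" "wff Y" unfolding X Y by simp_all
  have "insert X (shift_lfm 1 ` ?K) \<tturnstile> ?X" unfolding X using wf by (intro prov_bang prov_hyp) auto
  then have "insert X (shift_lfm 1 ` ?K) \<tturnstile> ?Y"
    by (rule merges_under_binder[OF assms(1) wf\<sigma> args br, rotated]) auto
  then have "insert X (shift_lfm 1 ` ?K) \<tturnstile> Y" using wf unfolding Y by (auto dest: prov_bang_E)
  moreover have "?K \<tturnstile> Ex (Bang X)" unfolding X using wf by (intro prov_hyp) auto
  ultimately have "?K \<tturnstile> Ex (Bang Y)" using wf by (rule prov_ex_mono)
  then have "?K \<tturnstile> Ex ?Y" unfolding Y .
  then show "insert (interp \<Sigma> \<Pi> (subst_lfm \<sigma> ?C) x (apps \<Sigma> g w)) (set (merge_hyps ?C e b x1 x2 w)) \<tturnstile>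
      interp \<Sigma> \<Pi> (subst_lfm \<sigma> ?C) (apps \<Sigma> m (b # x1 @ x2)) w"
    by (simp add: hyps)
qed

lemma body_wf:
  assumes "wff A" "trms (lang T) (tpos \<Pi> A) xs" "k = length (tneg \<Pi> A)"
  shows "wff (interp \<Sigma> \<Pi> (shift_lfm k A) (map (shift_trm k) xs) (vars k))"
  using assms by (intro interp_wf) (auto intro: trms_map)

text \<open>Used after \<open>eta_rule\<close>: what that rule extracts from the body of
  \<open>|!A|\<close> is \<open>|A|\<close> at the challenge \<open>zs\<close>.\<close>

lemma inst_body:
  assumes "wff A" "trms (lang T) (tpos \<Pi> A) xs" "trms (lang T) (tneg \<Pi> A) zs" "k = length (tneg \<Pi> A)"
  shows "inst zs (interp \<Sigma> \<Pi> (shift_lfm k A) (map (shift_trm k) xs) (vars k)) = interp \<Sigma> \<Pi> A xs zs"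
proof -
  have len: "length zs = k" using assms(3,4) by (simp add: trms_def)
  have "subst_lfm (inst_sub zs) (shift_lfm k A) = A"
    using inst_shift[OF len] by (simp add: inst_eq)
  moreover have "map (subst_trm (inst_sub zs)) (map (shift_trm k) xs) = xs"
    by (simp add: shift_trm_inst[OF len] map_idI)
  moreover have "map (subst_trm (inst_sub zs)) (vars k) = zs"
    using len by (auto simp: vars_def inst_sub_def intro: nth_equalityI)
  ultimately show ?thesis
    unfolding inst_eq using assms
    by (subst interp_subst) (auto intro: trms_map wf_inst_sub dest: trmsD simp del: map_map)
qed

text \<open>
  The challenge \<open>a\<close> bounds the challenges \<open>w\<close> to the merged witness; the challenges \<open>g w\<close> to the
  given one are bounded by \<open>(\<lambda>w. \<eta> (g w)) \<circ> a\<close>.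
\<close>

lemma merges_Bang:
  assumes "merges A m g" "wff A" shows "\<exists>g'. merges (Bang A) m g'"
proof -
  let ?n = "tneg \<Pi> A"
  let ?k = "length ?n" and ?h = "hat \<Pi> ?n"
  note c = merges_closed[OF assms(1)]
  have "reps ?n ?n (\<lambda>xs. take ?k (drop 0 xs))" by (rule reps_block[of _ "[]" _ "[]"]) simp_all
  from reps_apps[OF reps_const[OF eta_closed] reps_apps[OF reps_const[OF c(2)] this]]
  obtain fs where fs: "closed_Ws (?n \<Rrightarrow> ?h) fs" "\<And>xs. trms (lang T) ?n xs \<Longrightarrow>
      apps \<Sigma> fs xs \<approx>\<^sub>l apps \<Sigma> (eta \<Pi> ?n) (apps \<Sigma> g (take ?k (drop 0 xs)))"
    by (rule reps_closed_terms) blast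
  have "closed_Ws (((?n \<Rrightarrow> ?h) @ ?h) \<Rrightarrow> ?h) (circ \<Pi> ?n ?n)"
    unfolding fun_tys_append_left by (rule circ_closed)
  moreover have "reps ?h ?h (\<lambda>xs. take (length ?h) (drop 0 xs))" by (rule reps_block[of _ "[]" _ "[]"]) simp_all
  ultimately obtain g' where g': "closed_Ws (?h \<Rrightarrow> ?h) g'" "\<And>xs. trms (lang T) ?h xs \<Longrightarrow>
      apps \<Sigma> g' xs \<approx>\<^sub>l apps \<Sigma> (circ \<Pi> ?n ?n) (fs @ take (length ?h) (drop 0 xs))"
    using reps_closed_terms[OF reps_apps[OF reps_const reps_append[OF reps_const[OF fs(1)]]]] by blast
  have "merges (Bang A) m g'"
    unfolding merges_def
  proof (intro conjI allI impI)
    show "closed_Ws ((bty # tpos \<Pi> (Bang A) @ tpos \<Pi> (Bang A)) \<Rrightarrow> tpos \<Pi> (Bang A)) m"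
      "closed_Ws (tneg \<Pi> (Bang A) \<Rrightarrow> tneg \<Pi> (Bang A)) g'"
      using c g' by simp_all
    fix \<sigma> :: "nat \<Rightarrow> 'f trm" and e b x x1 x2 a
    assume \<sigma>: "\<forall>n. wft (\<sigma> n)" and args: "valid_args (Bang A) b x1 x2 a" and br: "branch e x x1 x2"
    let ?A = "subst_lfm \<sigma> A"
    have wfA: "wff ?A" using assms(2) \<sigma> by (simp add: wf_subst_lfm)
    have wb: "wft b" and x1: "trms (lang T) (tpos \<Pi> A) x1" and x2: "trms (lang T) (tpos \<Pi> A) x2"
      and a: "trms (lang T) ?h a"
      using args by (auto simp: valid_args_def)
    have x: "trms (lang T) (tpos \<Pi> A) x" using br x1 x2 by (rule branch_trms)
    let ?y = "apps \<Sigma> m (b # x1 @ x2)"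
    have y: "trms (lang T) (tpos \<Pi> A) ?y"
      using c wb x1 x2 by (intro trms_apps_closed) (auto dest: trmsD)
    let ?sh = "map (shift_trm ?k)" and ?A' = "shift_lfm ?k ?A"
    let ?X = "interp \<Sigma> \<Pi> ?A' (?sh x) (vars ?k)" and ?Y = "interp \<Sigma> \<Pi> ?A' (?sh ?y) (vars ?k)"
    have wfX: "wff ?X" and wfY: "wff ?Y" using wfA x y by (auto intro!: body_wf)
    let ?H = "bq \<Pi> ?n (apps \<Sigma> g' a) ?X" and ?Ks = "merge_hyps (Bang A) e b x1 x2 a"
    let ?K = "insert (Bang ?H) (set ?Ks)"
    have tg': "trms (lang T) ?h (apps \<Sigma> g' a)" using g'(1) a by (auto intro: trms_apps_closed dest: trmsD)
    have wfH: "wff ?H" using tg' wfX by (rule bq_wf)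
    have h: "?K \<tturnstile> Bwit e b" "Ws ?K [bty] [b]" "Ws ?K (tpos \<Pi> A) x1" "Ws ?K (tpos \<Pi> A) x2" "Ws ?K ?h a"
      using merge_hyps_prov[OF args br, of ?K] by auto
    have "?K \<tturnstile> ?H" using wfH by (intro prov_bang_E[OF prov_hyp]) auto
    then have "?K \<tturnstile> bq \<Pi> ?n (apps \<Sigma> (circ \<Pi> ?n ?n) (fs @ a)) ?X"
      using g'(2)[OF a] wfX tg' trmsD(1)[OF a] by (auto elim: bq_eqv)
    note circ = circ_rule[OF this closed_Ws_Ws[OF fs(1)] h(5) wfX]
    \<comment> \<open>The body now stands below two blocks of bound variables: its own indices are
      kept, and the remaining ones are raised past the outer block.\<close>
    let ?sub = "lift_sub ?k (\<lambda>n. Var (n + ?k))"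
    let ?Xs = "subst_lfm ?sub ?X"
    let ?Z = "bq \<Pi> ?n (apps \<Sigma> fs (vars ?k)) ?Xs"
    have Z: "?K \<tturnstile> bq \<Pi> ?n a (Bang ?Z)"
      using circ by (simp add: closed_Ws_shift[OF fs(1)])
    have wfX1: "wff ?Xs" using wfX by (intro wf_subst_lfm wf_lift_sub) auto
    have tfs: "trms (lang T) ?h (apps \<Sigma> fs (vars ?k))" using fs(1) by (intro trms_apps_closed) auto
    have wfZ: "wff ?Z" using tfs wfX1 by (rule bq_wf)
    have "?K \<tturnstile> bq \<Pi> ?n a ?Y"
    proof (rule bq_mono_rule[OF _ Z])
      let ?L = "set (map (shift_lfm ?k) ?Ks) \<union> set (W_list \<Pi> ?n (vars ?k)) \<union> {?Z}"
      let ?b = "shift_trm ?k b"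
      have Wv: "Ws ?L ?n (vars ?k)" by (rule Ws_hyp) auto
      have Wg: "Ws ?L ?n (apps \<Sigma> g (vars ?k))" using c Wv by (intro Ws_apps[OF closed_Ws_Ws])
      have "?L \<tturnstile> ?Z" using wfZ by (intro prov_hyp) auto
      then have "?L \<tturnstile> bq \<Pi> ?n (apps \<Sigma> (eta \<Pi> ?n) (apps \<Sigma> g (vars ?k))) ?Xs"
        using fs(2)[OF trms_vars] wfX1 tfs by (auto elim: bq_eqv)
      from eta_rule[OF this Wg wfX1] have inst: "?L \<tturnstile> inst (apps \<Sigma> g (vars ?k)) ?Xs" .
      \<comment> \<open>The shifted body is recognised as an interpretation again, so that its
        instance can be evaluated by \<open>inst_body\<close>.\<close>
      have "?Xs = interp \<Sigma> \<Pi> (shift_lfm ?k ?A') (?sh (?sh x)) (vars ?k)"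
      proof -
        have "?Xs = interp \<Sigma> \<Pi> (subst_lfm ?sub ?A') (map (subst_trm ?sub) (?sh x)) (map (subst_trm ?sub) (vars ?k))"
          using wfA x by (intro interp_subst) (auto intro: trms_map wf_lift_sub)
        also have "subst_lfm ?sub ?A' = shift_lfm ?k ?A'"
          unfolding subst_lift_shift_lfm by (simp add: shift_lfm_def)
        also have "map (subst_trm ?sub) (?sh x) = ?sh (?sh x)"
          unfolding map_shift_map by (simp add: shift_trm_def[abs_def])
        finally show ?thesis by (simp add: map_lift_vars)
      qed
      then have "inst (apps \<Sigma> g (vars ?k)) ?Xs =
          inst (apps \<Sigma> g (vars ?k)) (interp \<Sigma> \<Pi> (shift_lfm ?k ?A') (?sh (?sh x)) (vars ?k))"
        by (rule arg_cong)
      also have "\<dots> = interp \<Sigma> \<Pi> ?A' (?sh x) (apps \<Sigma> g (vars ?k))"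
        using wfA x Ws_trms[OF Wg] by (intro inst_body) (auto intro: trms_map)
      finally have H: "?L \<tturnstile> interp \<Sigma> \<Pi> ?A' (?sh x) (apps \<Sigma> g (vars ?k))" using inst by (simp only:)
      have "set (merge_hyps (Bang A) e ?b (?sh x1) (?sh x2) (?sh a)) \<subseteq> ?L"
        unfolding merge_hyps_shift[OF br, symmetric] by blast
      note hL = merge_hyps_prov[OF valid_args_shift[OF args] branch_map[OF br] this]
      \<comment> \<open>The shift is absorbed into the substitution, so that the hypothesis on
        \<open>A\<close> applies to the shifted formula.\<close>
      have A': "?A' = subst_lfm (\<lambda>n. shift_trm ?k (\<sigma> n)) A"
        by (simp add: shift_lfm_def subst_lfm_comp shift_trm_def)
      have "?L \<tturnstile> interp \<Sigma> \<Pi> ?A' (apps \<Sigma> m (?b # ?sh x1 @ ?sh x2)) (vars ?k)"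
        using hL(3,4) \<sigma>
        by (intro mergesE[OF assms(1), where \<sigma> = "\<lambda>n. shift_trm ?k (\<sigma> n)", folded A',
              OF H hL(1) _ branch_map[OF br, of ?sh] hL(2) _ _ Wv]) simp_all
      then show "?L \<tturnstile> ?Y" by (simp add: map_shift_apps_closed[OF c(1)])
    qed (use args br wfZ wfY a in \<open>auto dest: merge_hyps_wf\<close>)
    from prov_bang[OF this]
    show "insert (interp \<Sigma> \<Pi> (subst_lfm \<sigma> (Bang A)) x (apps \<Sigma> g' a)) (set ?Ks) \<tturnstile>
        interp \<Sigma> \<Pi> (subst_lfm \<sigma> (Bang A)) (apps \<Sigma> m (b # x1 @ x2)) a"
      by (simp add: Let_def)
  qed
  then show ?thesis by blast
qed

lemma merges_girard: "wff (girard A) \<Longrightarrow> \<exists>m g. merges (girard A) m g"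
proof (induction A)
  case IBot
  then show ?case by (intro exI[of _ "[]"] merges_trivial) simp_all
next
  case (IPred P ts)
  then show ?case
    using merges_Pred[of P ts] merges_trivial[of "Pred P ts"] by (cases "P \<in> comp_preds \<Pi>") auto
next
  case (IAnd A B)
  then show ?case by (auto dest: merges_Tensor)
next
  case (IImp A B)
  then show ?case by (auto dest: merges_Lolli)
next
  case (IAll A)
  then show ?case by (auto dest: merges_All)
next
  case (IEx A)
  then show ?case using merges_Bang merges_Ex by fastforce
qed

subsection \<open>Case distinction\<close>

text \<open>From \<open>x1\<close>, \<open>x2\<close> and \<open>b\<close> the witness is
  \<open>m b x1 x2\<close>. A challenge \<open>w\<close> to it is answered by the bound
  \<open>\<eta> (g w)\<close> for both premises about \<open>C\<close>, and by \<open>\<eta>\<close>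
  of the empty tuple for the boolean premise.\<close>

lemma witnessable_bool_cases:
  assumes C: "wff C" and "merges C m g"
  shows "witnessable \<Sigma> \<Pi> T [Bang (C\<lbrakk>tt \<Sigma>/z\<rbrakk>), Bang (C\<lbrakk>ff \<Sigma>/z\<rbrakk>), Bang (Pred (boolP \<Sigma>) [Var z])] C"
proof -
  let ?p = "tpos \<Pi> C" and ?n = "tneg \<Pi> C"
  \<comment> \<open>The boolean premise has no challenges before it is banged, but the bounding
    types of the empty tuple are not assumed to be empty, so \<open>?hb\<close> is kept as a tuple
    of its own.\<close>
  let ?h = "hat \<Pi> ?n" and ?hb = "hat \<Pi> []" and ?\<rho> = "?p @ ?p @ [bty]"
  let ?a = "length ?p" and ?k = "length ?n"
  let ?C = "\<lambda>u. subst_lfm (Var(z := u)) C"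
  let ?\<Gamma> = "[Bang (?C (tt \<Sigma>)), Bang (?C (ff \<Sigma>)), Bang (Pred (boolP \<Sigma>) [Var z])]"
  have types: "tpos_list \<Pi> ?\<Gamma> = ?\<rho>" "tneg_list \<Pi> ?\<Gamma> = ?h @ ?h @ ?hb"
    using boolP_comp by (simp_all add: tpos_list_def tneg_list_def)
  note c = merges_closed[OF assms(2)]
  have blocks: "reps ?\<rho> [bty] (\<lambda>xs. take 1 (drop (?a + ?a) xs))" "reps ?\<rho> ?p (\<lambda>xs. take ?a (drop 0 xs))"
    "reps ?\<rho> ?p (\<lambda>xs. take ?a (drop ?a xs))"
    by (rule reps_block[of _ "?p @ ?p" _ "[]"] reps_block[of _ "[]"] reps_block[of _ ?p]; simp; fail)+
  have "closed_Ws (([bty] @ ?p @ ?p) \<Rrightarrow> ?p) m" using c by simp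
  from reps_apps[OF reps_const[OF this] reps_append[OF blocks(1) reps_append[OF blocks(2,3)]]]
  obtain a where a: "closed_Ws (?\<rho> \<Rrightarrow> ?p) a" "\<And>xs. trms (lang T) ?\<rho> xs \<Longrightarrow> apps \<Sigma> a xs \<approx>\<^sub>l
      apps \<Sigma> m (take 1 (drop (?a + ?a) xs) @ take ?a (drop 0 xs) @ take ?a (drop ?a xs))"
    by (rule reps_closed_terms) blast
  have "reps (?\<rho> @ ?n) ?n (\<lambda>xs. take ?k (drop (?a + ?a + 1) xs))"
    by (rule reps_block[of _ ?\<rho> _ "[]"]) simp_all
  note bound = reps_apps[OF reps_const[OF eta_closed] reps_apps[OF reps_const[OF c(2)] this]]
  have "closed_Ws ?hb (eta \<Pi> [])" using eta_closed[of "[]"] by simp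
  from reps_append[OF bound reps_append[OF bound reps_const[OF this]]]
  obtain \<gamma> where \<gamma>: "closed_Ws ((?\<rho> @ ?n) \<Rrightarrow> ?h @ ?h @ ?hb) \<gamma>" "\<And>xs. trms (lang T) (?\<rho> @ ?n) xs \<Longrightarrow>
      apps \<Sigma> \<gamma> xs \<approx>\<^sub>l apps \<Sigma> (eta \<Pi> ?n) (apps \<Sigma> g (take ?k (drop (?a + ?a + 1) xs))) @
        apps \<Sigma> (eta \<Pi> ?n) (apps \<Sigma> g (take ?k (drop (?a + ?a + 1) xs))) @ eta \<Pi> []"
    by (rule reps_closed_terms) blast
  have main: "entails T (bangW \<Pi> ?\<rho> xs + bangW \<Pi> ?n ws + mset (interp_list \<Sigma> \<Pi> ?\<Gamma> xs (apps \<Sigma> \<gamma> (xs @ ws))))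
      (interp \<Sigma> \<Pi> C (apps \<Sigma> a xs) ws)" (is "entails T ?M ?goal")
    if xs: "trms (lang T) ?\<rho> xs" and ws: "trms (lang T) ?n ws" for xs ws
  proof -
    obtain x1 x2 b where xs': "xs = x1 @ x2 @ [b]" and x1: "trms (lang T) ?p x1" and x2: "trms (lang T) ?p x2" and b: "wft b"
    proof -
      obtain x1 y where 1: "xs = x1 @ y" "trms (lang T) ?p x1" "trms (lang T) (?p @ [bty]) y"
        using xs by (rule trms_appendE)
      obtain x2 y' where 2: "y = x2 @ y'" "trms (lang T) ?p x2" "trms (lang T) [bty] y'"
        using 1(3) by (rule trms_appendE)
      obtain b where "y' = [b]" "wft b" using 2(3) by (cases y') (auto simp: trms_def)
      then show ?thesis using that 1 2 by simp
    qed
    note len [simp] = x1[THEN trmsD(1)] x2[THEN trmsD(1)] ws[THEN trmsD(1)]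
    note wft [simp] = x1[THEN trmsD(2)] x2[THEN trmsD(2)] ws[THEN trmsD(2)] b
    have tg: "trms (lang T) ?n (apps \<Sigma> g ws)" using c by (intro trms_apps_closed) auto
    have te: "trms (lang T) ?h (apps \<Sigma> (eta \<Pi> ?n) (apps \<Sigma> g ws))"
      using trmsD[OF tg] by (intro trms_apps_closed[OF eta_closed]) auto
    have \<gamma>_eq: "apps \<Sigma> \<gamma> (xs @ ws) \<approx>\<^sub>l apps \<Sigma> (eta \<Pi> ?n) (apps \<Sigma> g ws) @ apps \<Sigma> (eta \<Pi> ?n) (apps \<Sigma> g ws) @ eta \<Pi> []"
      using \<gamma>(2)[of "xs @ ws"] xs ws by (simp add: xs' trms_def)
    then obtain c1 c2 c3 where cs: "apps \<Sigma> \<gamma> (xs @ ws) = c1 @ c2 @ c3"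
      and c1: "c1 \<approx>\<^sub>l apps \<Sigma> (eta \<Pi> ?n) (apps \<Sigma> g ws)" and c2: "c2 \<approx>\<^sub>l apps \<Sigma> (eta \<Pi> ?n) (apps \<Sigma> g ws)"
      and c3: "c3 \<approx>\<^sub>l eta \<Pi> []"
      by (auto simp: list_all2_append2)
    have len_eta: "length (eta \<Pi> ?n) = length ?h" "length (eta \<Pi> []) = length ?hb"
      using eta_closed[of ?n, THEN list_all2_lengthD] eta_closed[of "[]", THEN list_all2_lengthD] by simp_all
    have tc: "trms (lang T) ?h c1" "trms (lang T) ?h c2" "trms (lang T) ?hb c3"
      using trms_eqvs[OF c1] trms_eqvs[OF c2] trms_eqvs[OF c3] len_eta
        list_all2_lengthD[OF c1] list_all2_lengthD[OF c2] list_all2_lengthD[OF c3] by auto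
    have wfu: "wff (?C u)" if "wft u" for u using C that by (intro wf_subst_lfm) auto
    let ?X = "\<lambda>u x. interp \<Sigma> \<Pi> (shift_lfm ?k (?C u)) (map (shift_trm ?k) x) (vars ?k)"
    let ?BT = "bq \<Pi> ?n c1 (?X (tt \<Sigma>) x1)" and ?BF = "bq \<Pi> ?n c2 (?X (ff \<Sigma>) x2)"
      and ?BB = "bq \<Pi> [] c3 (Bwit (Var z) b)"
    have wfX: "wff (?X (tt \<Sigma>) x1)" "wff (?X (ff \<Sigma>) x2)" using x1 x2 by (auto intro!: body_wf wfu)
    have wfB: "wff ?BT" "wff ?BF" "wff ?BB" using wfX tc by (auto intro!: bq_wf Bwit_wf)
    let ?N = "mset (W_list \<Pi> ?\<rho> xs) + mset (W_list \<Pi> ?n ws) + {#?BT, ?BF, ?BB#}"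
    \<comment> \<open>Every premise is interpreted by a banged formula, as is every assumption in
      \<open>W\<close>, so the whole antecedent fits the format of \<open>prov\<close>.\<close>
    have M: "?M = image_mset Bang ?N"
      using boolP_comp tc[THEN trmsD(1)] unfolding cs by (simp add: bangW_def xs' Let_def vars_def)
    let ?K = "set_mset ?N"
    have Wxs: "Ws ?K ?\<rho> xs" using xs by (rule Ws_hyp) auto
    then have W: "Ws ?K ?p x1" "Ws ?K ?p x2" "Ws ?K [bty] [b]"
      by (auto simp: xs' list_all2_append)
    have Wws: "Ws ?K ?n ws" using ws by (rule Ws_hyp) auto
    have Wg: "Ws ?K ?n (apps \<Sigma> g ws)" using c Wws by (intro Ws_apps[OF closed_Ws_Ws])
    have branch_hyp: "?K \<tturnstile> interp \<Sigma> \<Pi> (?C u) x (apps \<Sigma> g ws)"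
      if "c' \<approx>\<^sub>l apps \<Sigma> (eta \<Pi> ?n) (apps \<Sigma> g ws)" "bq \<Pi> ?n c' (?X u x) \<in> ?K" "wft u" "trms (lang T) ?p x"
        "trms (lang T) ?h c'" for c' u x
    proof -
      have wf: "wff (?X u x)" using that by (auto intro!: body_wf wfu)
      then have "?K \<tturnstile> bq \<Pi> ?n c' (?X u x)" using that by (intro prov_hyp bq_wf) auto
      then have "?K \<tturnstile> bq \<Pi> ?n (apps \<Sigma> (eta \<Pi> ?n) (apps \<Sigma> g ws)) (?X u x)"
        using that wf by (auto elim: bq_eqv)
      from eta_rule[OF this Wg wf] show ?thesis using inst_body[of "?C u"] wfu that tg by simp
    qed
    have caseT: "?K \<tturnstile> interp \<Sigma> \<Pi> (?C (tt \<Sigma>)) x1 (apps \<Sigma> g ws)" using x1 tc by (intro branch_hyp[OF c1]) auto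
    have caseF: "?K \<tturnstile> interp \<Sigma> \<Pi> (?C (ff \<Sigma>)) x2 (apps \<Sigma> g ws)" using x2 tc by (intro branch_hyp[OF c2]) auto
    have "?K \<tturnstile> bq \<Pi> [] (apps \<Sigma> (eta \<Pi> []) []) (Bwit (Var z) b)"
      using c3 tc(3) wfB(3) b by (simp, intro bq_eqv[OF prov_hyp]) (auto intro: Bwit_wf)
    from eta_rule[OF this] have Bz: "?K \<tturnstile> Bwit (Var z) b"
      using b by (simp add: Bwit_wf inst_Nil)
    have "entails T {#Bwit (Var z) b#} (Pred (boolP \<Sigma>) [Var z])"
      using A3 boolP_comp comp_pred_ar[OF boolP_comp symbols(2)] b by (simp add: A3_def)
    then have Pz: "?K \<tturnstile> Pred (boolP \<Sigma>) [Var z]" by (rule prov_app) (use Bz in simp)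
    let ?y = "apps \<Sigma> m (b # x1 @ x2)"
    have ty: "trms (lang T) ?p ?y" using c by (intro trms_apps_closed) auto
    \<comment> \<open>Index 0 takes the place of \<open>z\<close>, and all other indices are raised
      past it; \<open>C'\<close> is thus \<open>C\<close> abstracted over \<open>z\<close>.\<close>
    define C' where "C' = subst_lfm (\<lambda>n. if n = z then Var 0 else Var (n + 1)) C"
    \<comment> \<open>The guard is needed because \<open>b\<close> is known to witness the boolean
      \<open>z\<close>, but not \<open>T\<close> or \<open>F\<close>; in each case the corresponding
      guard provides the missing assumption of \<open>mergesE\<close>.\<close>
    define D where "D = Lolli (Bang (Bwit (Var 0) (shift_trm 1 b))) (interp \<Sigma> \<Pi> C' (map (shift_trm 1) ?y) (map (shift_trm 1) ws))"
    have tC': "trms (lang T) (tpos \<Pi> C') (map (shift_trm 1) ?y)" "trms (lang T) (tneg \<Pi> C') (map (shift_trm 1) ws)"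
      using ty ws unfolding C'_def by (auto intro: trms_map)
    have wfC': "wff C'" unfolding C'_def using C by (intro wf_subst_lfm) auto
    have wfD: "wff D" unfolding D_def using wfC' tC' by (auto intro: Bwit_wf interp_wf)
    have inst: "inst [u] D = Lolli (Bang (Bwit u b)) (interp \<Sigma> \<Pi> (?C u) ?y ws)" if "wft u" for u
    proof -
      have "subst_lfm (inst_sub [u]) C' = ?C u"
        unfolding C'_def subst_lfm_comp by (intro subst_lfm_cong) (auto simp: inst_sub_def)
      moreover have "map (subst_trm (inst_sub [u])) (map (shift_trm 1) ts) = ts" for ts
        by (simp add: shift_trm_inst map_idI del: One_nat_def)
      ultimately show ?thesis
        unfolding D_def inst_eq using interp_subst[OF wfC' tC', of "inst_sub [u]"] wf_inst_sub[of "lang T" "[u]"] that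
          shift_trm_inst[of "[u]" 1 b]
        by (simp add: Bwit_subst inst_sub_def del: map_map One_nat_def)
    qed
    have branch: "?K \<tturnstile> inst [e] D" if "branch e x x1 x2" "?K \<tturnstile> interp \<Sigma> \<Pi> (?C e) x (apps \<Sigma> g ws)" for e x
    proof -
      let ?L = "insert (Bwit e b) ?K"
      have wfe: "wft e" using that(1) by (rule branch_wf)
      have mono: "?K \<subseteq> ?L" by blast
      have "?L \<tturnstile> interp \<Sigma> \<Pi> (?C e) ?y ws"
        by (rule mergesE[OF assms(2) prov_mono[OF that(2) mono] prov_hyp _ that(1) Ws_mono[OF W(3) mono]
            Ws_mono[OF W(1) mono] Ws_mono[OF W(2) mono] Ws_mono[OF Wws mono]])
          (use wfe in \<open>auto intro: Bwit_wf\<close>)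
      from prov_imp_I[OF this Bwit_wf[OF wfe b]] show ?thesis
        unfolding inst[OF wfe] .
    qed
    have "?K \<tturnstile> inst [Var z] D"
      by (rule bool_rule[OF branch[OF _ caseT] branch[OF _ caseF] Pz _ wfD]) (simp_all add: branch_def)
    then have "?K \<tturnstile> Lolli (Bang (Bwit (Var z) b)) (interp \<Sigma> \<Pi> C ?y ws)"
      by (simp add: inst)
    then have "?K \<tturnstile> interp \<Sigma> \<Pi> C ?y ws"
      using Bz by (rule prov_imp_E) (use C ty ws in \<open>auto intro: Bwit_wf interp_wf\<close>)
    moreover have "apps \<Sigma> a xs \<approx>\<^sub>l ?y" using a(2)[OF xs] by (simp add: xs')
    ultimately have "?K \<tturnstile> ?goal"
      by (rule interp_eqv[OF _ eqvs_sym eqvs_refl]) (use C ty ws in auto)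
    then show ?thesis
      unfolding M by (rule entails_if_prov) (use xs ws wfB in \<open>auto dest: W_list_wf\<close>)
  qed
  have "closed_Ws (?\<rho> \<Rrightarrow> ?n \<Rrightarrow> ?h @ ?h @ ?hb) \<gamma>" using \<gamma>(1) by (simp only: fun_tys_append_left)
  then show ?thesis
    using a(1) main unfolding closed_Ws_iff witnessable_def subst_var_def Let_def types by blast
qed

end

theorem theorem2p10:
  fixes \<Sigma> :: "('f, 'p) omega_symbols"
    and \<Pi> :: "('f, 'p) params"
    and I :: "('f, 'p, ('f, 'p) ifm) thy"
    and As At :: "('f, 'p, ('f, 'p) lfm) thy"
    and A :: "('f, 'p) ifm"
    and z :: nat
  assumes "il_theory I" and "extends_ILB \<Sigma> I" and "As = girard_thy I"
    and "al_theory At"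
    and "A1 \<Sigma> At" and "A2 \<Pi> As At" and "A3 \<Pi> As At" and "A4 \<Sigma> \<Pi> As At" and "A5 \<Sigma> \<Pi> At"
    and "eqP \<Sigma> \<notin> comp_preds \<Pi>" and "boolP \<Sigma> \<in> comp_preds \<Pi>"
    and "A6 \<Sigma> \<Pi> As At"
    and "wf_ifm (lang I) A"
  shows "witnessable \<Sigma> \<Pi> At
    [Bang ((girard A)\<lbrakk>tt \<Sigma>/z\<rbrakk>), Bang ((girard A)\<lbrakk>ff \<Sigma>/z\<rbrakk>), Bang (Pred (boolP \<Sigma>) [Var z])]
    (girard A)"
proof -
  interpret bool_target \<Sigma> \<Pi> As At by unfold_locales fact+
  have "sublanguage (lang I) (lang At)"
    using assms(3,6) by (simp add: A2_def girard_thy_def)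
  then have "wf_lfm (lang At) (girard A)"
    using wf_girard[OF assms(13)] by (rule wf_lfm_sublanguage[rotated])
  then show ?thesis using merges_girard witnessable_bool_cases by blast
qed

end
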